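(* Let $\alpha\ge 0$ be real, $r\ge 1$ an integer, $1\le s\le\infty$, $1\le p\le\infty$, $\mu>r+1-1/s$. Let $\theta>0$ be fixed with $\theta>\mu+1/s-1-r$, let $\nu=\{\nu_k^N\}$ be an array defining a method $S_N^\nu$ of the class $\mathcal{S}^\theta$, and let $0<a_1\le a_2$ be constants. Then there is a constant $c>0$, depending only on $\alpha,r,\mu,s,p,\theta,C(\nu),a_1,a_2$, such that for every $0<\delta<1$, every $f\in L_{2,w}$ with $\|f\|_{s,\mu}\le 1$, every real sequence $\boldsymbol{\xi}=(\xi_k)_{k\in\mathbb{N}_0}$ with $\|\boldsymbol{\xi}\|_{\ell_p}\le\delta$, and every integer $N\ge r$ with $$a_1\,\delta^{-1/(\mu+1/s-1/p)}\le N\le a_2\,\delta^{-1/(\mu+1/s-1/p)},$$ one has, with $\mathbf{f}^\delta=(\langle f,\ell_k^{(\alpha)}\rangle+\xi_k)_{k\in\mathbb{N}_0}$, $$\bigl\|(f-S_N^\nu\mathbf{f}^\delta)^{(r)}\sqrt{w}\bigr\|_C\le c\,\delta^{(\mu+1/s-1-r)/(\mu+1/s-1/p)} .$$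
   Context: $w(t)=t^\alpha e^{-t}$ on $(0,\infty)$; $L_{2,w}$ is the Hilbert space of real-valued functions on $(0,\infty)$ square-summable with weight $w$, with $\langle f,g\rangle=\int_0^\infty w f g\,dt$. $L_k^{(\alpha)}$ are the Laguerre polynomials and $\ell_k^{(\alpha)}=(k!/\Gamma(k+\alpha+1))^{1/2}L_k^{(\alpha)}$, $k\in\mathbb{N}_0$, is the corresponding orthonormal system in $L_{2,w}$. For $g$ continuous on $(0,\infty)$, $\|g\|_C=\sup_{t>0}|g(t)|\in[0,+\infty]$. Conventions: $1/\infty=0$. With $\underline{k}=\max\{1,k\}$: $\|f\|_{s,\mu}=\bigl(\sum_{k\ge0}\underline{k}^{s\mu}|\langle f,\ell_k^{(\alpha)}\rangle|^s\bigr)^{1/s}$ for $1\le s<\infty$, and $\|f\|_{\infty,\mu}=\sup_{k\ge0}\underline{k}^{\mu}|\langle f,\ell_k^{(\alpha)}\rangle|$. For $\mu>r+1-1/s$ a function $f$ with $\|f\|_{s,\mu}<\infty$ is identified with its representative of class $C^r$ on $(0,\infty)$ (which exists), and $f^{(r)}$ denotes the $r$-th derivative of that representative. For a triangular array of real numbers $\nu=\{\nu_k^N\}$, $0\le k\le N$, $N\in\mathbb{N}$, and a real sequence $\mathbf{y}=(y_k)$ put $S_N^\nu\mathbf{y}(t)=\sum_{k=0}^N\nu_k^N y_k\,\ell_k^{(\alpha)}(t)$. For $\theta>0$, $\mathcal{S}^\theta$ is the class of all such methods for which there is $C(\nu)>0$ with $|1-\nu_k^N|\le C(\nu)(k/N)^\theta$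 for all $N\in\mathbb{N}$, $k=0,1,\ldots,N$ (with $0^\theta=0$). *)

theory Defs
  imports "HOL-Analysis.Analysis"
begin

text \<open>
  Functions on \<open>(0,\<infinity>)\<close> are functions of type \<open>real \<Rightarrow> real\<close>, of which only the values on
  \<open>{0<..}\<close> are used. Exponents \<open>s\<close>, \<open>p\<close> in \<open>[1,\<infinity>]\<close> have type \<^typ>\<open>ereal\<close>.
\<close>

definition laguerre_weight :: "real \<Rightarrow> real \<Rightarrow> real" where
  "laguerre_weight \<alpha> t = t powr \<alpha> * exp (- t)"

definition weighted_L2 :: "real \<Rightarrow> (real \<Rightarrow> real) set" where
  "weighted_L2 \<alpha> = {f. set_borel_measurable lebesgue {0<..} f \<and>
     set_integrable lebesgue {0<..} (\<lambda>t. laguerre_weight \<alpha> t * (f t)\<^sup>2)}"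

definition weighted_inner :: "real \<Rightarrow> (real \<Rightarrow> real) \<Rightarrow> (real \<Rightarrow> real) \<Rightarrow> real" where
  "weighted_inner \<alpha> f g = (LINT t:{0<..}|lebesgue. laguerre_weight \<alpha> t * f t * g t)"

text \<open>The explicit expansion, in the standard normalisation where the value at \<open>0\<close> is the
  generalised binomial coefficient \<open>(k + \<alpha>) gchoose k\<close>.\<close>

definition laguerre :: "real \<Rightarrow> nat \<Rightarrow> real \<Rightarrow> real" where
  "laguerre \<alpha> k t = (\<Sum>i\<le>k. (- 1) ^ i * ((real k + \<alpha>) gchoose (k - i)) * t ^ i / fact i)"

definition laguerre_on :: "real \<Rightarrow> nat \<Rightarrow> real \<Rightarrow> real" where
  "laguerre_on \<alpha> k t = sqrt (fact k / Gamma (real k + \<alpha> + 1)) * laguerre \<alpha> k t"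

definition laguerre_coeff :: "real \<Rightarrow> (real \<Rightarrow> real) \<Rightarrow> nat \<Rightarrow> real" where
  "laguerre_coeff \<alpha> f k = weighted_inner \<alpha> f (laguerre_on \<alpha> k)"

text \<open>The reciprocal exponent, with \<open>recip \<infinity> = 0\<close>.\<close>

definition recip :: "ereal \<Rightarrow> real" where
  "recip s = real_of_ereal (1 / s)"

lemma recip_simps [simp]: "recip \<infinity> = 0" "recip (ereal x) = 1 / x"
  by (auto simp: recip_def divide_ereal_def inverse_eq_divide)

text \<open>Both norms take the value \<open>\<infinity>\<close> when the series diverges or the supremum is infinite.\<close>

definition smoothness_norm :: "real \<Rightarrow> ereal \<Rightarrow> real \<Rightarrow> (real \<Rightarrow> real) \<Rightarrow> ereal" where
  "smoothness_norm \<alpha> s \<mu> f =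
    (if s = \<infinity> then (SUP k. ereal (real (max 1 k) powr \<mu> * \<bar>laguerre_coeff \<alpha> f k\<bar>))
     else let \<sigma> = real_of_ereal s;
              a = (\<lambda>k. real (max 1 k) powr (\<sigma> * \<mu>) * \<bar>laguerre_coeff \<alpha> f k\<bar> powr \<sigma>)
          in if summable a then ereal ((\<Sum>k. a k) powr (1 / \<sigma>)) else \<infinity>)"

definition ell_norm :: "ereal \<Rightarrow> (nat \<Rightarrow> real) \<Rightarrow> ereal" where
  "ell_norm p \<xi> =
    (if p = \<infinity> then (SUP k. ereal \<bar>\<xi> k\<bar>)
     else let \<pi> = real_of_ereal p; a = (\<lambda>k. \<bar>\<xi> k\<bar> powr \<pi>)
          in if summable a then ereal ((\<Sum>k. a k) powr (1 / \<pi>)) else \<infinity>)"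

definition C_norm :: "(real \<Rightarrow> real) \<Rightarrow> ereal" where
  "C_norm g = (SUP t\<in>{0<..}. ereal \<bar>g t\<bar>)"

definition C_class_pos :: "nat \<Rightarrow> (real \<Rightarrow> real) set" where
  "C_class_pos r = {g. (\<forall>j<r. \<forall>t>0. (deriv ^^ j) g field_differentiable at t) \<and>
                       continuous_on {0<..} ((deriv ^^ r) g)}"

text \<open>
  The representatives of class \<open>C\<^sup>r\<close> on \<open>(0,\<infinity>)\<close> of the a.e.-equivalence class of \<open>f\<close>.
  Any two of them coincide on \<open>(0,\<infinity>)\<close>, being continuous there.
\<close>

definition is_C_representative :: "nat \<Rightarrow> (real \<Rightarrow> real) \<Rightarrow> (real \<Rightarrow> real) \<Rightarrow> bool" where
  "is_C_representative r f g \<longleftrightarrow>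
     g \<in> C_class_pos r \<and> (AE t in lebesgue. 0 < t \<longrightarrow> g t = f t)"

definition summation_method ::
    "real \<Rightarrow> (nat \<Rightarrow> nat \<Rightarrow> real) \<Rightarrow> nat \<Rightarrow> (nat \<Rightarrow> real) \<Rightarrow> real \<Rightarrow> real" where
  "summation_method \<alpha> \<nu> N y t = (\<Sum>k\<le>N. \<nu> N k * y k * laguerre_on \<alpha> k t)"

text \<open>
  \<open>\<nu> N k\<close> stands for \<open>\<nu>\<^sub>k\<^sup>N\<close>; entries with \<open>N = 0\<close> or \<open>k > N\<close> are not part of the array.
  The class \<open>S\<^sup>\<theta>\<close> is the union of \<open>summation_class \<theta> C\<close> over all \<open>C > 0\<close>; the constant \<open>C\<close>,
  written \<open>C(\<nu>)\<close> informally, is kept explicit so that estimates can be uniform in \<open>\<nu>\<close> for given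
  \<open>C\<close>. For \<open>k = 0\<close> the bound is \<open>0\<close>, since \<open>0 powr \<theta> = 0\<close>.
\<close>

definition summation_class :: "real \<Rightarrow> real \<Rightarrow> (nat \<Rightarrow> nat \<Rightarrow> real) set" where
  "summation_class \<theta> C =
     {\<nu>. \<forall>N\<ge>1. \<forall>k\<le>N. \<bar>1 - \<nu> N k\<bar> \<le> C * (real k / real N) powr \<theta>}"

end

theory Submission
  imports Defs "HOL-Real_Asymp.Real_Asymp"
begin

text \<open>
  The heart of the matter is the uniform bound \<open>w(t) L\<^sub>n(t)\<^sup>2 \<le> K \<Gamma>(n+\<alpha>+1)/n!\<close>. With
  \<open>R = t L' + (\<alpha>-t)L/2\<close>, the Laguerre equation turns into the first order system
  \<open>t(wL\<^sup>2)' = 2wLR\<close>, \<open>t(wLR)' = w(R\<^sup>2 - QL\<^sup>2)\<close>, \<open>t(wR\<^sup>2)' = -2wQLR\<close>, where \<open>Q\<close> is a quadratic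
  polynomial with leading behaviour \<open>\<kappa>t\<close>, \<open>\<kappa> = n + (\<alpha>+1)/2\<close>. At a maximum of \<open>wL\<^sup>2\<close> the product
  \<open>LR\<close> vanishes, and integrating a suitable combination of the three identities from \<open>0\<close> or to
  \<open>\<infinity>\<close>, with \<open>\<integral>wL\<^sup>2\<close> and \<open>\<integral>wL\<^sup>2/t\<close> known, bounds the maximum; no turning point analysis is
  needed. Since \<open>L\<^sub>k' = -(L\<^sub>0 + \<dots> + L\<^sub>k\<^sub>-\<^sub>1)\<close>, the \<open>r\<close>-th derivative of the orthonormal
  function number \<open>k\<close> times \<open>\<surd>w\<close> is \<open>O(k\<^sup>r)\<close>, and Hoelder's inequality applied to the three parts
  of the error (multipliers, tail, noise) gives the theorem.
\<close>

section \<open>Laguerre polynomials\<close>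

text \<open>In the variable log t the function y = sqrt(w) L satisfies a Schrodinger equation with
  potential \<open>Q\<close>, and sqrt(w) R is its derivative there; this is why the weight drops
  out of the system. No single combination serves all maxima. Integrating to infinity uses the mass
  of w L^2; integrating from 0 uses that of w L^2 / t, which equals the former divided by \<alpha>
  and so is lost at \<alpha> = 0, where monotonicity of a Sonin function takes over. For \<alpha> >
  0, comparing 2 \<kappa> T with \<alpha>^2 decides whether the constant or the linear term of
  \<open>Q\<close> matters at the maximum T. A second obstacle: the claim concerns every C^r
  representative of an L2 class. The Laguerre series of f has to be shown to be one, which needs
  completeness of the system; it is deduced from determinacy of a moment problem. The rate is a
  balance. With e = \<mu> + 1/s - 1 - r and b = r + 1 - 1/p, multipliers and tail cost N^(-e) and
  the noise costs \<delta> N^b; both equal \<delta>^(e/(e+b)) up to constants when N is of order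
  \<delta>^(-1/(e+b)).\<close>

definition laguerre_poly :: "real \<Rightarrow> nat \<Rightarrow> real poly" where
  "laguerre_poly \<alpha> n =
     (\<Sum>i\<le>n. monom ((- 1) ^ i * ((real n + \<alpha>) gchoose (n - i)) / fact i) i)"

lemma coeff_laguerre_poly:
  "coeff (laguerre_poly \<alpha> n) i =
     (if i \<le> n then (- 1) ^ i * ((real n + \<alpha>) gchoose (n - i)) / fact i else 0)"
  unfolding laguerre_poly_def coeff_sum coeff_monom by (auto simp: sum.delta)

lemma poly_laguerre_poly [simp]: "poly (laguerre_poly \<alpha> n) t = laguerre \<alpha> n t"
  by (simp add: laguerre_poly_def laguerre_def poly_sum poly_monom)

lemma laguerre_poly_0 [simp]: "laguerre_poly \<alpha> 0 = 1"
  by (simp add: laguerre_poly_def)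

lemma laguerre_0 [simp]: "laguerre \<alpha> 0 t = 1"
  by (simp add: laguerre_def)

lemma laguerre_at_0: "laguerre 0 n 0 = 1"
proof -
  have "laguerre 0 n 0 = coeff (laguerre_poly 0 n) 0"
    by (metis poly_0_coeff_0 poly_laguerre_poly)
  then show ?thesis
    by (simp add: coeff_laguerre_poly flip: binomial_gbinomial)
qed

text \<open>Trading one degree for one unit of the parameter is what drives the induction for the L2
  norm.\<close>

lemma pderiv_laguerre_poly_shift:
  "pderiv (laguerre_poly \<alpha> (Suc n)) = - laguerre_poly (\<alpha> + 1) n"
proof (rule poly_eqI)
  fix i
  have eq: "(real (Suc n) + \<alpha>) gchoose m = (real n + (\<alpha> + 1)) gchoose m" for m
    by (rule arg_cong[where f = "\<lambda>x. x gchoose m"]) simp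
  show "coeff (pderiv (laguerre_poly \<alpha> (Suc n))) i = coeff (- laguerre_poly (\<alpha> + 1) n) i"
    by (simp add: coeff_pderiv coeff_laguerre_poly eq del: of_nat_Suc)
qed

text \<open>Pascal's rule on the coefficients. Telescoped, it expands L' in the lower L_j, which is
  used twice: to see that w L L' has integral 0, and to bound derivatives by induction.\<close>

lemma pderiv_laguerre_poly_Suc:
  "pderiv (laguerre_poly \<alpha> (Suc n)) = pderiv (laguerre_poly \<alpha> n) - laguerre_poly \<alpha> n"
proof (rule poly_eqI)
  fix i
  consider "i < n" | "i = n" | "i > n" by linarith
  then show "coeff (pderiv (laguerre_poly \<alpha> (Suc n))) i =
      coeff (pderiv (laguerre_poly \<alpha> n) - laguerre_poly \<alpha> n) i"
  proof cases
    case 1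
    then obtain m where m: "n - i = Suc m" "n - Suc i = m"
      by (metis Suc_diff_Suc)
    have "(real (Suc n) + \<alpha>) gchoose (Suc m) =
        ((real n + \<alpha>) gchoose m) + ((real n + \<alpha>) gchoose (Suc m))"
      using gbinomial_Suc_Suc[of "real n + \<alpha>" m] by (simp add: add_ac)
    with 1 m show ?thesis
      by (simp add: coeff_pderiv coeff_laguerre_poly field_simps del: of_nat_Suc)
  qed (simp_all add: coeff_pderiv coeff_laguerre_poly del: of_nat_Suc)
qed

lemma pderiv_laguerre_poly: "pderiv (laguerre_poly \<alpha> n) = - (\<Sum>j<n. laguerre_poly \<alpha> j)"
  by (induction n) (simp_all add: pderiv_laguerre_poly_Suc)

lemma laguerre_poly_ode:
  fixes n :: nat and \<alpha> :: real
  defines "p \<equiv> laguerre_poly \<alpha> n"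
  shows "t * poly (pderiv (pderiv p)) t + (\<alpha> + 1 - t) * poly (pderiv p) t = - real n * poly p t"
proof -
  have "pCons 0 (pderiv (pderiv p)) + smult (\<alpha> + 1) (pderiv p) - pCons 0 (pderiv p)
      + smult (real n) p = 0"
  proof (rule poly_eqI)
    fix i
    \<comment> \<open>The differential equation amounts to this two-term recurrence. For i < n it is
      the absorption identity for binomial coefficients; for i \<ge> n both sides are 0.\<close>
    have c: "(real i + 1) * (real i + \<alpha> + 1) * coeff p (Suc i) = (real i - real n) * coeff p i"
    proof (cases "i < n")
      case True
      then obtain m where m: "n - i = Suc m" "n - Suc i = m"
        by (metis Suc_diff_Suc)
      have nm: "real n = real i + real m + 1"
        using m True by linarith
      have "(real i + \<alpha> + 1) * ((real n + \<alpha>) gchoose m)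
          = (real m + 1) * ((real n + \<alpha>) gchoose (Suc m))"
        using gbinomial_absorb_comp[of "real n + \<alpha>" m] gbinomial_absorption[of m "real n + \<alpha>"]
          gbinomial_mult_1[of "real n + \<alpha>" m] nm
        by (simp add: algebra_simps)
      moreover have "real i - real n = - (real m + 1)"
        using nm by simp
      ultimately have "(real i + \<alpha> + 1) * ((real n + \<alpha>) gchoose m) =
          - (real i - real n) * ((real n + \<alpha>) gchoose (Suc m))"
        by simp
      note A = this
      have B: "coeff p (Suc i) * (real i + 1)
          = - ((- 1) ^ i * ((real n + \<alpha>) gchoose m) / fact i)"
      proof -
        have "fact (Suc i) = (real i + 1) * fact i" "real i + 1 \<noteq> 0"
          by simp_all
        with True m show ?thesis
          by (simp add: p_def coeff_laguerre_poly divide_simps del: fact_Suc)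
      qed
      have D: "coeff p i = (- 1) ^ i * ((real n + \<alpha>) gchoose (Suc m)) / fact i"
        using True m by (simp add: p_def coeff_laguerre_poly)
      have "(real i + 1) * (real i + \<alpha> + 1) * coeff p (Suc i)
          = (real i + \<alpha> + 1) * (coeff p (Suc i) * (real i + 1))"
        by simp
      also have "\<dots> = - ((- 1) ^ i / fact i) * ((real i + \<alpha> + 1) * ((real n + \<alpha>) gchoose m))"
        unfolding B by simp
      also have "\<dots> = (real i - real n) * coeff p i"
        unfolding A D by (simp add: field_simps)
      finally show ?thesis .
    next
      case False
      then show ?thesis
        by (cases "i = n") (simp_all add: p_def coeff_laguerre_poly)
    qed
    show "coeff (pCons 0 (pderiv (pderiv p)) + smult (\<alpha> + 1) (pderiv p) - pCons 0 (pderiv p)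
      + smult (real n) p) i = coeff 0 i"
      using c by (cases i) (simp_all add: coeff_pderiv algebra_simps)
  qed
  then have "poly (pCons 0 (pderiv (pderiv p)) + smult (\<alpha> + 1) (pderiv p) - pCons 0 (pderiv p)
      + smult (real n) p) t = 0"
    by simp
  then show ?thesis
    by (simp add: algebra_simps)
qed

section \<open>The Laguerre weight\<close>

lemma powr_exp_integrable:
  fixes a c :: real
  assumes "a > -1" "c > 0"
  shows "(\<lambda>t. t powr a * exp (- c * t)) absolutely_integrable_on {0<..}"
proof -
  \<comment> \<open>Norm of the integrand of the complex Gamma integral at the real point a + 1,
    which is absolutely integrable.\<close>
  have "(\<lambda>t. norm (complex_of_real t powr (complex_of_real (a + 1) - 1) / of_real (exp (c * t))))
      absolutely_integrable_on {0<..}"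
    using assms by (intro set_integrable_norm absolutely_integrable_Gamma_integral) auto
  then show ?thesis
    by (rule set_integrable_cong[THEN iffD1, rotated 3])
       (auto simp: norm_divide norm_powr_real_powr exp_minus field_simps)
qed

lemma powr_exp_poly_integrable:
  fixes a c :: real
  assumes "a > -1" "c > 0"
  shows "(\<lambda>t. t powr a * exp (- c * t) * poly p t) absolutely_integrable_on {0<..}"
  using assms(1)
\<comment> \<open>Horner's scheme: the factor t in front of the remaining polynomial raises the
  exponent a by 1.\<close>
proof (induction p arbitrary: a)
  case (pCons b p)
  have "(\<lambda>t. b * (t powr a * exp (- c * t)) + t powr (a + 1) * exp (- c * t) * poly p t)
      absolutely_integrable_on {0<..}"
    using pCons assms by (intro set_integral_add set_integrable_mult_right powr_exp_integrable) auto
  then show ?case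
    by (rule set_integrable_cong[THEN iffD1, rotated 3]) (auto simp: powr_add algebra_simps)
qed simp

lemma powr_exp_poly_tendsto_at_top:
  fixes a c :: real
  assumes "c > 0"
  shows "((\<lambda>t. t powr a * exp (- c * t) * poly p t) \<longlongrightarrow> 0) at_top"
proof (induction p arbitrary: a)
  case (pCons b p)
  have "((\<lambda>t. b * (t powr a * exp (- c * t)) + t powr (a + 1) * exp (- c * t) * poly p t)
      \<longlongrightarrow> b * 0 + 0) at_top"
  proof (intro tendsto_intros pCons.IH)
    show "((\<lambda>t. t powr a * exp (- c * t)) \<longlongrightarrow> 0) at_top"
      using assms by real_asymp
  qed
  moreover have "\<forall>\<^sub>F t in at_top. b * (t powr a * exp (- c * t)) + t powr (a + 1) * exp (- c * t) * poly p t
     = t powr a * exp (- c * t) * poly (pCons b p) t"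
    using eventually_gt_at_top[of 0] by eventually_elim (auto simp: powr_add algebra_simps)
  ultimately show ?case
    using tendsto_cong by force
qed simp

lemma powr_exp_poly_tendsto_at_0:
  fixes a c :: real
  assumes "a > 0"
  shows "((\<lambda>t. t powr a * exp (- c * t) * poly p t) \<longlongrightarrow> 0) (at_right 0)"
proof -
  have "((\<lambda>t. t powr a) \<longlongrightarrow> 0) (at_right 0)"
    using assms by real_asymp
  moreover have "((\<lambda>t. exp (- c * t) * poly p t) \<longlongrightarrow> exp (- c * 0) * poly p 0) (at_right 0)"
    by (intro tendsto_intros)
  ultimately show ?thesis
    using tendsto_mult by (fastforce simp: mult.assoc)
qed

lemma laguerre_weight_nonneg: "laguerre_weight a t \<ge> 0"
  by (simp add: laguerre_weight_def)

lemma laguerre_weight_pos: "t > 0 \<Longrightarrow> laguerre_weight a t > 0"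
  by (simp add: laguerre_weight_def)

lemma laguerre_weight_add_1: "t > 0 \<Longrightarrow> laguerre_weight (a + 1) t = t * laguerre_weight a t"
  by (simp add: laguerre_weight_def powr_add)

lemma laguerre_weight_integrable:
  "a > -1 \<Longrightarrow> (\<lambda>t. laguerre_weight a t * poly p t) absolutely_integrable_on {0<..}"
  using powr_exp_poly_integrable[of a 1 p] by (simp add: laguerre_weight_def)

lemma laguerre_weight_tendsto_at_top:
  "((\<lambda>t. laguerre_weight a t * poly p t) \<longlongrightarrow> 0) at_top"
  using powr_exp_poly_tendsto_at_top[of 1 a p] by (simp add: laguerre_weight_def)

lemma laguerre_weight_tendsto_at_0:
  "a > 0 \<Longrightarrow> ((\<lambda>t. laguerre_weight a t * poly p t) \<longlongrightarrow> 0) (at_right 0)"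
  using powr_exp_poly_tendsto_at_0[of a 1 p] by (simp add: laguerre_weight_def)

lemma has_derivative_laguerre_weight_poly:
  assumes "t > 0"
  shows "((\<lambda>t. laguerre_weight a t * poly p t) has_real_derivative
     laguerre_weight a t * ((a - t) * poly p t + t * poly (pderiv p) t) / t) (at t)"
proof -
  have "((\<lambda>t. t powr a) has_real_derivative a * t powr (a - 1)) (at t)"
    using assms by (rule has_real_derivative_powr)
  moreover have "((\<lambda>t. exp (- t)) has_real_derivative - exp (- t)) (at t)"
    by (auto intro!: derivative_eq_intros)
  moreover have "(poly p has_real_derivative poly (pderiv p) t) (at t)"
    by (rule poly_DERIV)
  ultimately have D: "((\<lambda>t. t powr a * exp (- t) * poly p t) has_real_derivative
      (a * t powr (a - 1) * exp (- t) + - exp (- t) * t powr a) * poly p t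
      + poly (pderiv p) t * (t powr a * exp (- t))) (at t)"
    by (intro DERIV_mult)
  have "t powr (a - 1) = t powr a / t"
    using assms by (simp add: powr_diff)
  then show ?thesis
    unfolding laguerre_weight_def using assms by (intro DERIV_cong[OF D]) (simp add: field_simps)
qed

text \<open>Exhaustion by the compact intervals [1/(n+1), n+1]. Neither F nor f is controlled at 0,
  where powers of t may be singular, so only one-sided limits of F enter.\<close>

lemma integral_FTC_pos:
  fixes F f :: "real \<Rightarrow> real"
  assumes deriv: "\<And>t. t > 0 \<Longrightarrow> (F has_real_derivative f t) (at t)"
    and int: "f absolutely_integrable_on {0<..}"
    and lim: "(F \<longlongrightarrow> A) (at_right 0)" "(F \<longlongrightarrow> B) at_top"
  shows "(LINT t:{0<..}|lebesgue. f t) = B - A"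
proof -
  define S where "S = (\<lambda>n::nat. {1 / (real n + 1)..real n + 1})"
  have U: "(\<Union>n. S n) = {0<..}"
  proof (intro equalityI subsetI)
    fix x :: real assume "x \<in> {0<..}"
    moreover obtain n :: nat where "max x (1 / x) \<le> real n"
      using real_arch_simple by blast
    ultimately have "x \<in> S n"
      by (auto simp: S_def field_simps)
    then show "x \<in> (\<Union>n. S n)" by blast
  next
    fix x assume "x \<in> (\<Union>n. S n)"
    then obtain n where "1 / (real n + 1) \<le> x" by (auto simp: S_def)
    moreover have "1 / (real n + 1) > 0" by simp
    ultimately show "x \<in> {0<..}" unfolding greaterThan_iff by (rule less_le_trans[rotated])
  qed
  have inc: "incseq S"
    unfolding incseq_def S_def by (auto simp: frac_le intro: order_trans)
  have "(\<lambda>n. LINT t:S n|lebesgue. f t) \<longlonglongrightarrow> (LINT t:(\<Union>n. S n)|lebesgue. f t)"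
    using inc int by (intro set_integral_cont_up) (auto simp: S_def U[unfolded S_def])
  moreover have "(LINT t:S n|lebesgue. f t) = F (real n + 1) - F (1 / (real n + 1))" for n
  proof -
    have sub: "S n \<subseteq> {0<..}" using U by blast
    have "1 / (real n + 1) \<le> real n + 1"
      by (simp add: divide_le_eq) (smt (verit) mult_le_cancel_left1 of_nat_0_le_iff)
    then have "(f has_integral F (real n + 1) - F (1 / (real n + 1))) (S n)"
      unfolding S_def using sub[unfolded S_def]
      by (intro fundamental_theorem_of_calculus)
         (auto intro!: has_field_derivative_at_within deriv
           simp flip: has_real_derivative_iff_has_vector_derivative)
    moreover have "f absolutely_integrable_on S n"
      by (rule set_integrable_subset[OF int _ sub]) (simp add: S_def)
    ultimately show ?thesis
      by (simp add: set_lebesgue_integral_eq_integral(2) integral_unique)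
  qed
  moreover have "(\<lambda>n. F (real n + 1) - F (1 / (real n + 1))) \<longlonglongrightarrow> B - A"
  proof (intro tendsto_diff)
    have "filterlim (\<lambda>n. real n + 1) at_top sequentially" by real_asymp
    then show "(\<lambda>n. F (real n + 1)) \<longlonglongrightarrow> B"
      using lim(2) by (rule filterlim_compose[rotated])
    have "filterlim (\<lambda>n. 1 / (real n + 1)) (at_right 0) sequentially" by real_asymp
    then show "(\<lambda>n. F (1 / (real n + 1))) \<longlonglongrightarrow> A"
      using lim(1) by (rule filterlim_compose[rotated])
  qed
  ultimately show ?thesis
    unfolding U by (simp add: LIMSEQ_unique)
qed

text \<open>The tool behind the bounds at maxima: the derivative of an auxiliary F is majorised by a
  nonnegative b whose integral over the whole half line is known exactly, so the increment is
  bounded independently of x and y.\<close>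

lemma increment_le_integral:
  fixes F f b :: "real \<Rightarrow> real"
  assumes "0 < x" "x \<le> y"
    and deriv: "\<And>t. x \<le> t \<Longrightarrow> t \<le> y \<Longrightarrow> (F has_real_derivative f t) (at t)"
    and le: "\<And>t. x \<le> t \<Longrightarrow> t \<le> y \<Longrightarrow> f t \<le> b t"
    and nonneg: "\<And>t. t > 0 \<Longrightarrow> 0 \<le> b t"
    and int: "b absolutely_integrable_on {0<..}"
  shows "F y - F x \<le> (LINT t:{0<..}|lebesgue. b t)"
proof -
  have hi: "(f has_integral F y - F x) {x..y}"
  proof (rule fundamental_theorem_of_calculus[OF assms(2)])
    fix t assume "t \<in> {x..y}"
    then show "(F has_vector_derivative f t) (at t within {x..y})"
      unfolding has_real_derivative_iff_has_vector_derivative[symmetric]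
      by (auto intro: has_field_derivative_at_within[OF deriv])
  qed
  have i: "b absolutely_integrable_on {x..y}"
    by (rule set_integrable_subset[OF int]) (use assms(1) in auto)
  note bi = set_lebesgue_integral_eq_integral(1)[OF i] set_lebesgue_integral_eq_integral(1)[OF int]
  have "F y - F x \<le> integral {x..y} b"
    by (rule has_integral_le[OF hi integrable_integral[OF bi(1)]]) (simp add: le)
  also have "\<dots> \<le> integral {0<..} b"
    using assms(1) by (intro integral_subset_le[OF _ bi]) (auto intro: nonneg)
  finally show ?thesis
    using set_lebesgue_integral_eq_integral(2)[OF int] by simp
qed

section \<open>Orthogonality\<close>

lemma set_lebesgue_integral_sum:
  fixes f :: "'i \<Rightarrow> 'a \<Rightarrow> real"
  assumes "\<And>i. i \<in> I \<Longrightarrow> set_integrable M A (f i)"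
  shows "(LINT x:A|M. (\<Sum>i\<in>I. f i x)) = (\<Sum>i\<in>I. LINT x:A|M. f i x)"
  using assms unfolding set_lebesgue_integral_def set_integrable_def
  by (simp add: sum_distrib_left)

lemma lint_laguerre_weight:
  assumes "a > -1"
  shows "(LINT t:{0<..}|lebesgue. laguerre_weight a t) = Gamma (a + 1)"
proof -
  have i: "laguerre_weight a absolutely_integrable_on {0<..}"
    using laguerre_weight_integrable[OF assms, of 1] by simp
  have "((\<lambda>t. t powr (a + 1 - 1) / exp t) has_integral Gamma (a + 1)) {0..}"
    using assms by (intro Gamma_integral_real) simp
  then have "integral {0..} (\<lambda>t. t powr (a + 1 - 1) / exp t) = Gamma (a + 1)"
    by (rule integral_unique)
  moreover have "integral {0<..} (\<lambda>t. t powr (a + 1 - 1) / exp t)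
      = integral {0..} (\<lambda>t. t powr (a + 1 - 1) / exp t)"
    by (rule integral_subset_negligible) (auto intro: negligible_subset[of "{0}"])
  moreover have "laguerre_weight a = (\<lambda>t. t powr (a + 1 - 1) / exp t)"
    by (intro ext) (simp add: laguerre_weight_def exp_minus divide_inverse)
  ultimately show ?thesis
    using set_lebesgue_integral_eq_integral(2)[OF i] by simp
qed

text \<open>The integrand is the derivative of w_a p, whose boundary terms vanish. Orthogonality and
  both norm formulas below are instances for suitable p.\<close>

lemma lint_derivative_laguerre_weight_poly:
  assumes "a > 0"
  shows "(LINT t:{0<..}|lebesgue.
    laguerre_weight (a - 1) t * poly ([:a, -1:] * p + [:0, 1:] * pderiv p) t) = 0"
proof -
  have "(LINT t:{0<..}|lebesgue.
    laguerre_weight (a - 1) t * poly ([:a, -1:] * p + [:0, 1:] * pderiv p) t) = 0 - 0"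
  proof (rule integral_FTC_pos)
    fix t :: real assume "t > 0"
    then show "((\<lambda>t. laguerre_weight a t * poly p t) has_real_derivative
        laguerre_weight (a - 1) t * poly ([:a, -1:] * p + [:0, 1:] * pderiv p) t) (at t)"
      using laguerre_weight_add_1[of t "a - 1"]
      by (intro DERIV_cong[OF has_derivative_laguerre_weight_poly]) (auto simp: field_simps)
  qed (use assms in \<open>auto intro: laguerre_weight_integrable laguerre_weight_tendsto_at_0
        laguerre_weight_tendsto_at_top simp del: poly_add poly_mult\<close>)
  then show ?thesis by simp
qed

text \<open>Lagrange's identity: with the Wronskian p q' - q p' of two Laguerre polynomials, the
  total derivative becomes (n - m) times their product.\<close>

lemma laguerre_orthogonal:
  assumes "\<alpha> > -1" "n \<noteq> m"
  shows "(LINT t:{0<..}|lebesgue. laguerre_weight \<alpha> t * (laguerre \<alpha> n t * laguerre \<alpha> m t)) = 0"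
proof -
  define p q where "p = laguerre_poly \<alpha> n" and "q = laguerre_poly \<alpha> m"
  have "poly ([:\<alpha> + 1, -1:] * (p * pderiv q - q * pderiv p)
        + [:0, 1:] * pderiv (p * pderiv q - q * pderiv p)) t
     = (real n - real m) * (laguerre \<alpha> n t * laguerre \<alpha> m t)" (is "?l t = _") for t
  proof -
    have "?l t = poly p t * (t * poly (pderiv (pderiv q)) t + (\<alpha> + 1 - t) * poly (pderiv q) t)
       - poly q t * (t * poly (pderiv (pderiv p)) t + (\<alpha> + 1 - t) * poly (pderiv p) t)"
      by (simp add: pderiv_mult pderiv_diff algebra_simps)
    also have "\<dots> = poly p t * (- real m * poly q t) - poly q t * (- real n * poly p t)"
      unfolding p_def q_def laguerre_poly_ode ..
    finally show ?thesis
      by (simp add: p_def q_def algebra_simps)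
  qed
  then have "(LINT t:{0<..}|lebesgue. laguerre_weight \<alpha> t *
      ((real n - real m) * (laguerre \<alpha> n t * laguerre \<alpha> m t))) = 0"
    using lint_derivative_laguerre_weight_poly[of "\<alpha> + 1" "p * pderiv q - q * pderiv p"] assms
    by simp
  then have "(real n - real m) *
      (LINT t:{0<..}|lebesgue. laguerre_weight \<alpha> t * (laguerre \<alpha> n t * laguerre \<alpha> m t)) = 0"
    by (simp add: mult.left_commute[of "laguerre_weight \<alpha> _"])
  then show ?thesis
    using assms by simp
qed

text \<open>Integrating the total derivative for p p' gives (n+1) times the norm for (\<alpha>, n+1)
  as the integral of t w (p')^2, which is the norm for (\<alpha>+1, n). The induction ends at a
  Gamma integral.\<close>

lemma laguerre_norm:
  assumes "\<alpha> > -1"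
  shows "(LINT t:{0<..}|lebesgue. laguerre_weight \<alpha> t * (laguerre \<alpha> n t)\<^sup>2)
    = Gamma (real n + \<alpha> + 1) / fact n"
  using assms
proof (induction n arbitrary: \<alpha>)
  case 0
  then show ?case by (simp add: lint_laguerre_weight)
next
  case (Suc n)
  define p where "p = laguerre_poly \<alpha> (Suc n)"
  have i: "(\<lambda>t. laguerre_weight \<alpha> t * poly q t) absolutely_integrable_on {0<..}" for q
    using Suc.prems by (rule laguerre_weight_integrable)
  have "poly ([:\<alpha> + 1, -1:] * (p * pderiv p) + [:0, 1:] * pderiv (p * pderiv p)) t
     = poly ([:0, 1:] * (pderiv p)\<^sup>2 - smult (real (Suc n)) (p\<^sup>2)) t" (is "?l t = _") for t
  proof -
    have "?l t = poly p t * (t * poly (pderiv (pderiv p)) t + (\<alpha> + 1 - t) * poly (pderiv p) t)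
       + t * (poly (pderiv p) t)\<^sup>2"
      by (simp add: pderiv_mult power2_eq_square algebra_simps)
    also have "t * poly (pderiv (pderiv p)) t + (\<alpha> + 1 - t) * poly (pderiv p) t
        = - real (Suc n) * poly p t"
      unfolding p_def by (rule laguerre_poly_ode)
    finally show ?thesis
      by (simp add: power2_eq_square algebra_simps)
  qed
  then have "(LINT t:{0<..}|lebesgue. laguerre_weight \<alpha> t *
      poly ([:0, 1:] * (pderiv p)\<^sup>2 - smult (real (Suc n)) (p\<^sup>2)) t) = 0"
    using lint_derivative_laguerre_weight_poly[of "\<alpha> + 1" "p * pderiv p"] Suc.prems by simp
  then have "(LINT t:{0<..}|lebesgue. laguerre_weight \<alpha> t * poly ([:0, 1:] * (pderiv p)\<^sup>2) t
      - real (Suc n) * (laguerre_weight \<alpha> t * poly (p\<^sup>2) t)) = 0"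
    by (simp add: right_diff_distrib mult.left_commute[of _ "real (Suc n)"]
        del: poly_mult poly_power of_nat_Suc)
  then have "(LINT t:{0<..}|lebesgue. laguerre_weight \<alpha> t * poly ([:0, 1:] * (pderiv p)\<^sup>2) t)
      = real (Suc n) * (LINT t:{0<..}|lebesgue. laguerre_weight \<alpha> t * poly (p\<^sup>2) t)"
    by (subst (asm) set_integral_diff(2)[OF i set_integrable_mult_right[OF i]]) simp
  moreover have "(LINT t:{0<..}|lebesgue. laguerre_weight \<alpha> t * poly ([:0, 1:] * (pderiv p)\<^sup>2) t)
      = (LINT t:{0<..}|lebesgue. laguerre_weight (\<alpha> + 1) t * (laguerre (\<alpha> + 1) n t)\<^sup>2)"
    by (intro set_lebesgue_integral_cong)
       (auto simp: laguerre_weight_add_1 p_def pderiv_laguerre_poly_shift)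
  moreover have "\<dots> = Gamma (real n + (\<alpha> + 1) + 1) / fact n"
    using Suc.prems by (intro Suc.IH) simp
  ultimately have "real (Suc n) * (LINT t:{0<..}|lebesgue. laguerre_weight \<alpha> t * (laguerre \<alpha> (Suc n) t)\<^sup>2)
      = Gamma (real n + (\<alpha> + 1) + 1) / fact n"
    by (simp add: p_def)
  moreover have "Gamma (real n + (\<alpha> + 1) + 1) = Gamma (real (Suc n) + \<alpha> + 1)"
    by (rule arg_cong[where f = Gamma]) simp
  ultimately have "real (Suc n) *
      (LINT t:{0<..}|lebesgue. laguerre_weight \<alpha> t * (laguerre \<alpha> (Suc n) t)\<^sup>2)
      = Gamma (real (Suc n) + \<alpha> + 1) / fact n"
    by simp
  then show ?case
    by (simp add: field_simps del: of_nat_Suc)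
qed

text \<open>Total derivative for p^2: \<alpha> times this integral minus the ordinary norm plus
  twice the integral of w L L' is 0, and the last one vanishes since L' combines lower L_j.\<close>

lemma laguerre_norm_shifted_weight:
  assumes "\<alpha> > 0"
  shows "(LINT t:{0<..}|lebesgue. laguerre_weight (\<alpha> - 1) t * (laguerre \<alpha> n t)\<^sup>2)
    = Gamma (real n + \<alpha> + 1) / fact n / \<alpha>"
proof -
  define p where "p = laguerre_poly \<alpha> n"
  have i: "(\<lambda>t. laguerre_weight a t * poly q t) absolutely_integrable_on {0<..}" 
    if "a > -1" for q a
    using that by (rule laguerre_weight_integrable)
  have "(LINT t:{0<..}|lebesgue. laguerre_weight \<alpha> t * poly (p * pderiv p) t)
     = (\<Sum>j<n. - 1 * (LINT t:{0<..}|lebesgue. laguerre_weight \<alpha> t * (laguerre \<alpha> n t * laguerre \<alpha> j t)))"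
  proof -
    have "laguerre_weight \<alpha> t * poly (p * pderiv p) t =
       (\<Sum>j<n. - 1 * (laguerre_weight \<alpha> t * (laguerre \<alpha> n t * laguerre \<alpha> j t)))" for t
      by (simp add: p_def pderiv_laguerre_poly poly_sum sum_distrib_left sum_negf)
    moreover have "(\<lambda>t. laguerre_weight \<alpha> t * (laguerre \<alpha> n t * laguerre \<alpha> j t))
        absolutely_integrable_on {0<..}" for j
      using i[of \<alpha> "laguerre_poly \<alpha> n * laguerre_poly \<alpha> j"] assms by simp
    ultimately show ?thesis
      by (subst set_integral_mult_right[symmetric])
         (simp only: set_lebesgue_integral_sum set_integrable_mult_right)
  qed
  also have "\<dots> = 0"
    using assms laguerre_orthogonal[of \<alpha> n] by simp
  finally have 0: "(LINT t:{0<..}|lebesgue. laguerre_weight \<alpha> t * poly (p * pderiv p) t) = 0" .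
  have "0 = (LINT t:{0<..}|lebesgue. laguerre_weight (\<alpha> - 1) t
      * poly ([:\<alpha>, -1:] * p\<^sup>2 + [:0, 1:] * pderiv (p\<^sup>2)) t)"
    using assms by (rule lint_derivative_laguerre_weight_poly[symmetric])
  also have "\<dots> = (LINT t:{0<..}|lebesgue. \<alpha> * (laguerre_weight (\<alpha> - 1) t * poly (p\<^sup>2) t)
      - laguerre_weight \<alpha> t * poly (p\<^sup>2) t + 2 * (laguerre_weight \<alpha> t * poly (p * pderiv p) t))"
    using laguerre_weight_add_1[of _ "\<alpha> - 1"]
    by (intro set_lebesgue_integral_cong)
       (auto simp: pderiv_mult power2_eq_square algebra_simps)
  also have "\<dots> = \<alpha> * (LINT t:{0<..}|lebesgue. laguerre_weight (\<alpha> - 1) t * poly (p\<^sup>2) t)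
      - (LINT t:{0<..}|lebesgue. laguerre_weight \<alpha> t * poly (p\<^sup>2) t)
      + 2 * (LINT t:{0<..}|lebesgue. laguerre_weight \<alpha> t * poly (p * pderiv p) t)"
    using assms
    by (simp add: set_integral_add set_integral_diff set_integrable_mult_right i
          del: poly_mult poly_power)
  finally have "\<alpha> * (LINT t:{0<..}|lebesgue. laguerre_weight (\<alpha> - 1) t * poly (p\<^sup>2) t)
      = Gamma (real n + \<alpha> + 1) / fact n"
    using 0 laguerre_norm[of \<alpha> n] assms by (simp add: p_def)
  then show ?thesis
    using assms by (simp add: p_def field_simps)
qed

section \<open>The uniform bound\<close>

text \<open>With y = sqrt(w) L one has t y' = sqrt(w) R, where R is this function.\<close>

definition laguerre_aux :: "real \<Rightarrow> nat \<Rightarrow> real \<Rightarrow> real" where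
  "laguerre_aux \<alpha> n t =
     (\<alpha> - t) / 2 * laguerre \<alpha> n t + t * poly (pderiv (laguerre_poly \<alpha> n)) t"

definition laguerre_kappa :: "real \<Rightarrow> nat \<Rightarrow> real" where
  "laguerre_kappa \<alpha> n = real n + (\<alpha> + 1) / 2"

text \<open>In terms of y = sqrt(w) L, the Laguerre equation reads t (t y')' = - Q y.\<close>

definition laguerre_potential :: "real \<Rightarrow> nat \<Rightarrow> real \<Rightarrow> real" where
  "laguerre_potential \<alpha> n t = laguerre_kappa \<alpha> n * t - t\<^sup>2 / 4 - \<alpha>\<^sup>2 / 4"

lemma laguerre_kappa_pos: "\<alpha> > -1 \<Longrightarrow> laguerre_kappa \<alpha> n > 0"
  unfolding laguerre_kappa_def by (intro add_nonneg_pos) auto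

lemma laguerre_potential_le: "t \<ge> 0 \<Longrightarrow> laguerre_potential \<alpha> n t \<le> laguerre_kappa \<alpha> n * t"
  by (simp add: laguerre_potential_def)

text \<open>The second equation of the linear system, obtained by removing L'' with the Laguerre
  equation. That R is a polynomial makes the limit lemmas for weight times polynomial apply to
  it.\<close>

lemma ex_laguerre_aux_poly:
  obtains q where "\<And>t. laguerre_aux \<alpha> n t = poly q t"
    "\<And>t. t * poly (pderiv q) t =
       - ((\<alpha> - t) / 2 * laguerre_aux \<alpha> n t) - laguerre_potential \<alpha> n t * laguerre \<alpha> n t"
proof
  define p where "p = laguerre_poly \<alpha> n"
  define c :: "real poly" where "c = [:\<alpha> / 2, - 1 / 2:]"
  define q where "q = c * p + [:0, 1:] * pderiv p"
  have c: "poly c t = (\<alpha> - t) / 2" "poly (pderiv c) t = - 1 / 2" for t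
    by (simp_all add: c_def pderiv_pCons field_simps)
  show q: "laguerre_aux \<alpha> n t = poly q t" for t
    by (simp add: laguerre_aux_def q_def p_def c)
  fix t
  have "t * poly (pderiv q) t = t * (- poly p t / 2 + (\<alpha> - t) / 2 * poly (pderiv p) t
      + poly (pderiv p) t + t * poly (pderiv (pderiv p)) t)"
    by (simp add: q_def c pderiv_add pderiv_mult pderiv_pCons field_simps)
  also have "\<dots> = t * (- poly p t / 2 + (\<alpha> - t) / 2 * poly (pderiv p) t
      + poly (pderiv p) t + (- real n * poly p t - (\<alpha> + 1 - t) * poly (pderiv p) t))"
    using laguerre_poly_ode[of t \<alpha> n] by (simp add: p_def)
  also have "\<dots> = - ((\<alpha> - t) / 2 * laguerre_aux \<alpha> n t) - laguerre_potential \<alpha> n t * laguerre \<alpha> n t"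
    by (simp add: laguerre_aux_def laguerre_potential_def laguerre_kappa_def p_def
        power2_eq_square field_simps)
  finally show "t * poly (pderiv q) t =
       - ((\<alpha> - t) / 2 * laguerre_aux \<alpha> n t) - laguerre_potential \<alpha> n t * laguerre \<alpha> n t" .
qed

lemma weighted_laguerre_derivatives:
  fixes \<alpha> t :: real and n :: nat
  assumes "t > 0"
  defines "w \<equiv> laguerre_weight \<alpha>" and "L \<equiv> laguerre \<alpha> n" and "R \<equiv> laguerre_aux \<alpha> n"
    and "Q \<equiv> laguerre_potential \<alpha> n"
  shows "((\<lambda>t. w t * (L t)\<^sup>2) has_real_derivative w t / t * (2 * L t * R t)) (at t)"
    and "((\<lambda>t. w t * (L t * R t)) has_real_derivative
          w t / t * ((R t)\<^sup>2 - Q t * (L t)\<^sup>2)) (at t)"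
    and "((\<lambda>t. w t * (R t)\<^sup>2) has_real_derivative w t / t * (- 2 * Q t * L t * R t)) (at t)"
proof -
  define p where "p = laguerre_poly \<alpha> n"
  obtain q where q: "R = poly q"
    "\<And>t. t * poly (pderiv q) t = - ((\<alpha> - t) / 2 * R t) - Q t * L t"
    using ex_laguerre_aux_poly[of \<alpha> n] unfolding R_def Q_def L_def by (metis ext)
  have p: "L = poly p" "t * poly (pderiv p) t = R t - (\<alpha> - t) / 2 * L t"
    by (auto simp: L_def p_def R_def laguerre_aux_def)
  \<comment> \<open>The term with \<alpha> - t is the derivative of the weight. In each of the three
    products it cancels the terms with (\<alpha> - t)/2 from the two linear equations.\<close>
  have d: "((\<lambda>t. w t * poly s t) has_real_derivative w t / t * X) (at t)"
    if "(\<alpha> - t) * poly s t + t * poly (pderiv s) t = X" for s X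
    using has_derivative_laguerre_weight_poly[OF assms(1), of \<alpha> s] that by (simp add: w_def)
  show "((\<lambda>t. w t * (L t)\<^sup>2) has_real_derivative w t / t * (2 * L t * R t)) (at t)"
  proof -
    have "(\<alpha> - t) * poly (p\<^sup>2) t + t * poly (pderiv (p\<^sup>2)) t
        = (\<alpha> - t) * (L t)\<^sup>2 + 2 * L t * (t * poly (pderiv p) t)"
      by (simp add: p(1) power2_eq_square pderiv_mult algebra_simps)
    also have "\<dots> = 2 * L t * R t"
      unfolding p(2) by (simp add: power2_eq_square field_simps)
    finally show ?thesis
      using d[of "p\<^sup>2"] by (simp add: p(1))
  qed
  show "((\<lambda>t. w t * (L t * R t)) has_real_derivative
          w t / t * ((R t)\<^sup>2 - Q t * (L t)\<^sup>2)) (at t)"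
  proof -
    have "(\<alpha> - t) * poly (p * q) t + t * poly (pderiv (p * q)) t
        = (\<alpha> - t) * (L t * R t) + R t * (t * poly (pderiv p) t) + L t * (t * poly (pderiv q) t)"
      by (simp add: p(1) q(1) pderiv_mult algebra_simps)
    also have "\<dots> = (R t)\<^sup>2 - Q t * (L t)\<^sup>2"
      unfolding p(2) q(2) by (simp add: power2_eq_square field_simps)
    finally show ?thesis
      using d[of "p * q"] by (simp add: p(1) q(1))
  qed
  show "((\<lambda>t. w t * (R t)\<^sup>2) has_real_derivative w t / t * (- 2 * Q t * L t * R t)) (at t)"
  proof -
    have "(\<alpha> - t) * poly (q\<^sup>2) t + t * poly (pderiv (q\<^sup>2)) t
        = (\<alpha> - t) * (R t)\<^sup>2 + 2 * R t * (t * poly (pderiv q) t)"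
      by (simp add: q(1) power2_eq_square pderiv_mult algebra_simps)
    also have "\<dots> = - 2 * Q t * L t * R t"
      unfolding q(2) by (simp add: power2_eq_square field_simps)
    finally show ?thesis
      using d[of "q\<^sup>2"] by (simp add: q(1))
  qed
qed

lemma weighted_laguerre_limits:
  shows "((\<lambda>t. laguerre_weight \<alpha> t * (laguerre \<alpha> n t)\<^sup>2) \<longlongrightarrow> 0) at_top"
    and "((\<lambda>t. laguerre_weight \<alpha> t * (laguerre \<alpha> n t * laguerre_aux \<alpha> n t)) \<longlongrightarrow> 0) at_top"
    and "\<alpha> > 0 \<Longrightarrow> ((\<lambda>t. laguerre_weight \<alpha> t * (laguerre \<alpha> n t)\<^sup>2) \<longlongrightarrow> 0) (at_right 0)"
    and "\<alpha> > 0 \<Longrightarrow>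
      ((\<lambda>t. laguerre_weight \<alpha> t * (laguerre \<alpha> n t * laguerre_aux \<alpha> n t)) \<longlongrightarrow> 0) (at_right 0)"
    and "\<alpha> > 0 \<Longrightarrow> ((\<lambda>t. laguerre_weight \<alpha> t * (laguerre_aux \<alpha> n t)\<^sup>2) \<longlongrightarrow> 0) (at_right 0)"
proof -
  define p where "p = laguerre_poly \<alpha> n"
  obtain q where q: "laguerre_aux \<alpha> n = poly q"
    using ex_laguerre_aux_poly[of \<alpha> n] by (metis ext)
  have eq: "laguerre_weight \<alpha> t * (laguerre \<alpha> n t)\<^sup>2 = laguerre_weight \<alpha> t * poly (p\<^sup>2) t"
    "laguerre_weight \<alpha> t * (laguerre \<alpha> n t * laguerre_aux \<alpha> n t) = laguerre_weight \<alpha> t * poly (p * q) t"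
    "laguerre_weight \<alpha> t * (laguerre_aux \<alpha> n t)\<^sup>2 = laguerre_weight \<alpha> t * poly (q\<^sup>2) t" for t
    by (simp_all add: p_def q)
  show "((\<lambda>t. laguerre_weight \<alpha> t * (laguerre \<alpha> n t)\<^sup>2) \<longlongrightarrow> 0) at_top"
    "((\<lambda>t. laguerre_weight \<alpha> t * (laguerre \<alpha> n t * laguerre_aux \<alpha> n t)) \<longlongrightarrow> 0) at_top"
    "\<alpha> > 0 \<Longrightarrow> ((\<lambda>t. laguerre_weight \<alpha> t * (laguerre \<alpha> n t)\<^sup>2) \<longlongrightarrow> 0) (at_right 0)"
    "\<alpha> > 0 \<Longrightarrow>
      ((\<lambda>t. laguerre_weight \<alpha> t * (laguerre \<alpha> n t * laguerre_aux \<alpha> n t)) \<longlongrightarrow> 0) (at_right 0)"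
    "\<alpha> > 0 \<Longrightarrow> ((\<lambda>t. laguerre_weight \<alpha> t * (laguerre_aux \<alpha> n t)\<^sup>2) \<longlongrightarrow> 0) (at_right 0)"
    unfolding eq by (rule laguerre_weight_tendsto_at_top laguerre_weight_tendsto_at_0; assumption)+
qed

section \<open>Bounds for w L^2 at its critical points\<close>

lemma weighted_laguerre_integrable:
  assumes "\<alpha> > -1"
  shows "(\<lambda>t. laguerre_weight \<alpha> t * (laguerre \<beta> n t)\<^sup>2) absolutely_integrable_on {0<..}"
  using laguerre_weight_integrable[OF assms, of "(laguerre_poly \<beta> n)\<^sup>2"] by simp

text \<open>Integration from T to infinity of F = - w L^2 - w L R / \<kappa>. F vanishes at
  infinity, and F T = - w L^2 because L R = 0 at T, so the increment of F is exactly the quantity to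
  be bounded.\<close>

lemma laguerre_bound_large:
  assumes "\<alpha> > -1" "T \<ge> laguerre_kappa \<alpha> n" "laguerre \<alpha> n T * laguerre_aux \<alpha> n T = 0"
  shows "laguerre_weight \<alpha> T * (laguerre \<alpha> n T)\<^sup>2 \<le> 2 * (Gamma (real n + \<alpha> + 1) / fact n)"
proof -
  define w L R Q k where defs: "w = laguerre_weight \<alpha>" "L = laguerre \<alpha> n" "R = laguerre_aux \<alpha> n"
    "Q = laguerre_potential \<alpha> n" "k = laguerre_kappa \<alpha> n"
  note der = weighted_laguerre_derivatives[of _ \<alpha> n, folded defs]
  have k: "k > 0" "T \<ge> k" using assms laguerre_kappa_pos by (auto simp: defs)
  define H where "H = Gamma (real n + \<alpha> + 1) / fact n"
  define F where "F = (\<lambda>t. - (w t * (L t)\<^sup>2) - w t * (L t * R t) / k)"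
  have "F y - F T \<le> (LINT t:{0<..}|lebesgue. 2 * (w t * (L t)\<^sup>2))" if "y \<ge> T" for y
  proof (rule increment_le_integral[where F = F and x = T and y = y and f = "\<lambda>t. - (w t / t * (2 * L t * R t)) - w t / t * ((R t)\<^sup>2 - Q t * (L t)\<^sup>2) / k"])
    fix t assume t: "T \<le> t"
    then have "t > 0" "k \<le> t" using k by auto
    show "(F has_real_derivative - (w t / t * (2 * L t * R t))
       - w t / t * ((R t)\<^sup>2 - Q t * (L t)\<^sup>2) / k) (at t)"
      unfolding F_def by (intro DERIV_diff DERIV_minus DERIV_cdivide der \<open>t > 0\<close>)
    \<comment> \<open>Completing the square eliminates R: -2 k L R - R^2 is at most k^2 L^2, and k
      \<le> t turns k^2 into k t, matching the bound for Q.\<close>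
    have "0 \<le> (k * L t + R t)\<^sup>2" by simp
    moreover have "Q t * (L t)\<^sup>2 \<le> k * t * (L t)\<^sup>2"
      using laguerre_potential_le[of t \<alpha> n] \<open>t > 0\<close> by (intro mult_right_mono) (auto simp: defs)
    moreover have "k * k * (L t)\<^sup>2 \<le> k * t * (L t)\<^sup>2"
      using \<open>k \<le> t\<close> k by (intro mult_right_mono mult_left_mono) auto
    ultimately have "- (2 * L t * R t) * k - ((R t)\<^sup>2 - Q t * (L t)\<^sup>2) \<le> 2 * t * (L t)\<^sup>2 * k"
      by (simp add: power2_eq_square algebra_simps)
    then have "(- (2 * L t * R t) * k - ((R t)\<^sup>2 - Q t * (L t)\<^sup>2)) / k \<le> 2 * t * (L t)\<^sup>2"
      using k(1) by (simp add: divide_le_eq)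
    then have "w t / t * ((- (2 * L t * R t) * k - ((R t)\<^sup>2 - Q t * (L t)\<^sup>2)) / k)
        \<le> w t / t * (2 * t * (L t)\<^sup>2)"
      using \<open>t > 0\<close> by (intro mult_left_mono) (simp_all add: defs laguerre_weight_nonneg)
    then show "- (w t / t * (2 * L t * R t)) - w t / t * ((R t)\<^sup>2 - Q t * (L t)\<^sup>2) / k
        \<le> 2 * (w t * (L t)\<^sup>2)"
      using k(1) \<open>t > 0\<close> by (simp add: field_simps)
  next
    show "(\<lambda>t. 2 * (w t * (L t)\<^sup>2)) absolutely_integrable_on {0<..}"
      unfolding defs using assms by (intro set_integrable_mult_right weighted_laguerre_integrable)
  qed (use k that in \<open>auto simp: defs laguerre_weight_nonneg\<close>)
  then have "F y \<le> 2 * H + F T" if "y \<ge> T" for y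
    using that laguerre_norm[OF assms(1), of n] by (fastforce simp: defs H_def)
  then have "\<forall>\<^sub>F y in at_top. F y \<le> 2 * H + F T"
    using eventually_ge_at_top by (rule eventually_mono[rotated])
  moreover have "(F \<longlongrightarrow> - 0 - 0 / k) at_top"
    unfolding F_def defs by (intro tendsto_intros weighted_laguerre_limits)
       (use k in \<open>simp add: defs\<close>)
  ultimately have "- 0 - 0 / k \<le> 2 * H + F T"
    by (intro tendsto_upperbound) auto
  moreover have "F T = - (w T * (L T)\<^sup>2)"
    using assms(3) by (simp add: F_def defs)
  ultimately show ?thesis
    by (simp add: defs H_def)
qed

text \<open>Integration from 0 to T of F = w L^2 - w L R, where (L - R)^2 \<ge> 0 eliminates R and
  leaves (1 + Q) L^2. Effective only as long as \<kappa> T stays bounded.\<close>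

lemma laguerre_bound_small:
  assumes "\<alpha> > 0" "T > 0" "laguerre \<alpha> n T * laguerre_aux \<alpha> n T = 0"
  shows "laguerre_weight \<alpha> T * (laguerre \<alpha> n T)\<^sup>2
    \<le> (1 + laguerre_kappa \<alpha> n * T) * (Gamma (real n + \<alpha> + 1) / fact n / \<alpha>)"
proof -
  define w L R Q k where defs: "w = laguerre_weight \<alpha>" "L = laguerre \<alpha> n" "R = laguerre_aux \<alpha> n"
    "Q = laguerre_potential \<alpha> n" "k = laguerre_kappa \<alpha> n"
  note der = weighted_laguerre_derivatives[of _ \<alpha> n, folded defs]
  have k: "k > 0" using assms laguerre_kappa_pos by (auto simp: defs)
  define H where "H = Gamma (real n + \<alpha> + 1) / fact n / \<alpha>"
  define F where "F = (\<lambda>t. w t * (L t)\<^sup>2 - w t * (L t * R t))"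
  have "F T - F x \<le> (LINT t:{0<..}|lebesgue. (1 + k * T) * (laguerre_weight (\<alpha> - 1) t * (L t)\<^sup>2))"
    if "0 < x" "x \<le> T" for x
  proof (rule increment_le_integral[where F = F and x = x and y = T and f = "\<lambda>t. w t / t * (2 * L t * R t) - w t / t * ((R t)\<^sup>2 - Q t * (L t)\<^sup>2)"])
    fix t assume t: "x \<le> t" "t \<le> T"
    then have "t > 0" using that by simp
    show "(F has_real_derivative w t / t * (2 * L t * R t)
       - w t / t * ((R t)\<^sup>2 - Q t * (L t)\<^sup>2)) (at t)"
      unfolding F_def by (intro DERIV_diff der \<open>t > 0\<close>)
    have "0 \<le> (L t - R t)\<^sup>2" by simp
    moreover have "Q t * (L t)\<^sup>2 \<le> k * t * (L t)\<^sup>2"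
      using laguerre_potential_le[of t \<alpha> n] \<open>t > 0\<close> by (intro mult_right_mono) (auto simp: defs)
    moreover have "k * t * (L t)\<^sup>2 \<le> k * T * (L t)\<^sup>2"
      using t k by (intro mult_right_mono mult_left_mono) auto
    ultimately have "2 * L t * R t - ((R t)\<^sup>2 - Q t * (L t)\<^sup>2) \<le> (1 + k * T) * (L t)\<^sup>2"
      by (simp add: power2_eq_square algebra_simps)
    then have "w t / t * (2 * L t * R t - ((R t)\<^sup>2 - Q t * (L t)\<^sup>2)) \<le> w t / t * ((1 + k * T) * (L t)\<^sup>2)"
      using \<open>t > 0\<close> by (intro mult_left_mono) (simp_all add: defs laguerre_weight_nonneg)
    then show "w t / t * (2 * L t * R t) - w t / t * ((R t)\<^sup>2 - Q t * (L t)\<^sup>2)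
        \<le> (1 + k * T) * (laguerre_weight (\<alpha> - 1) t * (L t)\<^sup>2)"
      using \<open>t > 0\<close> laguerre_weight_add_1[of t "\<alpha> - 1"]
      by (simp add: defs right_diff_distrib mult_ac)
  next
    show "(\<lambda>t. (1 + k * T) * (laguerre_weight (\<alpha> - 1) t * (L t)\<^sup>2)) absolutely_integrable_on {0<..}"
      unfolding defs using assms by (intro set_integrable_mult_right weighted_laguerre_integrable) simp
  qed (use that k assms in \<open>auto simp: laguerre_weight_nonneg\<close>)
  then have *: "F T - (1 + k * T) * H \<le> F x"
    if "0 < x" "x \<le> T" for x
    using that laguerre_norm_shifted_weight[OF assms(1), of n] by (fastforce simp: defs H_def)
  have "\<forall>\<^sub>F x in at_right 0. F T - (1 + k * T) * H \<le> F x"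
    using eventually_at_right_real[OF assms(2)] by eventually_elim (auto intro: *)
  moreover have "(F \<longlongrightarrow> 0 - 0) (at_right 0)"
    unfolding F_def defs using assms(1) by (intro tendsto_intros weighted_laguerre_limits)
  ultimately have "F T - (1 + k * T) * H \<le> 0 - 0"
    by (intro tendsto_lowerbound) auto
  then show ?thesis
    using assms(3) by (simp add: F_def defs H_def)
qed

text \<open>Uses the energy w R^2 + Q w L^2, which grows only through Q'. The growth up to T is of
  order \<kappa> T, and so is Q T, hence the quotient is bounded.\<close>

lemma laguerre_bound_middle:
  assumes "\<alpha> > 0" "T > 0" "laguerre \<alpha> n T * laguerre_aux \<alpha> n T = 0"
    and "\<alpha>\<^sup>2 \<le> 2 * laguerre_kappa \<alpha> n * T" "T \<le> laguerre_kappa \<alpha> n"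
  shows "laguerre_weight \<alpha> T * (laguerre \<alpha> n T)\<^sup>2
    \<le> 4 * (Gamma (real n + \<alpha> + 1) / fact n / \<alpha>)"
proof -
  define w L R Q k where defs: "w = laguerre_weight \<alpha>" "L = laguerre \<alpha> n" "R = laguerre_aux \<alpha> n"
    "Q = laguerre_potential \<alpha> n" "k = laguerre_kappa \<alpha> n"
  note der = weighted_laguerre_derivatives[of _ \<alpha> n, folded defs]
  define H where "H = Gamma (real n + \<alpha> + 1) / fact n / \<alpha>"
  have k: "k > 0" using assms laguerre_kappa_pos by (auto simp: defs)
  define F where "F = (\<lambda>t. w t * (R t)\<^sup>2 + Q t * (w t * (L t)\<^sup>2))"
  have Q: "(Q has_real_derivative k - t / 2) (at t)" for t
    unfolding defs laguerre_potential_def by (auto intro!: derivative_eq_intros)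
  have "F T - F x \<le> (LINT t:{0<..}|lebesgue. k * T * (laguerre_weight (\<alpha> - 1) t * (L t)\<^sup>2))"
    if "0 < x" "x \<le> T" for x
  proof (rule increment_le_integral[where F = F and x = x and y = T and f = "\<lambda>t. (k - t / 2) * (w t * (L t)\<^sup>2)"])
    fix t assume t: "x \<le> t" "t \<le> T"
    then have "t > 0" using that by simp
    have "(F has_real_derivative w t / t * (- 2 * Q t * L t * R t)
       + ((k - t / 2) * (w t * (L t)\<^sup>2) + w t / t * (2 * L t * R t) * Q t)) (at t)"
      unfolding F_def by (intro DERIV_add DERIV_mult Q der \<open>t > 0\<close>)
    then show "(F has_real_derivative (k - t / 2) * (w t * (L t)\<^sup>2)) (at t)"
      \<comment> \<open>The two terms with Q L R cancel; only the one with Q' survives.\<close>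
      by (rule DERIV_cong) (simp add: algebra_simps)
    have "(k - t / 2) * t \<le> k * T"
      using t \<open>t > 0\<close> k by (intro mult_mono) auto
    then have "(k - t / 2) * t * (laguerre_weight (\<alpha> - 1) t * (L t)\<^sup>2)
       \<le> k * T * (laguerre_weight (\<alpha> - 1) t * (L t)\<^sup>2)"
      by (intro mult_right_mono) (auto simp: laguerre_weight_nonneg)
    then show "(k - t / 2) * (w t * (L t)\<^sup>2) \<le> k * T * (laguerre_weight (\<alpha> - 1) t * (L t)\<^sup>2)"
      using \<open>t > 0\<close> laguerre_weight_add_1[of t "\<alpha> - 1"] by (simp add: defs mult_ac)
  next
    show "(\<lambda>t. k * T * (laguerre_weight (\<alpha> - 1) t * (L t)\<^sup>2)) absolutely_integrable_on {0<..}"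
      unfolding defs using assms by (intro set_integrable_mult_right weighted_laguerre_integrable) simp
  qed (use that k assms in \<open>auto simp: laguerre_weight_nonneg\<close>)
  then have *: "F T - k * T * H \<le> F x" if "0 < x" "x \<le> T" for x
    using that laguerre_norm_shifted_weight[OF assms(1), of n] by (fastforce simp: defs H_def)
  have "\<forall>\<^sub>F x in at_right 0. F T - k * T * H \<le> F x"
    using eventually_at_right_real[OF assms(2)] by eventually_elim (auto intro: *)
  moreover have "(Q \<longlongrightarrow> Q 0) (at_right 0)"
    using Q[of 0] by (meson DERIV_isCont continuous_at_imp_continuous_at_within continuous_within)
  then have "(F \<longlongrightarrow> 0 + Q 0 * 0) (at_right 0)"
    unfolding F_def defs using assms(1) by (intro tendsto_intros weighted_laguerre_limits)
  ultimately have "F T - k * T * H \<le> 0 + Q 0 * 0"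
    by (intro tendsto_lowerbound) auto
  then have "w T * (R T)\<^sup>2 + Q T * (w T * (L T)\<^sup>2) \<le> k * T * H"
    by (simp add: F_def)
  moreover have "0 \<le> w T * (R T)\<^sup>2"
    by (simp add: defs laguerre_weight_nonneg)
  moreover have "k * T / 4 * (w T * (L T)\<^sup>2) \<le> Q T * (w T * (L T)\<^sup>2)"
  proof (intro mult_right_mono)
    \<comment> \<open>T \<le> k makes T^2/4 at most k T/4, and the lower bound on T makes
      \<alpha>^2/4 at most k T/2; so a quarter of k T remains of Q T.\<close>
    have "T * T \<le> k * T" using assms by (intro mult_right_mono) (auto simp: defs)
    then show "k * T / 4 \<le> Q T"
      using assms(4) by (simp add: defs laguerre_potential_def power2_eq_square mult.commute)
  qed (simp add: defs laguerre_weight_nonneg)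
  ultimately have "k * T * (w T * (L T)\<^sup>2) \<le> k * T * (4 * H)"
    by simp
  moreover have "k * T > 0"
    using k assms(2) by simp
  ultimately have "w T * (L T)\<^sup>2 \<le> 4 * H"
    by (rule mult_left_le_imp_le)
  then show ?thesis
    by (simp add: defs H_def)
qed

text \<open>Sonin's argument: \<open>w L\<^sup>2 + w R\<^sup>2 / Q\<close> decreases as long as \<open>Q\<close> increases.\<close>

lemma laguerre_bound_zero:
  assumes "0 < T" "T < 2 * laguerre_kappa 0 n"
  shows "laguerre_weight 0 T * (laguerre 0 n T)\<^sup>2 \<le> 1"
proof -
  define w L R Q k where defs: "w = laguerre_weight 0" "L = laguerre 0 n" "R = laguerre_aux 0 n"
    "Q = laguerre_potential 0 n" "k = laguerre_kappa 0 n"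
  note der = weighted_laguerre_derivatives[of _ 0 n, folded defs]
  have k: "k > 0" using laguerre_kappa_pos by (auto simp: defs)
  have Q: "(Q has_real_derivative k - t / 2) (at t)" for t
    unfolding defs laguerre_potential_def by (auto intro!: derivative_eq_intros)
  have Q_eq: "Q t = t * (k - t / 4)" for t
    by (simp add: defs laguerre_potential_def power2_eq_square algebra_simps)
  define F where "F = (\<lambda>t. w t * (L t)\<^sup>2 + w t * (R t)\<^sup>2 / Q t)"
  have le: "F T \<le> F x" if "0 < x" "x \<le> T" for x
  proof (rule DERIV_nonpos_imp_nonincreasing[OF that(2)])
    fix t assume t: "x \<le> t" "t \<le> T"
    then have "t > 0" "t < 2 * k" using that assms by (auto simp: defs)
    then have "Q t > 0" by (simp add: Q_eq)
    have "(F has_real_derivative w t / t * (2 * L t * R t)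
       + (w t / t * (- 2 * Q t * L t * R t) * Q t - w t * (R t)\<^sup>2 * (k - t / 2)) / (Q t * Q t)) (at t)"
      unfolding F_def by (intro DERIV_add DERIV_divide Q der \<open>t > 0\<close>) (use \<open>Q t > 0\<close> in simp)
    then have "(F has_real_derivative - (w t * (R t)\<^sup>2 * (k - t / 2)) / (Q t * Q t)) (at t)"
      by (rule DERIV_cong) (use \<open>Q t > 0\<close> \<open>t > 0\<close> in \<open>simp add: field_simps\<close>)
    moreover have "- (w t * (R t)\<^sup>2 * (k - t / 2)) / (Q t * Q t) \<le> 0"
      using \<open>t < 2 * k\<close> by (auto simp: defs laguerre_weight_nonneg intro!: divide_nonpos_nonneg)
    ultimately show "\<exists>y. (F has_real_derivative y) (at t) \<and> y \<le> 0" by blast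
  qed
  \<comment> \<open>F has a 0/0 quotient at 0, and \<open>laguerre_weight 0 0 = 0\<close> since
    \<open>0 powr 0 = 0\<close>. Cancelling t by R = t Y and Q = t (k - t/4), and writing the weight
    as exp(-t), gives a function G continuous at 0 that equals F to the right of it.\<close>
  define Y where "Y = (\<lambda>t. poly (pderiv (laguerre_poly 0 n)) t - L t / 2)"
  define G where "G = (\<lambda>t. exp (- t) * ((L t)\<^sup>2 + t * (Y t)\<^sup>2 / (k - t / 4)))"
  have "F x = G x" if "0 < x" "x < T" for x
  proof -
    have "R x = x * Y x"
      by (simp add: defs Y_def laguerre_aux_def algebra_simps)
    moreover have "k - x / 4 > 0" using that assms by (simp add: defs)
    moreover have "w x = exp (- x)"
      using that by (simp add: defs laguerre_weight_def)
    ultimately show ?thesis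
      using that by (simp add: F_def G_def Q_eq power2_eq_square field_simps)
  qed
  then have "\<forall>\<^sub>F x in at_right 0. F T \<le> G x"
    using eventually_at_right_real[OF assms(1)] le by (auto elim!: eventually_mono)
      (metis less_eq_real_def)
  moreover have "isCont L 0"
  proof -
    have "L = poly (laguerre_poly 0 n)" by (auto simp: defs)
    then show ?thesis by simp
  qed
  then have "isCont G 0"
    unfolding G_def Y_def using k by (intro continuous_intros) auto
  then have "(G \<longlongrightarrow> G 0) (at_right 0)"
    by (meson continuous_at_imp_continuous_at_within continuous_within)
  ultimately have "F T \<le> G 0"
    by (intro tendsto_lowerbound) auto
  moreover have "G 0 = 1"
    by (simp add: G_def defs laguerre_at_0)
  moreover have "0 \<le> w T * (R T)\<^sup>2 / Q T"
  proof -
    have "Q T \<ge> 0" unfolding Q_eq using assms by (auto simp: defs)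
    then show ?thesis by (simp add: defs laguerre_weight_nonneg)
  qed
  ultimately show ?thesis
    by (simp add: F_def defs)
qed

lemma laguerre_norm_pos:
  assumes "\<alpha> \<ge> 0"
  shows "Gamma (real n + \<alpha> + 1) / fact n > 0"
  using assms by (intro divide_pos_pos Gamma_real_pos) auto

text \<open>The derivative of w L^2 is a positive multiple of L R, so at an interior maximum L R = 0
  and one of the four preceding bounds applies.\<close>

lemma laguerre_bound:
  assumes "\<alpha> \<ge> 0"
  shows "\<exists>K>0. \<forall>n. \<forall>t>0.
    laguerre_weight \<alpha> t * (laguerre \<alpha> n t)\<^sup>2 \<le> K * (Gamma (real n + \<alpha> + 1) / fact n)"
proof -
  \<comment> \<open>The summands are the constants for large, middle and small T, the last with 2
    \<kappa> T \<le> \<alpha>^2 inserted. For \<alpha> = 0 the normalisation is 1 and Sonin's bound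
    1 lies below 2.\<close>
  define K where "K = (if \<alpha> = 0 then 2 else 2 + 4 / \<alpha> + (1 + \<alpha>\<^sup>2 / 2) / \<alpha>)"
  define h where "h = (\<lambda>n. Gamma (real n + \<alpha> + 1) / fact n)"
  have h: "h n > 0" for n
    using laguerre_norm_pos[OF assms] by (simp add: h_def)
  have h0: "h n = 1" if "\<alpha> = 0" for n
    using that by (simp add: h_def Gamma_fact add.commute)
  have K: "K \<ge> 2" "\<alpha> \<noteq> 0 \<Longrightarrow> 4 / \<alpha> \<le> K" "\<alpha> \<noteq> 0 \<Longrightarrow> (1 + \<alpha>\<^sup>2 / 2) / \<alpha> \<le> K"
    using assms by (auto simp: K_def)
  have crit: "laguerre_weight \<alpha> T * (laguerre \<alpha> n T)\<^sup>2 \<le> K * h n"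
    if T: "T > 0" "laguerre \<alpha> n T * laguerre_aux \<alpha> n T = 0" for n T
  proof -
    define k where "k = laguerre_kappa \<alpha> n"
    have k: "k > 0" using assms laguerre_kappa_pos by (auto simp: k_def)
    consider "T \<ge> k" | "T < k" "\<alpha> = 0" | "T < k" "\<alpha> > 0" "2 * k * T \<le> \<alpha>\<^sup>2"
      | "T < k" "\<alpha> > 0" "2 * k * T > \<alpha>\<^sup>2"
      using assms by linarith
    then show ?thesis
    proof cases
      case 1
      then have "laguerre_weight \<alpha> T * (laguerre \<alpha> n T)\<^sup>2 \<le> 2 * h n"
        unfolding h_def using assms T by (intro laguerre_bound_large) (auto simp: k_def)
      also have "\<dots> \<le> K * h n"
        using K(1) h by (intro mult_right_mono) (auto simp: less_imp_le)
      finally show ?thesis .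
    next
      case 2
      then have "laguerre_weight 0 T * (laguerre 0 n T)\<^sup>2 \<le> 1"
        using T k by (intro laguerre_bound_zero) (auto simp: k_def)
      also have "\<dots> \<le> K * h n"
        using K(1) h0 2 by simp
      finally show ?thesis
        using 2 by simp
    next
      case 3
      then have "laguerre_weight \<alpha> T * (laguerre \<alpha> n T)\<^sup>2 \<le> (1 + k * T) * (h n / \<alpha>)"
        unfolding h_def k_def using T by (intro laguerre_bound_small)
      also have "\<dots> \<le> (1 + \<alpha>\<^sup>2 / 2) * (h n / \<alpha>)"
        using 3 h[of n] by (intro mult_right_mono) auto
      also have "\<dots> = (1 + \<alpha>\<^sup>2 / 2) / \<alpha> * h n"
        by simp
      also have "\<dots> \<le> K * h n"
        using K(3) h 3 by (intro mult_right_mono) (auto simp: less_imp_le)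
      finally show ?thesis .
    next
      case 4
      then have "laguerre_weight \<alpha> T * (laguerre \<alpha> n T)\<^sup>2 \<le> 4 * (h n / \<alpha>)"
        unfolding h_def using T by (intro laguerre_bound_middle) (auto simp: k_def)
      also have "\<dots> = 4 / \<alpha> * h n"
        by simp
      also have "\<dots> \<le> K * h n"
        using K(2) h 4 by (intro mult_right_mono) (auto simp: less_imp_le)
      finally show ?thesis .
    qed
  qed
  \<comment> \<open>From maxima to all t: if the bound failed at t, values near 0 and near infinity
    would lie below g t, so the maximum over some [a, b] would be interior and violate
    \<open>crit\<close>.\<close>
  have "laguerre_weight \<alpha> t * (laguerre \<alpha> n t)\<^sup>2 \<le> K * h n" if "t > 0" for n t
  proof (rule ccontr)
    define g where "g = (\<lambda>t. laguerre_weight \<alpha> t * (laguerre \<alpha> n t)\<^sup>2)"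
    have der: "(g has_real_derivative
        laguerre_weight \<alpha> t / t * (2 * laguerre \<alpha> n t * laguerre_aux \<alpha> n t)) (at t)" if "t > 0" for t
      unfolding g_def using that by (rule weighted_laguerre_derivatives(1))
    assume "\<not> ?thesis"
    then have big: "g t > K * h n" by (simp add: g_def)
    have Kh: "K * h n > 0"
      using K(1) h[of n] by simp
    \<comment> \<open>For \<alpha> = 0 the boundary value is L(0)^2 = 1 rather than 0; K \<ge> 2
      keeps it below g t.\<close>
    have lim0: "\<exists>l<g t. (g \<longlongrightarrow> l) (at_right 0)"
    proof (cases "\<alpha> = 0")
      case True
      have "((\<lambda>t. exp (- t) * (poly (laguerre_poly 0 n) t)\<^sup>2) \<longlongrightarrow>
          exp (- 0) * (poly (laguerre_poly 0 n) 0)\<^sup>2) (at_right 0)"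
        by (intro tendsto_intros)
      then have "((\<lambda>t. exp (- t) * (laguerre 0 n t)\<^sup>2) \<longlongrightarrow> 1) (at_right 0)"
        by (simp add: laguerre_at_0)
      moreover have "\<forall>\<^sub>F t in at_right 0. exp (- t) * (laguerre 0 n t)\<^sup>2 = g t"
        using eventually_at_right_less[of 0]
        by eventually_elim (simp add: g_def True laguerre_weight_def)
      ultimately have "(g \<longlongrightarrow> 1) (at_right 0)"
        by (rule Lim_transform_eventually)
      moreover have "1 < g t"
        using big h0[OF True] K(1) by simp
      ultimately show ?thesis by blast
    next
      case False
      then have "(g \<longlongrightarrow> 0) (at_right 0)"
        unfolding g_def using assms by (intro weighted_laguerre_limits) simp
      then show ?thesis
        using big Kh by (intro exI[of _ 0]) simp
    qed
    then have "\<forall>\<^sub>F x in at_right 0. g x < g t"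
      by (metis order_tendstoD(2))
    then obtain a' where a': "a' > 0" "\<And>x. 0 < x \<Longrightarrow> x < a' \<Longrightarrow> g x < g t"
      by (auto simp: eventually_at_right_field)
    define a where "a = min (a' / 2) t"
    have a: "0 < a" "a \<le> t" "g a < g t \<or> a = t"
      using a' \<open>t > 0\<close> by (auto simp: a_def min_def)
    have "(g \<longlongrightarrow> 0) at_top"
      unfolding g_def by (rule weighted_laguerre_limits)
    then have "\<forall>\<^sub>F x in at_top. g x < g t"
      by (rule order_tendstoD(2)) (use big Kh in simp)
    then obtain b' where b': "\<And>x. x \<ge> b' \<Longrightarrow> g x < g t"
      by (auto simp: eventually_at_top_linorder)
    define b where "b = max b' (t + 1)"
    have b: "t < b" "g b < g t"
      using b' by (auto simp: b_def)
    \<comment> \<open>Otherwise t would be smaller than a', where g lies below g t.\<close>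
    have "a \<noteq> t"
    proof
      assume "a = t"
      then have "t \<le> a' / 2" by (auto simp: a_def min_def split: if_splits)
      then show False using a'(2)[of t] a'(1) \<open>t > 0\<close> by simp
    qed
    have "continuous_on {a..b} g"
      using a(1) by (auto intro!: continuous_at_imp_continuous_on DERIV_isCont der)
    then obtain T where T: "T \<in> {a..b}" "\<And>x. x \<in> {a..b} \<Longrightarrow> g x \<le> g T"
      using continuous_attains_sup[of "{a..b}" g] a b by auto
    have gT: "g t \<le> g T"
      using a b by (intro T(2)) auto
    then have "T \<noteq> a" "T \<noteq> b"
      using a b \<open>a \<noteq> t\<close> by auto
    then have "a < T" "T < b"
      using T(1) by auto
    then have "T > 0" using a by simp
    have "laguerre_weight \<alpha> T / T * (2 * laguerre \<alpha> n T * laguerre_aux \<alpha> n T) = 0"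
    proof (rule DERIV_local_max[OF der[OF \<open>T > 0\<close>], of "min (T - a) (b - T)"])
      show "\<forall>y. \<bar>T - y\<bar> < min (T - a) (b - T) \<longrightarrow> g y \<le> g T"
        using T(2) by (auto simp: abs_less_iff)
    qed (use \<open>a < T\<close> \<open>T < b\<close> in auto)
    then have "laguerre \<alpha> n T * laguerre_aux \<alpha> n T = 0"
      using laguerre_weight_pos[OF \<open>T > 0\<close>, of \<alpha>] \<open>T > 0\<close> by auto
    then have "g T \<le> K * h n"
      unfolding g_def using \<open>T > 0\<close> by (intro crit)
    then show False using gT big by simp
  qed
  then show ?thesis
    using K(1) unfolding h_def by (intro exI[of _ K]) auto
qed

section \<open>Derivatives of the orthonormal functions\<close>

definition laguerre_on_poly :: "real \<Rightarrow> nat \<Rightarrow> real poly" where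
  "laguerre_on_poly \<alpha> k = smult (sqrt (fact k / Gamma (real k + \<alpha> + 1))) (laguerre_poly \<alpha> k)"

lemma poly_laguerre_on_poly [simp]: "poly (laguerre_on_poly \<alpha> k) = laguerre_on \<alpha> k"
  by (simp add: laguerre_on_poly_def laguerre_on_def fun_eq_iff)

text \<open>Taken formally on polynomials, so that differentiating needs no side conditions.\<close>

definition laguerre_on_deriv :: "real \<Rightarrow> nat \<Rightarrow> nat \<Rightarrow> real \<Rightarrow> real" where
  "laguerre_on_deriv \<alpha> j k = poly ((pderiv ^^ j) (laguerre_on_poly \<alpha> k))"

lemma laguerre_on_deriv_0 [simp]: "laguerre_on_deriv \<alpha> 0 k = laguerre_on \<alpha> k"
  by (simp add: laguerre_on_deriv_def)

lemma laguerre_on_deriv_Suc: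
  "(laguerre_on_deriv \<alpha> j k has_real_derivative laguerre_on_deriv \<alpha> (Suc j) k t) (at t)"
  by (simp add: laguerre_on_deriv_def poly_DERIV)

lemma higher_pderiv_minus: "(pderiv ^^ j) (- p) = - (pderiv ^^ j) (p :: real poly)"
  by (induction j) (auto simp: pderiv_minus)

text \<open>Consecutive values have ratio (k + \<alpha> + 1)/(k + 1), at least 1 because \<alpha>
  \<ge> 0. In the derivative bound it lets the norm of L_k stand for those of all lower
  indices.\<close>

lemma laguerre_norm_mono:
  assumes "\<alpha> \<ge> 0" "j \<le> k"
  shows "Gamma (real j + \<alpha> + 1) / fact j \<le> Gamma (real k + \<alpha> + 1) / fact k"
  using assms(2)
proof (induction k rule: dec_induct)
  case (step k)
  have "Gamma (real (Suc k) + \<alpha> + 1) = (real k + \<alpha> + 1) * Gamma (real k + \<alpha> + 1)"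
    using Gamma_plus1[of "real k + \<alpha> + 1"] assms(1) nonpos_Ints_nonpos[of "real k + \<alpha> + 1"]
    by (fastforce simp: add_ac)
  then have "Gamma (real (Suc k) + \<alpha> + 1) / fact (Suc k)
      = (real k + \<alpha> + 1) / (real k + 1) * (Gamma (real k + \<alpha> + 1) / fact k)"
    by (simp add: add.commute)
  moreover have "1 \<le> (real k + \<alpha> + 1) / (real k + 1)"
    using assms(1) by simp
  then have "1 * (Gamma (real k + \<alpha> + 1) / fact k)
      \<le> (real k + \<alpha> + 1) / (real k + 1) * (Gamma (real k + \<alpha> + 1) / fact k)"
    using laguerre_norm_pos[OF assms(1), of k] by (intro mult_right_mono) auto
  ultimately show ?case
    using step.IH by simp
qed simp

text \<open>Each derivative costs one factor \<open>k\<close>, since \<open>L\<^sub>k'\<close> is minus the sum of the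
  preceding \<open>L\<^sub>j\<close>.\<close>

lemma laguerre_on_deriv_bound:
  assumes "\<alpha> \<ge> 0"
  shows "\<exists>K>0. \<forall>j k. \<forall>t>0.
    sqrt (laguerre_weight \<alpha> t) * \<bar>laguerre_on_deriv \<alpha> j k t\<bar> \<le> K * real k ^ j"
proof -
  obtain K where K: "K > 0" "\<And>n t. t > 0 \<Longrightarrow>
    laguerre_weight \<alpha> t * (laguerre \<alpha> n t)\<^sup>2 \<le> K * (Gamma (real n + \<alpha> + 1) / fact n)"
    using laguerre_bound[OF assms] by metis
  define h where "h = (\<lambda>n. sqrt (Gamma (real n + \<alpha> + 1) / fact n))"
  have h: "h n > 0" for n
    using laguerre_norm_pos[OF assms] by (simp add: h_def)
  have *: "sqrt (laguerre_weight \<alpha> t) * \<bar>poly ((pderiv ^^ j) (laguerre_poly \<alpha> k)) t\<bar>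
      \<le> sqrt K * h k * real k ^ j" if "t > 0" for j k t
  proof (induction j arbitrary: k)
    case 0
    have "sqrt (laguerre_weight \<alpha> t * (laguerre \<alpha> k t)\<^sup>2)
        \<le> sqrt (K * (Gamma (real k + \<alpha> + 1) / fact k))"
      using K(2)[OF that] by (rule real_sqrt_le_mono)
    then show ?case
      by (simp add: h_def real_sqrt_mult real_sqrt_divide)
  next
    case (Suc j)
    have "sqrt (laguerre_weight \<alpha> t) * \<bar>poly ((pderiv ^^ Suc j) (laguerre_poly \<alpha> k)) t\<bar>
        = \<bar>\<Sum>i<k. sqrt (laguerre_weight \<alpha> t) * poly ((pderiv ^^ j) (laguerre_poly \<alpha> i)) t\<bar>"
      by (simp add: funpow_Suc_right pderiv_laguerre_poly higher_pderiv_sum higher_pderiv_minus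
          poly_sum abs_mult laguerre_weight_nonneg flip: sum_distrib_left del: funpow.simps)
    also have "\<dots> \<le> (\<Sum>i<k. sqrt (laguerre_weight \<alpha> t) * \<bar>poly ((pderiv ^^ j) (laguerre_poly \<alpha> i)) t\<bar>)"
      by (rule order_trans[OF sum_abs]) (simp add: abs_mult laguerre_weight_nonneg)
    also have "\<dots> \<le> (\<Sum>i<k. sqrt K * h k * real k ^ j)"
    proof (rule sum_mono)
      fix i assume "i \<in> {..<k}"
      have "sqrt (laguerre_weight \<alpha> t) * \<bar>poly ((pderiv ^^ j) (laguerre_poly \<alpha> i)) t\<bar>
          \<le> sqrt K * h i * real i ^ j"
        by (rule Suc)
      \<comment> \<open>After i is raised to k all k summands are equal, and their number supplies
        the new factor k.\<close>
      also have "\<dots> \<le> sqrt K * h k * real k ^ j"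
        using \<open>i \<in> {..<k}\<close> K(1) h laguerre_norm_mono[OF assms, of i k]
        by (intro mult_mono power_mono) (auto simp: h_def less_imp_le)
      finally show "sqrt (laguerre_weight \<alpha> t) * \<bar>poly ((pderiv ^^ j) (laguerre_poly \<alpha> i)) t\<bar>
          \<le> sqrt K * h k * real k ^ j" .
    qed
    also have "\<dots> = sqrt K * h k * real k ^ Suc j"
      by simp
    finally show ?case .
  qed
  have "sqrt (laguerre_weight \<alpha> t) * \<bar>laguerre_on_deriv \<alpha> j k t\<bar> \<le> sqrt K * real k ^ j"
    if "t > 0" for j k t
  proof -
    have "sqrt (fact k / Gamma (real k + \<alpha> + 1)) = 1 / h k"
      by (simp add: h_def real_sqrt_divide)
    then have "sqrt (laguerre_weight \<alpha> t) * \<bar>laguerre_on_deriv \<alpha> j k t\<bar>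
        = sqrt (laguerre_weight \<alpha> t) * \<bar>poly ((pderiv ^^ j) (laguerre_poly \<alpha> k)) t\<bar> / h k"
      using h[of k]
      by (simp add: laguerre_on_deriv_def laguerre_on_poly_def higher_pderiv_smult abs_mult)
    also have "\<dots> \<le> sqrt K * h k * real k ^ j / h k"
      using *[OF that] h[of k] by (intro divide_right_mono) auto
    also have "\<dots> = sqrt K * real k ^ j"
      using h[of k] by simp
    finally show ?thesis .
  qed
  then show ?thesis
    using K(1) by (intro exI[of _ "sqrt K"]) auto
qed

section \<open>Hoelder estimates\<close>

lemma recip_bounds:
  assumes "1 \<le> p"
  shows "0 \<le> recip p" "recip p \<le> 1" "recip p = 1 \<longleftrightarrow> p = 1"
proof -
  show "0 \<le> recip p" "recip p \<le> 1" "recip p = 1 \<longleftrightarrow> p = 1"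
    using assms by (cases p; force simp: divide_le_eq divide_eq_eq one_ereal_def)+
qed

text \<open>Young's inequality with constants dropped: for M the larger of the two powers, u y \<le>
  M^(1/q) M^(1/p) = M.\<close>

lemma mult_le_powr_add_powr:
  fixes u y p q :: real
  assumes "u \<ge> 0" "y \<ge> 0" "p > 0" "q > 0" "1 / p + 1 / q = 1"
  shows "u * y \<le> u powr q + y powr p"
proof -
  define M where "M = max (u powr q) (y powr p)"
  have "u = (u powr q) powr (1 / q)" "y = (y powr p) powr (1 / p)"
    using assms by (simp_all add: powr_powr)
  moreover have "(u powr q) powr (1 / q) \<le> M powr (1 / q)" "(y powr p) powr (1 / p) \<le> M powr (1 / p)"
    using assms by (auto simp: M_def intro!: powr_mono2)
  ultimately have "u * y \<le> M powr (1 / q) * M powr (1 / p)"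
    using assms by (intro mult_mono) auto
  also have "\<dots> = M powr 1"
    using assms(5) by (simp add: add.commute flip: powr_add)
  also have "\<dots> = M" by (simp add: M_def le_max_iff_disj)
  also have "M \<le> u powr q + y powr p" by (simp add: M_def)
  finally show ?thesis .
qed

text \<open>Hoelder's inequality for weights whose dual sum is already normalised. The constant B +
  1 adds the dual sum to the sum of (|x|/D)^p. At p = 1 the dual exponent is 1/0, which is 0 in HOL,
  so the weights are bounded pointwise there.\<close>

lemma sum_mult_le_ell_norm:
  fixes x u :: "nat \<Rightarrow> real"
  assumes "1 \<le> p" "ell_norm p x \<le> ereal D" "D > 0" "finite A" "\<And>k. k \<in> A \<Longrightarrow> u k \<ge> 0"
    and one: "p = 1 \<Longrightarrow> \<forall>k\<in>A. u k \<le> 1"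
    and gt_one: "p \<noteq> 1 \<Longrightarrow> (\<Sum>k\<in>A. u k powr (1 / (1 - recip p))) \<le> B"
    and "B \<ge> 0"
  shows "(\<Sum>k\<in>A. u k * \<bar>x k\<bar>) \<le> (B + 1) * D"
proof (cases "p = \<infinity>")
  case True
  have x: "\<bar>x k\<bar> \<le> D" for k
  proof -
    have "ereal \<bar>x k\<bar> \<le> (SUP k. ereal \<bar>x k\<bar>)" by (rule SUP_upper) simp
    also have "\<dots> \<le> ereal D" using assms(2) True by (simp add: ell_norm_def)
    finally show ?thesis by simp
  qed
  have "(\<Sum>k\<in>A. u k * \<bar>x k\<bar>) \<le> (\<Sum>k\<in>A. u k) * D"
    unfolding sum_distrib_right using x assms(5) by (intro sum_mono mult_left_mono)
  also have "(\<Sum>k\<in>A. u k) \<le> B"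
    using gt_one assms(5) True by (simp add: one_ereal_def)
  finally show ?thesis
    using \<open>D > 0\<close> by (simp add: algebra_simps)
next
  case False
  then obtain \<pi> where \<pi>: "p = ereal \<pi>" "\<pi> \<ge> 1"
    using \<open>1 \<le> p\<close> by (cases p) (auto simp: one_ereal_def)
  define a where "a = (\<lambda>k. \<bar>x k\<bar> powr \<pi>)"
  have a: "summable a" "suminf a powr (1 / \<pi>) \<le> D"
    using assms(2) \<pi> by (auto simp: ell_norm_def a_def Let_def split: if_splits)
  have "suminf a = (suminf a powr (1 / \<pi>)) powr \<pi>"
    using \<pi> suminf_nonneg[OF a(1)] by (simp add: powr_powr a_def)
  also have "\<dots> \<le> D powr \<pi>"
    using a(2) \<pi> by (intro powr_mono2) auto
  finally have "suminf a \<le> D powr \<pi>" .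
  moreover have "sum a A \<le> suminf a"
    using a(1) \<open>finite A\<close> by (intro sum_le_suminf) (auto simp: a_def)
  ultimately have sa: "sum a A \<le> D powr \<pi>" by simp
  show ?thesis
  proof (cases "\<pi> = 1")
    case True
    have "(\<Sum>k\<in>A. u k * \<bar>x k\<bar>) \<le> (\<Sum>k\<in>A. 1 * \<bar>x k\<bar>)"
      using one \<pi> True by (intro sum_mono mult_right_mono) (auto simp: one_ereal_def)
    also have "\<dots> \<le> D"
      using sa True \<open>D > 0\<close> by (simp add: a_def)
    also have "\<dots> \<le> (B + 1) * D"
      using \<open>D > 0\<close> \<open>B \<ge> 0\<close> by simp
    finally show ?thesis .
  next
    case False
    then have "\<pi> > 1" using \<pi> by simp
    define q where "q = 1 / (1 - recip p)"
    have q: "1 - recip p > 0"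
      using \<open>\<pi> > 1\<close> \<pi> by simp
    have "u k * (\<bar>x k\<bar> / D) \<le> u k powr q + a k / D powr \<pi>" if "k \<in> A" for k
    proof -
      have "u k * (\<bar>x k\<bar> / D) \<le> u k powr q + (\<bar>x k\<bar> / D) powr \<pi>"
        using assms(5)[OF that] \<open>\<pi> > 1\<close> \<open>D > 0\<close> \<pi> q by (intro mult_le_powr_add_powr) (auto simp: q_def)
      then show ?thesis
        using \<open>D > 0\<close> by (simp add: a_def powr_divide)
    qed
    then have "(\<Sum>k\<in>A. u k * (\<bar>x k\<bar> / D)) \<le> (\<Sum>k\<in>A. u k powr q + a k / D powr \<pi>)"
      by (rule sum_mono)
    also have "\<dots> = (\<Sum>k\<in>A. u k powr q) + sum a A / D powr \<pi>"
      by (simp add: sum.distrib sum_divide_distrib)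
    also have "\<dots> \<le> B + 1"
      using gt_one False \<pi> sa \<open>D > 0\<close> by (intro add_mono) (auto simp: q_def one_ereal_def)
    finally have "(\<Sum>k\<in>A. u k * (\<bar>x k\<bar> / D)) * D \<le> (B + 1) * D"
      using \<open>D > 0\<close> by (intro mult_right_mono) auto
    then show ?thesis
      using \<open>D > 0\<close> by (simp add: sum_distrib_right)
  qed
qed

text \<open>Rescaling: q is the reciprocal of the conjugate exponent, and dividing k^a by N^(a+q)
  turns the assumed power-sum bound into a dual sum of at most B.\<close>

lemma sum_powr_mult_le_ell_norm:
  fixes x :: "nat \<Rightarrow> real" and a B :: real and p :: ereal
  defines "q \<equiv> 1 - recip p"
  assumes "1 \<le> p" "ell_norm p x \<le> ereal D" "D > 0" "finite A" "0 < N"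
    and one: "q = 0 \<Longrightarrow> \<forall>k\<in>A. real k powr a \<le> real N powr a"
    and gt_one: "q \<noteq> 0 \<Longrightarrow> (\<Sum>k\<in>A. real k powr (a / q)) \<le> B * real N powr (a / q + 1)"
    and "B \<ge> 0"
  shows "(\<Sum>k\<in>A. real k powr a * \<bar>x k\<bar>) \<le> (B + 1) * D * real N powr (a + q)"
proof -
  define u where "u = (\<lambda>k::nat. real k powr a / real N powr (a + q))"
  have N: "real N powr e > 0" for e using \<open>0 < N\<close> by simp
  have "(\<Sum>k\<in>A. u k * \<bar>x k\<bar>) \<le> (B + 1) * D"
  proof (rule sum_mult_le_ell_norm[OF assms(2-5)])
    show "\<forall>k\<in>A. u k \<le> 1" if "p = 1"
    proof -
      have "q = 0" using that by (simp add: q_def one_ereal_def)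
      then show ?thesis using one N by (simp add: u_def)
    qed
    show "(\<Sum>k\<in>A. u k powr (1 / (1 - recip p))) \<le> B" if "p \<noteq> 1"
    proof -
      have "q \<noteq> 0" using that recip_bounds(3)[OF assms(2)] by (simp add: q_def)
      have "(\<Sum>k\<in>A. u k powr (1 / q)) = (\<Sum>k\<in>A. real k powr (a / q)) / real N powr (a / q + 1)"
        using \<open>q \<noteq> 0\<close> by (simp add: u_def powr_divide powr_powr sum_divide_distrib add_divide_distrib)
      also have "\<dots> \<le> B"
        using gt_one[OF \<open>q \<noteq> 0\<close>] N by (simp add: divide_le_eq)
      finally show ?thesis by (simp add: q_def)
    qed
  qed (use assms in \<open>auto simp: u_def\<close>)
  moreover have "(\<Sum>k\<in>A. u k * \<bar>x k\<bar>) = (\<Sum>k\<in>A. real k powr a * \<bar>x k\<bar>) / real N powr (a + q)"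
    by (simp add: u_def sum_divide_distrib)
  ultimately show ?thesis
    using N by (simp add: divide_le_eq)
qed

text \<open>For b < 0 the sum telescopes: with c = b + 1, the mean value theorem bounds c (N+1)^b by
  (N+1)^c - N^c.\<close>

lemma sum_powr_le:
  fixes b :: real
  assumes "b > -1"
  shows "\<exists>B>0. \<forall>N. (\<Sum>k=1..N. real k powr b) \<le> B * real N powr (b + 1)"
proof (cases "b \<ge> 0")
  case True
  have "(\<Sum>k=1..N. real k powr b) \<le> 1 * real N powr (b + 1)" for N
  proof -
    have "(\<Sum>k=1..N. real k powr b) \<le> (\<Sum>k=1..N. real N powr b)"
      using True by (intro sum_mono powr_mono2) auto
    also have "\<dots> = real N powr (b + 1)"
      by (cases "N = 0") (auto simp: powr_add)
    finally show ?thesis by simp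
  qed
  then show ?thesis by (intro exI[of _ 1]) simp
next
  case False
  define c where "c = b + 1"
  have c: "0 < c" "c < 1" using assms False by (auto simp: c_def)
  have "(\<Sum>k=1..N. real k powr b) \<le> 1 / c * real N powr (b + 1)" for N
  proof (induction N)
    case (Suc N)
    have "c * real (Suc N) powr b \<le> real (Suc N) powr c - real N powr c"
    proof (cases "N = 0")
      case False
      have "\<exists>z>real N. z < real (Suc N) \<and>
          real (Suc N) powr c - real N powr c = (real (Suc N) - real N) * (c * z powr (c - 1))"
        using False by (intro MVT2 has_real_derivative_powr) auto
      then obtain z where z: "real N < z" "z < real (Suc N)"
        "real (Suc N) powr c - real N powr c = c * z powr b"
        by (auto simp: c_def)
      have "real (Suc N) powr b \<le> z powr b"
        using z \<open>\<not> b \<ge> 0\<close> by (intro powr_mono2') auto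
      then show ?thesis unfolding z(3) using c by (intro mult_left_mono) auto
    qed (use c in simp)
    then have "real (Suc N) powr b \<le> 1 / c * (real (Suc N) powr c - real N powr c)"
      using c by (simp add: field_simps)
    with Suc show ?case
      by (simp add: c_def algebra_simps diff_divide_distrib)
  qed simp
  then show ?thesis using c by (intro exI[of _ "1 / c"]) simp
qed

text \<open>The same telescoping with a negative exponent. The bound does not depend on the upper
  end M.\<close>

lemma sum_powr_tail_le:
  fixes b :: real
  assumes "b < -1"
  shows "\<exists>B>0. \<forall>N M. 0 < N \<longrightarrow> (\<Sum>k\<in>{N<..M}. real k powr b) \<le> B * real N powr (b + 1)"
proof -
  define c where "c = - (b + 1)"
  have c: "c > 0" using assms by (simp add: c_def)
  have "(\<Sum>k\<in>{N<..M}. real k powr b) \<le> 1 / c * (real N powr (- c) - real M powr (- c))"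
    if "0 < N" "N \<le> M" for N M
    using that(2)
  proof (induction M rule: dec_induct)
    case (step M)
    have "\<exists>z>real M. z < real (Suc M) \<and> real (Suc M) powr (- c) - real M powr (- c)
        = (real (Suc M) - real M) * (- c * z powr (- c - 1))"
      using that step by (intro MVT2 has_real_derivative_powr) auto
    then obtain z where z: "real M < z" "z < real (Suc M)"
      "real M powr (- c) - real (Suc M) powr (- c) = c * z powr b"
      by (auto simp: c_def algebra_simps)
    have "real (Suc M) powr b \<le> z powr b"
      using z assms by (intro powr_mono2') auto
    then have "c * real (Suc M) powr b \<le> real M powr (- c) - real (Suc M) powr (- c)"
      unfolding z(3) using c by (intro mult_left_mono) auto
    then have "real (Suc M) powr b \<le> 1 / c * (real M powr (- c) - real (Suc M) powr (- c))"
      using c by (simp add: field_simps)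
    moreover have "{N<..Suc M} = insert (Suc M) {N<..M}"
      using step by auto
    ultimately show ?case
      using step by (simp add: algebra_simps diff_divide_distrib)
  qed simp
  moreover have "1 / c * (real N powr (- c) - real M powr (- c)) \<le> 1 / c * real N powr (b + 1)" for N M
    using c by (intro mult_left_mono) (auto simp: c_def add.commute)
  moreover have "(\<Sum>k\<in>{N<..M}. real k powr b) \<le> 1 / c * real N powr (b + 1)" if "\<not> N \<le> M" for N M
    using that c by simp
  ultimately show ?thesis
    using c by (intro exI[of _ "1 / c"]) (meson order_trans zero_less_divide_1_iff)
qed

lemma ell_norm_sum_le:
  fixes a :: real
  assumes "1 \<le> p" "a + 1 - recip p > 0"
  obtains B where "B > 0"
    "\<And>D x N. D > 0 \<Longrightarrow> ell_norm p x \<le> ereal D \<Longrightarrow> N > 0 \<Longrightarrow>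
      (\<Sum>k=1..N. real k powr a * \<bar>x k\<bar>) \<le> B * D * real N powr (a + 1 - recip p)"
proof -
  define q where "q = 1 - recip p"
  have q: "q \<ge> 0" using recip_bounds[OF assms(1)] by (simp add: q_def)
  obtain B where B: "B > 0"
    "q \<noteq> 0 \<Longrightarrow> (\<Sum>k=1..N. real k powr (a / q)) \<le> B * real N powr (a / q + 1)" for N
  \<comment> \<open>q = 0 is the case p = 1, where the power-sum condition is void and any B
    serves.\<close>
  proof (cases "q = 0")
    case False
    then have "a / q > -1" using q assms(2) by (simp add: q_def less_divide_eq)
    then show ?thesis using sum_powr_le[of "a / q"] that by blast
  qed (use that[of 1] in simp)
  have "(\<Sum>k=1..N. real k powr a * \<bar>x k\<bar>) \<le> (B + 1) * D * real N powr (a + (1 - recip p))"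
    if "D > 0" "ell_norm p x \<le> ereal D" "N > 0" for D x N
    using that assms B q
    by (intro sum_powr_mult_le_ell_norm) (auto simp: q_def intro!: powr_mono2)
  then show ?thesis
    using B(1) by (intro that[of "B + 1"]) (simp_all add: add_diff_eq)
qed

text \<open>Uniform in M, hence good both for the tail beyond N and, with N = 1, for absolute
  convergence of the differentiated series.\<close>

lemma ell_norm_tail_sum_le:
  fixes a :: real
  assumes "1 \<le> p" "a + 1 - recip p < 0"
  obtains B where "B > 0"
    "\<And>D x N M. D > 0 \<Longrightarrow> ell_norm p x \<le> ereal D \<Longrightarrow> N > 0 \<Longrightarrow>
      (\<Sum>k\<in>{N<..M}. real k powr a * \<bar>x k\<bar>) \<le> B * D * real N powr (a + 1 - recip p)"
proof -
  define q where "q = 1 - recip p"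
  have q: "q \<ge> 0" using recip_bounds[OF assms(1)] by (simp add: q_def)
  obtain B where B: "B > 0"
    "q \<noteq> 0 \<Longrightarrow> 0 < N \<Longrightarrow> (\<Sum>k\<in>{N<..M}. real k powr (a / q)) \<le> B * real N powr (a / q + 1)" for N M
  proof (cases "q = 0")
    case False
    then have "a / q < -1" using q assms(2) by (simp add: q_def divide_less_eq)
    then show ?thesis using sum_powr_tail_le[of "a / q"] that by blast
  qed (use that[of 1] in simp)
  have "(\<Sum>k\<in>{N<..M}. real k powr a * \<bar>x k\<bar>) \<le> (B + 1) * D * real N powr (a + (1 - recip p))"
    if "D > 0" "ell_norm p x \<le> ereal D" "N > 0" for D x N M
    using that assms B q
    by (intro sum_powr_mult_le_ell_norm) (auto simp: q_def intro!: powr_mono2')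
  then show ?thesis
    using B(1) by (intro that[of "B + 1"]) (simp_all add: add_diff_eq)
qed

text \<open>Absorbing the weight into the sequence lets the same Hoelder estimates treat f and the
  noise.\<close>

lemma smoothness_norm_eq_ell_norm:
  assumes "1 \<le> s"
  shows "smoothness_norm \<alpha> s \<mu> f = ell_norm s (\<lambda>k. real (max 1 k) powr \<mu> * laguerre_coeff \<alpha> f k)"
proof (cases "s = \<infinity>")
  case True
  then show ?thesis by (simp add: smoothness_norm_def ell_norm_def abs_mult)
next
  case False
  have "real (max 1 k) powr (\<sigma> * \<mu>) * \<bar>c\<bar> powr \<sigma> = \<bar>real (max 1 k) powr \<mu> * c\<bar> powr \<sigma>" for \<sigma> k c
    by (simp add: abs_mult powr_mult powr_powr mult.commute)
  with False show ?thesis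
    by (simp add: smoothness_norm_def ell_norm_def)
qed

section \<open>Determinacy of the moment problem\<close>

text \<open>Dynkin's argument: the rays are stable under intersection and generate the Borel sets;
  the total integral handles complements. Then v and 0 have the same integral on every Borel
  set.\<close>

lemma AE_zero_if_lessThan_integrals_zero:
  fixes v :: "real \<Rightarrow> real"
  assumes int: "integrable lborel v" and tot: "(LINT x|lborel. v x) = 0"
    and lt: "\<And>a. (LINT x:{..<a}|lborel. v x) = 0"
  shows "AE x in lborel. v x = 0"
proof -
  have si: "set_integrable lborel A v" if "A \<in> sets borel" for A
    using integrable_mult_indicator[of A lborel v] int that by (simp add: set_integrable_def)
  have "{..<a} \<inter> {..<b} = {..<min a b}" for a b :: real
    by auto
  then have stable: "Int_stable (range (lessThan :: real \<Rightarrow> _))"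
    by (auto simp: Int_stable_def)
  have Pow_sub: "range (lessThan :: real \<Rightarrow> _) \<subseteq> Pow UNIV" by simp
  have "(LINT x:A|lborel. v x) = 0" if "A \<in> sigma_sets UNIV (range lessThan)" for A
    using stable Pow_sub that
  proof (induction A rule: sigma_sets_induct_disjoint)
    case (basic A)
    then show ?case using lt by auto
  next
    case (compl A)
    then have A: "A \<in> sets borel" by (simp add: borel_Iio)
    have "(LINT x:A \<union> (UNIV - A)|lborel. v x)
        = (LINT x:A|lborel. v x) + (LINT x:UNIV - A|lborel. v x)"
      using A by (intro set_integral_Un si) auto
    then show ?case
      using compl tot by (simp add: set_lebesgue_integral_def)
  next
    case (union A)
    then have A: "A i \<in> sets borel" for i by (auto simp: borel_Iio)
    have "(LINT x:(\<Union>i. A i)|lborel. v x) = (\<Sum>i. LINT x:A i|lborel. v x)"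
      using A union by (intro lebesgue_integral_countable_add si) (auto simp: disjoint_family_on_def)
    then show ?case using union by simp
  qed (simp add: set_lebesgue_integral_def)
  then have "(LINT x:A|lborel. v x) = (LINT x:A|lborel. 0)" if "A \<in> sets lborel" for A
    using that by (simp add: borel_Iio set_lebesgue_integral_def)
  then show ?thesis
    by (intro density_unique_real[of lborel v "\<lambda>_. 0"] int) auto
qed

text \<open>In the variable \<open>e\<^sup>-\<^sup>c\<^sup>t\<close> these are moments on \<open>(0,1]\<close>, so the Weierstrass theorem applies.\<close>

lemma AE_zero_if_exp_moments_zero:
  fixes v :: "real \<Rightarrow> real" and c :: real
  assumes int: "integrable lebesgue v" and v0: "\<And>t. t \<le> 0 \<Longrightarrow> v t = 0" and "c > 0"
    and zero: "\<And>j. (LINT t|lebesgue. v t * exp (- c * t) ^ j) = 0"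
  shows "AE t in lebesgue. v t = 0"
proof -
  \<comment> \<open>The cut-off at 0 keeps X in [0,1] on the whole line; it changes nothing in the
    integrals, because v vanishes for t \<le> 0.\<close>
  define X where "X = (\<lambda>t::real. exp (- c * max 0 t))"
  have X: "0 \<le> X t" "X t \<le> 1" for t
    using \<open>c > 0\<close> by (auto simp: X_def)
  have cX: "continuous_on UNIV X"
    unfolding X_def by (intro continuous_intros)
  have meas: "(\<lambda>t. F (X t)) \<in> borel_measurable lebesgue" if "continuous_on UNIV F" for F :: "real \<Rightarrow> real"
  proof -
    have "continuous_on UNIV (\<lambda>t. F (X t))"
      using continuous_on_compose2[OF that cX] by simp
    then show ?thesis
      by (intro measurable_completion) (simp add: borel_measurable_continuous_onI)
  qed
  have intF: "integrable lebesgue (\<lambda>t. v t * F (X t))" if "continuous_on UNIV F" for F :: "real \<Rightarrow> real"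
  proof -
    have "compact (F ` {0..1})"
      using that by (intro compact_continuous_image) (auto intro: continuous_on_subset)
    then obtain B where B: "\<forall>x\<in>{0..1}. \<bar>F x\<bar> \<le> B"
      by (auto dest!: compact_imp_bounded simp: bounded_iff)
    have "\<bar>F (X t)\<bar> \<le> B" for t
      using X B by auto
    then have "\<bar>v t\<bar> * \<bar>F (X t)\<bar> \<le> \<bar>v t\<bar> * \<bar>B\<bar>" for t
      by (intro mult_left_mono) (auto intro: order_trans[OF _ abs_ge_self])
    then show ?thesis
      using borel_measurable_times[OF borel_measurable_integrable[OF int] meas[OF that]]
      by (intro Bochner_Integration.integrable_bound[OF integrable_mult_right[OF int, of B]])
         (auto simp: abs_mult mult.commute[of "\<bar>B\<bar>"])
  qed
  have zeroX: "(LINT t|lebesgue. v t * X t ^ j) = 0" for j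
  proof -
    have "v t * X t ^ j = v t * exp (- c * t) ^ j" for t
      using v0[of t] by (cases "t \<le> 0") (auto simp: X_def)
    then show ?thesis by (simp only: zero)
  qed
  have poly: "(LINT t|lebesgue. v t * poly p (X t)) = 0" for p
  proof -
    have "(LINT t|lebesgue. v t * poly p (X t))
        = (LINT t|lebesgue. (\<Sum>i\<le>degree p. coeff p i * (v t * X t ^ i)))"
      by (simp add: poly_altdef sum_distrib_left mult_ac)
    also have "\<dots> = (\<Sum>i\<le>degree p. coeff p i * (LINT t|lebesgue. v t * X t ^ i))"
      by (subst Bochner_Integration.integral_sum)
         (auto intro!: intF integrable_mult_right continuous_intros)
    finally show ?thesis by (simp add: zeroX)
  qed
  have cont: "(LINT t|lebesgue. v t * F (X t)) = 0" if F: "continuous_on UNIV F" for F :: "real \<Rightarrow> real"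
  proof -
    have *: "\<bar>LINT t|lebesgue. v t * F (X t)\<bar> \<le> e * (LINT t|lebesgue. \<bar>v t\<bar>)" if "e > 0" for e
    proof -
      obtain N where N: "\<And>x. x \<in> {0..1} \<Longrightarrow>
          \<bar>F x - (\<Sum>k\<le>N. F (real k / real N) * Bernstein N k x)\<bar> < e"
        using Bernstein_Weierstrass[OF continuous_on_subset[OF F] \<open>e > 0\<close>] by blast
      \<comment> \<open>The Bernstein approximant of F, written as a formal polynomial so that
        \<open>poly\<close> applies.\<close>
      define p where "p = (\<Sum>k\<le>N. smult (F (real k / real N) * real (N choose k))
          ([:0, 1:] ^ k * [:1, -1:] ^ (N - k)))"
      have p: "\<bar>F (X t) - poly p (X t)\<bar> \<le> e" for t
        using N[of "X t"] X[of t] by (simp add: p_def poly_sum Bernstein_def mult.assoc)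
      have ip: "integrable lebesgue (\<lambda>t. v t * poly p (X t))"
        by (intro intF continuous_intros)
      have "(LINT t|lebesgue. v t * F (X t)) = (LINT t|lebesgue. v t * F (X t) - v t * poly p (X t))"
        using poly intF[OF F] ip by simp
      also have "\<bar>\<dots>\<bar> \<le> (LINT t|lebesgue. \<bar>v t * F (X t) - v t * poly p (X t)\<bar>)"
        by (rule integral_abs_bound)
      also have "\<dots> \<le> (LINT t|lebesgue. e * \<bar>v t\<bar>)"
      proof (rule integral_mono)
        fix t
        have "\<bar>v t\<bar> * \<bar>F (X t) - poly p (X t)\<bar> \<le> \<bar>v t\<bar> * e"
          using p by (intro mult_left_mono) auto
        then show "\<bar>v t * F (X t) - v t * poly p (X t)\<bar> \<le> e * \<bar>v t\<bar>"
          by (simp add: mult.commute flip: abs_mult right_diff_distrib)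
      qed (use int intF[OF F] ip in auto)
      finally show ?thesis by simp
    qed
    have "\<bar>LINT t|lebesgue. v t * F (X t)\<bar> \<le> 0"
    proof (rule field_le_epsilon)
      fix e :: real assume "e > 0"
      \<comment> \<open>V may be 0, so the tolerance is divided by V + 1.\<close>
      define V where "V = (LINT t|lebesgue. \<bar>v t\<bar>)"
      have "V \<ge> 0" unfolding V_def by (rule Bochner_Integration.integral_nonneg) simp
      have "\<bar>LINT t|lebesgue. v t * F (X t)\<bar> \<le> e / (V + 1) * V"
        using *[of "e / (V + 1)"] \<open>e > 0\<close> \<open>V \<ge> 0\<close> unfolding V_def[symmetric] by simp
      also have "\<dots> \<le> e"
        using \<open>e > 0\<close> \<open>V \<ge> 0\<close> by (simp add: field_simps)
      finally show "\<bar>LINT t|lebesgue. v t * F (X t)\<bar> \<le> 0 + e" by simp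
    qed
    then show ?thesis by simp
  qed
  have lt: "(LINT t|lebesgue. v t * indicator {..<a} t) = 0" for a
  proof (cases "a \<le> 0")
    case True
    then have z: "v t * indicator {..<a} t = 0" for t
      using v0[of t] by (auto simp: indicator_def)
    show ?thesis unfolding z by simp
  next
    case False
    define y where "y = exp (- c * a)"
    \<comment> \<open>Continuous ramps tending to the indicator of x > y; since a > 0, X t > y holds
      exactly for t < a.\<close>
    define F where "F = (\<lambda>(m::nat) x::real. min 1 (max 0 (real m * (x - y))))"
    have F: "continuous_on UNIV (F m)" for m
      unfolding F_def by (intro continuous_intros)
    have "(\<lambda>m. LINT t|lebesgue. v t * F m (X t)) \<longlonglongrightarrow> (LINT t|lebesgue. v t * indicator {..<a} t)"
    proof (rule integral_dominated_convergence[where w = "\<lambda>t. \<bar>v t\<bar>"])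
      show "AE t in lebesgue. (\<lambda>m. v t * F m (X t)) \<longlonglongrightarrow> v t * indicator {..<a} t"
      proof (intro AE_I2 tendsto_mult_left)
        fix t
        show "(\<lambda>m. F m (X t)) \<longlonglongrightarrow> indicator {..<a} t"
        proof (cases "t < a")
          case True
          then have "X t > y"
            using False \<open>c > 0\<close> by (auto simp: X_def y_def)
          then have "filterlim (\<lambda>m. real m * (X t - y)) at_top sequentially"
            by (intro filterlim_at_top_mult_tendsto_pos[OF _ _ filterlim_real_sequentially, of _ "X t - y"])
               auto
          then have "\<forall>\<^sub>F m in sequentially. 1 \<le> real m * (X t - y)"
            by (simp add: filterlim_at_top)
          then have "\<forall>\<^sub>F m in sequentially. F m (X t) = indicator {..<a} t"
            by eventually_elim (use True in \<open>auto simp: F_def\<close>)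
          then show ?thesis by (rule tendsto_eventually)
        next
          case False
          then have "X t \<le> y"
            using \<open>\<not> a \<le> 0\<close> \<open>c > 0\<close> by (auto simp: X_def y_def)
          then have "real m * (X t - y) \<le> 0" for m
            by (intro mult_nonneg_nonpos) auto
          then show ?thesis using False by (simp add: F_def max_absorb1)
        qed
      qed
      show "AE t in lebesgue. norm (v t * F m (X t)) \<le> \<bar>v t\<bar>" for m
        by (intro AE_I2) (auto simp: F_def abs_mult intro!: mult_left_le)
      show "(\<lambda>t. v t * F m (X t)) \<in> borel_measurable lebesgue" for m
        using intF[OF F] by (rule borel_measurable_integrable)
      show "(\<lambda>t. v t * indicator {..<a} t) \<in> borel_measurable lebesgue"
        using borel_measurable_integrable[OF int]
        by (intro borel_measurable_times borel_measurable_indicator) auto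
    qed (use int in auto)
    then show ?thesis
      using cont[OF F] by (simp add: LIMSEQ_const_iff)
  qed
  \<comment> \<open>The Dynkin argument runs on Borel sets, whereas v is only Lebesgue measurable; a
    Borel version of v bridges the two.\<close>
  obtain v' where v': "v' \<in> borel_measurable lborel" "AE t in lborel. v t = v' t"
    using completion_ex_borel_measurable_real[OF borel_measurable_integrable[OF int]] by blast
  have AE': "AE t in lebesgue. v t = v' t"
    using v'(2) by (rule AE_completion)
  have int': "integrable lebesgue v'"
    using int AE' v'(1) borel_measurable_integrable[OF int]
    by (subst integrable_cong_AE[of v' lebesgue v]) (auto intro: measurable_completion elim: eventually_mono)
  have transfer: "(LINT t|lborel. v' t * g t) = (LINT t|lebesgue. v t * g t)"
    if g: "g \<in> borel_measurable borel" for g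
  proof -
    have "(LINT t|lborel. v' t * g t) = (LINT t|lebesgue. v' t * g t)"
      using v'(1) g by (intro integral_completion[symmetric]) auto
    also have "\<dots> = (LINT t|lebesgue. v t * g t)"
      using AE' v'(1) g borel_measurable_integrable[OF int]
      by (intro integral_cong_AE borel_measurable_times) (auto intro: measurable_completion elim: eventually_mono)
    finally show ?thesis .
  qed
  have "AE t in lborel. v' t = 0"
  proof (rule AE_zero_if_lessThan_integrals_zero)
    show "integrable lborel v'"
      using int' v'(1) by (simp add: integrable_completion)
    show "(LINT t|lborel. v' t) = 0"
      using transfer[of "\<lambda>_. 1"] zero[of 0] by simp
    show "(LINT t:{..<a}|lborel. v' t) = 0" for a
      using transfer[of "indicator {..<a}"] lt[of a] by (simp add: set_lebesgue_integral_def mult.commute)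
  qed
  then have "AE t in lebesgue. v' t = 0"
    by (rule AE_completion)
  with AE' show ?thesis
    by eventually_elim simp
qed

text \<open>The power series of \<open>e\<^sup>-\<^sup>c\<^sup>t\<close> carries the vanishing of all moments of \<open>v(t) e\<^sup>-\<^sup>j\<^sup>c\<^sup>t\<close> over
  from \<open>j\<close> to \<open>j + 1\<close>.\<close>

lemma AE_zero_if_moments_zero:
  fixes v :: "real \<Rightarrow> real" and c :: real
  assumes int: "\<And>k. integrable lebesgue (\<lambda>t. v t * t ^ k * exp (c * t))"
    and v0: "\<And>t. t \<le> 0 \<Longrightarrow> v t = 0" and "c > 0"
    and zero: "\<And>k. (LINT t|lebesgue. v t * t ^ k) = 0"
  shows "AE t in lebesgue. v t = 0"
proof -
  have exp_meas: "(\<lambda>t. exp (b * t)) \<in> borel_measurable lebesgue" for b :: real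
    by (intro measurable_completion) simp
  have intE: "integrable lebesgue (\<lambda>t. v t * t ^ k * exp (- c * t) ^ j)" for k j
  proof (rule Bochner_Integration.integrable_bound[OF int[of k]])
    \<comment> \<open>The second exponential cancels exp(c t) and leaves exp(-c t)^j, so
      measurability comes from the integrability assumption.\<close>
    have "(\<lambda>t. v t * t ^ k * exp (c * t) * exp (- (c + c * real j) * t)) \<in> borel_measurable lebesgue"
      using borel_measurable_integrable[OF int] exp_meas by (rule borel_measurable_times)
    then show "(\<lambda>t. v t * t ^ k * exp (- c * t) ^ j) \<in> borel_measurable lebesgue"
      by (simp add: algebra_simps flip: exp_of_nat_mult exp_add)
    show "AE t in lebesgue. norm (v t * t ^ k * exp (- c * t) ^ j) \<le> norm (v t * t ^ k * exp (c * t))"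
    proof (intro AE_I2)
      fix t
      show "norm (v t * t ^ k * exp (- c * t) ^ j) \<le> norm (v t * t ^ k * exp (c * t))"
      proof (cases "t \<le> 0")
        case False
        then have "exp (- c * t) ^ j \<le> 1" "1 \<le> exp (c * t)"
          using \<open>c > 0\<close> by (auto intro!: power_le_one)
        then have "exp (- c * t) ^ j \<le> exp (c * t)"
          by (rule order_trans)
        then have "\<bar>v t * t ^ k\<bar> * exp (- c * t) ^ j \<le> \<bar>v t * t ^ k\<bar> * exp (c * t)"
          by (intro mult_left_mono) auto
        then show ?thesis by (simp add: abs_mult)
      qed (simp add: v0)
    qed
  qed
  have "(LINT t|lebesgue. v t * t ^ k * exp (- c * t) ^ j) = 0" for j k
  proof (induction j arbitrary: k)
    case 0
    then show ?case using zero by simp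
  next
    case (Suc j)
    \<comment> \<open>Partial sums of exp(-c t). By the induction hypothesis for all powers of t
      each contributes integral 0, and |S n t| \<le> exp(c t) for t > 0 is where the exponential
      integrability of v provides the majorant.\<close>
    define S where "S = (\<lambda>n t. \<Sum>m<n. (- c * t) ^ m / fact m)"
    have S_eq: "v t * t ^ k * exp (- c * t) ^ j * S n t
        = (\<Sum>m<n. (- c) ^ m / fact m * (v t * t ^ (k + m) * exp (- c * t) ^ j))" for n t
      unfolding S_def sum_distrib_left power_mult_distrib power_add by (simp add: mult_ac)
    have S0: "(LINT t|lebesgue. v t * t ^ k * exp (- c * t) ^ j * S n t) = 0" for n
      unfolding S_eq
      by (subst Bochner_Integration.integral_sum, rule integrable_mult_right, rule intE)
         (simp only: integral_mult_right_zero Suc.IH mult_zero_right sum.neutral_const)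
    have "(\<lambda>n. LINT t|lebesgue. v t * t ^ k * exp (- c * t) ^ j * S n t) \<longlonglongrightarrow>
        (LINT t|lebesgue. v t * t ^ k * exp (- c * t) ^ Suc j)"
    proof (rule integral_dominated_convergence[where w = "\<lambda>t. \<bar>v t * t ^ k * exp (c * t)\<bar>"])
      show "(\<lambda>t. v t * t ^ k * exp (- c * t) ^ Suc j) \<in> borel_measurable lebesgue"
        using intE by (rule borel_measurable_integrable)
      show "(\<lambda>t. v t * t ^ k * exp (- c * t) ^ j * S n t) \<in> borel_measurable lebesgue" for n
        unfolding S_eq by (intro borel_measurable_sum borel_measurable_times borel_measurable_const
            borel_measurable_integrable[OF intE])
      show "integrable lebesgue (\<lambda>t. \<bar>v t * t ^ k * exp (c * t)\<bar>)"
        using int by (rule integrable_abs)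
      have "S n t \<in> UNIV \<and> (\<lambda>n. S n t) \<longlonglongrightarrow> exp (- c * t)" for n t
        using exp_converges[of "- c * t"] unfolding S_def sums_def by (simp add: divide_inverse mult.commute)
      then have "(\<lambda>n. v t * t ^ k * exp (- c * t) ^ j * S n t) \<longlonglongrightarrow> v t * t ^ k * exp (- c * t) ^ j * exp (- c * t)" for t
        by (intro tendsto_mult_left) simp
      then show "AE t in lebesgue. (\<lambda>n. v t * t ^ k * exp (- c * t) ^ j * S n t)
          \<longlonglongrightarrow> v t * t ^ k * exp (- c * t) ^ Suc j"
        by (intro AE_I2) (simp add: mult_ac)
      show "AE t in lebesgue. norm (v t * t ^ k * exp (- c * t) ^ j * S n t) \<le> \<bar>v t * t ^ k * exp (c * t)\<bar>" for n
      proof (intro AE_I2)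
        fix t
        show "norm (v t * t ^ k * exp (- c * t) ^ j * S n t) \<le> \<bar>v t * t ^ k * exp (c * t)\<bar>"
        proof (cases "t \<le> 0")
          case False
          have "\<bar>S n t\<bar> \<le> (\<Sum>m<n. (c * t) ^ m / fact m)"
            unfolding S_def using False \<open>c > 0\<close>
            by (intro order_trans[OF sum_abs]) (simp add: abs_mult power_abs)
          also have "\<dots> \<le> exp (c * t)"
          proof -
            have "(\<lambda>m. (c * t) ^ m / fact m) sums exp (c * t)"
              using exp_converges[of "c * t"] by (simp add: divide_inverse mult.commute)
            then show ?thesis
              using False \<open>c > 0\<close> sum_le_suminf[of "\<lambda>m. (c * t) ^ m / fact m" "{..<n}"]
              by (auto simp: sums_iff)
          qed
          finally have "\<bar>S n t\<bar> \<le> exp (c * t)" .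
          moreover have "exp (- c * t) ^ j \<le> 1"
            using False \<open>c > 0\<close> by (auto intro!: power_le_one)
          ultimately have "\<bar>v t * t ^ k\<bar> * (exp (- c * t) ^ j * \<bar>S n t\<bar>) \<le> \<bar>v t * t ^ k\<bar> * (1 * exp (c * t))"
            by (intro mult_left_mono mult_mono) auto
          then show ?thesis by (simp add: abs_mult mult_ac)
        qed (simp add: v0)
      qed
    qed
    then show ?case
      unfolding S0 by (simp add: LIMSEQ_const_iff)
  qed
  from this[of 0] show ?thesis
    using intE[of 0 0] by (intro AE_zero_if_exp_moments_zero[OF _ v0 \<open>c > 0\<close>]) auto
qed

section \<open>Smooth representatives\<close>

text \<open>g and G 0 agree only for t > 0; since that set is open they agree near each of its
  points, and iterated \<open>deriv\<close> sees nothing else.\<close>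

lemma higher_deriv_eqI:
  fixes g :: "real \<Rightarrow> real" and G :: "nat \<Rightarrow> real \<Rightarrow> real"
  assumes "\<And>t. t > 0 \<Longrightarrow> g t = G 0 t"
    and "\<And>j t. j < r \<Longrightarrow> t > 0 \<Longrightarrow> (G j has_real_derivative G (Suc j) t) (at t)"
    and "j \<le> r" "t > 0"
  shows "(deriv ^^ j) g t = G j t"
  using assms(3,4)
proof (induction j arbitrary: t)
  case (Suc j)
  have "\<forall>\<^sub>F x in nhds t. (deriv ^^ j) g x = G j x"
    using eventually_nhds_in_open[OF open_greaterThan, of t 0] Suc by (auto elim!: eventually_mono)
  then have "deriv ((deriv ^^ j) g) t = deriv (G j) t"
    by (intro deriv_cong_ev) auto
  also have "\<dots> = G (Suc j) t"
    using assms(2) Suc by (intro DERIV_imp_deriv) auto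
  finally show ?case by simp
qed (use assms(1) in simp)

lemma C_class_posI:
  fixes g :: "real \<Rightarrow> real" and G :: "nat \<Rightarrow> real \<Rightarrow> real"
  assumes eq: "\<And>t. t > 0 \<Longrightarrow> g t = G 0 t"
    and der: "\<And>j t. j < r \<Longrightarrow> t > 0 \<Longrightarrow> (G j has_real_derivative G (Suc j) t) (at t)"
    and cont: "continuous_on {0<..} (G r)"
  shows "g \<in> C_class_pos r"
proof -
  have h: "(deriv ^^ j) g t = G j t" if "j \<le> r" "t > 0" for j t
    using higher_deriv_eqI[of g G r, OF eq der that] by blast
  have "(deriv ^^ j) g field_differentiable at t" if "j < r" "t > 0" for j t
  proof -
    have "((deriv ^^ j) g has_real_derivative G (Suc j) t) (at t)"
      using der[OF that] open_greaterThan that h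
      by (rule_tac has_field_derivative_transform_within_open[of "G j" _ _ "{0<..}"]) auto
    then show ?thesis
      unfolding field_differentiable_def by blast
  qed
  moreover have "continuous_on {0<..} ((deriv ^^ r) g)"
    using cont h by (subst continuous_on_cong[OF refl, of _ _ "G r"]) auto
  ultimately show ?thesis
    by (simp add: C_class_pos_def)
qed

lemma C_class_pos_isCont:
  assumes "g \<in> C_class_pos r" "r \<ge> 1" "t > 0"
  shows "isCont g t"
proof -
  have "0 < r"
    using assms(2) by simp
  then have "(deriv ^^ 0) g field_differentiable at t"
    using assms unfolding C_class_pos_def by blast
  then show ?thesis
    using field_differentiable_imp_continuous_at by auto
qed

text \<open>If continuous g and h differed at t they would differ on an interval, which has positive
  measure. This carries the estimate for the series over to every representative.\<close>

lemma C_representative_unique: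
  assumes "is_C_representative r f g" "is_C_representative r f h" "r \<ge> 1" "t > 0"
  shows "g t = h t"
proof (rule ccontr)
  assume "g t \<noteq> h t"
  define d where "d = (\<lambda>x. g x - h x)"
  have "isCont d t"
    using assms C_class_pos_isCont unfolding is_C_representative_def d_def
    by (intro continuous_intros) auto
  then have "(d \<longlongrightarrow> d t) (nhds t)"
    by (simp add: isCont_def tendsto_at_iff_tendsto_nhds)
  then have "\<forall>\<^sub>F x in nhds t. d x \<noteq> 0"
    using \<open>g t \<noteq> h t\<close> by (intro tendsto_imp_eventually_ne[of d "d t"]) (simp_all add: d_def)
  moreover have "\<forall>\<^sub>F x in nhds t. x > 0"
    using eventually_nhds_in_open[OF open_greaterThan, of t 0] assms by auto
  ultimately have "\<forall>\<^sub>F x in nhds t. x > 0 \<and> g x \<noteq> h x"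
    by eventually_elim (auto simp: d_def)
  then obtain d where d: "d > 0" "\<And>x. dist x t < d \<Longrightarrow> x > 0 \<and> g x \<noteq> h x"
    by (auto simp: eventually_nhds_metric)
  have "AE x in lebesgue. 0 < x \<longrightarrow> g x = h x"
    using assms(1,2) unfolding is_C_representative_def by (auto elim: eventually_elim2)
  then have "AE x in lebesgue. x \<notin> {t - d<..<t + d}"
    by (rule eventually_mono) (use d(2) in \<open>force simp: dist_real_def abs_less_iff\<close>)
  then have "emeasure lebesgue {t - d<..<t + d} = 0"
    by (subst AE_iff_measurable[symmetric, of "{t - d<..<t + d}" lebesgue "\<lambda>x. x \<notin> {t - d<..<t + d}"]) auto
  then show False
    using d(1) by simp
qed

section \<open>Laguerre series of an L2 function\<close>

lemma weighted_L2_mult_integrable: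
  assumes f: "f \<in> weighted_L2 \<alpha>"
    and q: "continuous_on {0<..} q" "(\<lambda>t. laguerre_weight \<alpha> t * (q t)\<^sup>2) absolutely_integrable_on {0<..}"
  shows "(\<lambda>t. laguerre_weight \<alpha> t * f t * q t) absolutely_integrable_on {0<..}"
proof (rule set_integrable_bound)
  \<comment> \<open>Since |f q| \<le> f^2 + q^2, this sum is an integrable majorant.\<close>
  show "(\<lambda>t. laguerre_weight \<alpha> t * (f t)\<^sup>2 + laguerre_weight \<alpha> t * (q t)\<^sup>2) absolutely_integrable_on {0<..}"
    using f q(2) by (intro set_integral_add) (auto simp: weighted_L2_def)
  have "continuous_on {0<..} (\<lambda>t. laguerre_weight \<alpha> t * q t)"
    unfolding laguerre_weight_def by (intro continuous_intros q) auto
  then have "(\<lambda>t. indicator {0<..} t *\<^sub>R (laguerre_weight \<alpha> t * q t)) \<in> borel_measurable lebesgue"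
    using borel_measurable_continuous_on_indicator[of "{0<..}" "\<lambda>t. laguerre_weight \<alpha> t * q t"]
    by (intro measurable_completion) simp
  moreover have "(\<lambda>t. indicator {0<..} t *\<^sub>R f t) \<in> borel_measurable lebesgue"
    using f by (simp add: weighted_L2_def set_borel_measurable_def)
  ultimately have "(\<lambda>t. (indicator {0<..} t *\<^sub>R (laguerre_weight \<alpha> t * q t)) * (indicator {0<..} t *\<^sub>R f t))
      \<in> borel_measurable lebesgue"
    by (rule borel_measurable_times)
  then show "set_borel_measurable lebesgue {0<..} (\<lambda>t. laguerre_weight \<alpha> t * f t * q t)"
    unfolding set_borel_measurable_def
    by (rule measurable_cong[THEN iffD1, rotated]) (auto simp: indicator_def)
  show "AE t in lebesgue. t \<in> {0<..} \<longrightarrow> norm (laguerre_weight \<alpha> t * f t * q t)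
      \<le> norm (laguerre_weight \<alpha> t * (f t)\<^sup>2 + laguerre_weight \<alpha> t * (q t)\<^sup>2)"
  proof (intro AE_I2 impI)
    fix t :: real
    have "\<bar>f t * q t\<bar> \<le> (f t)\<^sup>2 + (q t)\<^sup>2"
      using sum_squares_bound[of "\<bar>f t\<bar>" "\<bar>q t\<bar>"] abs_ge_zero[of "f t * q t"]
      unfolding abs_mult power2_abs by linarith
    then have "laguerre_weight \<alpha> t * \<bar>f t * q t\<bar> \<le> laguerre_weight \<alpha> t * ((f t)\<^sup>2 + (q t)\<^sup>2)"
      using laguerre_weight_nonneg by (intro mult_left_mono) auto
    then show "norm (laguerre_weight \<alpha> t * f t * q t)
      \<le> norm (laguerre_weight \<alpha> t * (f t)\<^sup>2 + laguerre_weight \<alpha> t * (q t)\<^sup>2)"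
      by (simp add: abs_mult laguerre_weight_nonneg distrib_left mult.assoc)
  qed
qed

definition laguerre_series :: "real \<Rightarrow> (nat \<Rightarrow> real) \<Rightarrow> nat \<Rightarrow> real \<Rightarrow> real" where
  "laguerre_series \<alpha> c j t = (\<Sum>k. c k * laguerre_on_deriv \<alpha> j k t)"

text \<open>The bound K k^j holds after multiplication by sqrt(w). Near a given t the weight stays
  away from 0, so the Weierstrass test gives locally uniform convergence, hence termwise
  differentiation r times.\<close>

lemma laguerre_series_facts:
  assumes "\<alpha> \<ge> 0" and sum: "summable (\<lambda>k. real k ^ r * \<bar>c k\<bar>)"
  shows laguerre_series_sums: "j \<le> r \<Longrightarrow> t > 0 \<Longrightarrow>
      (\<lambda>k. c k * laguerre_on_deriv \<alpha> j k t) sums laguerre_series \<alpha> c j t"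
    and laguerre_series_deriv: "j < r \<Longrightarrow> t > 0 \<Longrightarrow>
      (laguerre_series \<alpha> c j has_real_derivative laguerre_series \<alpha> c (Suc j) t) (at t)"
    and laguerre_series_cont: "j \<le> r \<Longrightarrow> continuous_on {0<..} (laguerre_series \<alpha> c j)"
proof -
  obtain K where K: "K > 0" "\<And>j k t. t > 0 \<Longrightarrow>
    sqrt (laguerre_weight \<alpha> t) * \<bar>laguerre_on_deriv \<alpha> j k t\<bar> \<le> K * real k ^ j"
    using laguerre_on_deriv_bound[OF assms(1)] by metis
  have sum_j: "summable (\<lambda>k. real k ^ j * \<bar>c k\<bar>)" if "j \<le> r" for j
  proof (rule summable_comparison_test'[OF sum])
    fix k :: nat assume "k \<ge> 1"
    then show "norm (real k ^ j * \<bar>c k\<bar>) \<le> real k ^ r * \<bar>c k\<bar>"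
      using that by (auto intro!: mult_right_mono power_increasing)
  qed
  have unif: "uniform_limit {t / 2<..<t + 1} (\<lambda>n x. \<Sum>k<n. c k * laguerre_on_deriv \<alpha> j k x)
      (laguerre_series \<alpha> c j) sequentially" if "j \<le> r" "t > 0" for j t
  proof -
    \<comment> \<open>A lower bound for sqrt(w) on the interval: the power increases, so its left
      end counts; the exponential decreases, so its right end counts.\<close>
    define m where "m = sqrt ((t / 2) powr \<alpha> * exp (- (t + 1)))"
    have m: "m > 0" using that by (simp add: m_def)
    have "norm (c k * laguerre_on_deriv \<alpha> j k x) \<le> K / m * (real k ^ j * \<bar>c k\<bar>)"
      if x: "x \<in> {t / 2<..<t + 1}" for k x
    proof -
      have "x > 0" using x \<open>t > 0\<close> by simp
      have "m \<le> sqrt (laguerre_weight \<alpha> x)"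
        unfolding m_def laguerre_weight_def using x \<open>t > 0\<close> assms(1)
        by (intro real_sqrt_le_mono mult_mono powr_mono2) auto
      then have "m * \<bar>laguerre_on_deriv \<alpha> j k x\<bar> \<le> K * real k ^ j"
        using K(2)[OF \<open>x > 0\<close>, of j k] by (meson abs_ge_zero mult_right_mono order_trans)
      then have "\<bar>c k\<bar> * (m * \<bar>laguerre_on_deriv \<alpha> j k x\<bar>) \<le> \<bar>c k\<bar> * (K * real k ^ j)"
        by (intro mult_left_mono) auto
      then show ?thesis
        using m by (simp add: abs_mult field_simps)
    qed
    moreover have "summable (\<lambda>k. K / m * (real k ^ j * \<bar>c k\<bar>))"
      by (intro summable_mult sum_j that)
    ultimately show ?thesis
      unfolding laguerre_series_def by (rule Weierstrass_m_test)
  qed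
  show sums: "(\<lambda>k. c k * laguerre_on_deriv \<alpha> j k t) sums laguerre_series \<alpha> c j t"
    if "j \<le> r" "t > 0" for j t
    using tendsto_uniform_limitI[OF unif[OF that], of t] that by (simp add: sums_def)
  show "(laguerre_series \<alpha> c j has_real_derivative laguerre_series \<alpha> c (Suc j) t) (at t)"
    if "j < r" "t > 0" for j t
  proof -
    have "((\<lambda>x. \<Sum>k. c k * laguerre_on_deriv \<alpha> j k x) has_field_derivative
        (\<Sum>k. c k * laguerre_on_deriv \<alpha> (Suc j) k t)) (at t)"
    proof (rule has_field_derivative_series'(2)[where S = "{t / 2<..<t + 1}" and ?x0.0 = t])
      show "((\<lambda>x. c n * laguerre_on_deriv \<alpha> j n x) has_real_derivative
          c n * laguerre_on_deriv \<alpha> (Suc j) n x) (at x within {t / 2<..<t + 1})" for n x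
        by (intro DERIV_cmult has_field_derivative_at_within[OF laguerre_on_deriv_Suc])
      show "uniformly_convergent_on {t / 2<..<t + 1} (\<lambda>n x. \<Sum>i<n. c i * laguerre_on_deriv \<alpha> (Suc j) i x)"
        using unif[of "Suc j" t] that unfolding uniformly_convergent_on_def by auto
      show "summable (\<lambda>n. c n * laguerre_on_deriv \<alpha> j n t)"
        using sums[of j t] that by (simp add: sums_iff)
    qed (use that in \<open>auto simp: interior_open\<close>)
    then show ?thesis
      by (simp add: laguerre_series_def[abs_def])
  qed
  show "continuous_on {0<..} (laguerre_series \<alpha> c j)" if "j \<le> r" for j
  proof (rule continuous_at_imp_continuous_on, rule ballI)
    fix t :: real assume "t \<in> {0<..}"
    then have t: "t > 0" by simp
    have "continuous_on {t / 2<..<t + 1} (laguerre_series \<alpha> c j)"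
    proof (rule uniform_limit_theorem[OF _ unif[OF that t]])
      show "\<forall>\<^sub>F n in sequentially. continuous_on {t / 2<..<t + 1}
          (\<lambda>x. \<Sum>k<n. c k * laguerre_on_deriv \<alpha> j k x)"
        unfolding laguerre_on_deriv_def by (intro always_eventually allI continuous_intros)
    qed simp
    then show "isCont (laguerre_series \<alpha> c j) t"
      using t by (auto simp: continuous_on_eq_continuous_at)
  qed
qed

lemma continuous_on_set_borel_measurable_lebesgue:
  fixes q :: "real \<Rightarrow> real"
  assumes "continuous_on {0<..} q"
  shows "set_borel_measurable lebesgue {0<..} q"
  unfolding set_borel_measurable_def
  using borel_measurable_continuous_on_indicator[OF _ assms]
  by (intro measurable_completion) simp

lemma sqrt_laguerre_weight:
  assumes "t > 0"
  shows "sqrt (laguerre_weight \<alpha> t) = t powr (\<alpha> / 2) * exp (- (1 / 2) * t)"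
proof -
  have "sqrt (exp (- t)) = exp (- (1 / 2) * t)"
    by (intro real_sqrt_unique) (simp_all add: power2_eq_square flip: exp_add)
  then show ?thesis
    using assms by (simp add: laguerre_weight_def real_sqrt_mult powr_half_sqrt_powr)
qed

lemma laguerre_weight_eq_sqrt_mult:
  "laguerre_weight \<alpha> t = sqrt (laguerre_weight \<alpha> t) * sqrt (laguerre_weight \<alpha> t)"
  by (simp add: laguerre_weight_nonneg)

lemma laguerre_on_orthonormal:
  assumes "\<alpha> \<ge> 0"
  shows "(LINT t:{0<..}|lebesgue. laguerre_weight \<alpha> t * (laguerre_on \<alpha> n t * laguerre_on \<alpha> m t))
    = (if n = m then 1 else 0)"
proof -
  define d where "d = (\<lambda>n. sqrt (fact n / Gamma (real n + \<alpha> + 1)))"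
  have "(LINT t:{0<..}|lebesgue. laguerre_weight \<alpha> t * (laguerre_on \<alpha> n t * laguerre_on \<alpha> m t))
    = (LINT t:{0<..}|lebesgue. d n * d m * (laguerre_weight \<alpha> t * (laguerre \<alpha> n t * laguerre \<alpha> m t)))"
    by (simp add: laguerre_on_def d_def mult_ac)
  also have "\<dots> = d n * d m * (LINT t:{0<..}|lebesgue. laguerre_weight \<alpha> t * (laguerre \<alpha> n t * laguerre \<alpha> m t))"
    by (rule set_integral_mult_right)
  also have "\<dots> = (if n = m then 1 else 0)"
  proof (cases "n = m")
    case True
    have "d m * d m = fact m / Gamma (real m + \<alpha> + 1)"
      using laguerre_norm_pos[OF assms, of m] unfolding d_def
      by (subst real_sqrt_mult_self) (simp add: zero_less_divide_iff)
    moreover have "Gamma (real m + \<alpha> + 1) \<noteq> 0"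
      using assms by (intro Gamma_real_pos[THEN less_imp_neq, symmetric]) auto
    ultimately show ?thesis
      using True laguerre_norm[of \<alpha> m] assms by (simp add: power2_eq_square)
  qed (use laguerre_orthogonal[of \<alpha> n m] assms in simp)
  finally show ?thesis .
qed

text \<open>Absolute summability of c makes sqrt(w) times the partial sums uniformly bounded. This
  bounds the limit and allows integration term by term against an orthonormal function.\<close>

lemma laguerre_series_inner:
  assumes "\<alpha> \<ge> 0" and sum: "summable (\<lambda>k. \<bar>c k\<bar>)"
  shows laguerre_series_bounded: "\<exists>M. \<forall>t>0. sqrt (laguerre_weight \<alpha> t) * \<bar>laguerre_series \<alpha> c 0 t\<bar> \<le> M"
    and laguerre_series_coeff: "(LINT t:{0<..}|lebesgue.
      laguerre_weight \<alpha> t * laguerre_series \<alpha> c 0 t * laguerre_on \<alpha> m t) = c m"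
proof -
  obtain K where K: "K > 0" "\<And>j k t. t > 0 \<Longrightarrow>
    sqrt (laguerre_weight \<alpha> t) * \<bar>laguerre_on_deriv \<alpha> j k t\<bar> \<le> K * real k ^ j"
    using laguerre_on_deriv_bound[OF assms(1)] by metis
  define w where "w = laguerre_weight \<alpha>"
  define G where "G = laguerre_series \<alpha> c 0"
  define S where "S = (\<lambda>n t. \<Sum>k<n. c k * laguerre_on \<alpha> k t)"
  define M where "M = K * (\<Sum>k. \<bar>c k\<bar>)"
  have sum': "summable (\<lambda>k. real k ^ 0 * \<bar>c k\<bar>)"
    using sum by simp
  have S_lim: "(\<lambda>n. S n t) \<longlonglongrightarrow> G t" if "t > 0" for t
    using laguerre_series_sums[OF assms(1) sum' _ that] by (simp add: sums_def S_def G_def)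
  have S_bound: "sqrt (w t) * \<bar>S n t\<bar> \<le> M" if "t > 0" for n t
  proof -
    have "sqrt (w t) * \<bar>S n t\<bar> \<le> sqrt (w t) * (\<Sum>k<n. \<bar>c k * laguerre_on \<alpha> k t\<bar>)"
      unfolding S_def by (intro mult_left_mono sum_abs) (simp add: w_def laguerre_weight_nonneg)
    also have "\<dots> = (\<Sum>k<n. \<bar>c k\<bar> * (sqrt (w t) * \<bar>laguerre_on_deriv \<alpha> 0 k t\<bar>))"
      by (simp add: sum_distrib_left abs_mult mult_ac)
    also have "\<dots> \<le> (\<Sum>k<n. \<bar>c k\<bar> * K)"
      using K(2)[OF that, of 0] by (intro sum_mono mult_left_mono) (auto simp: w_def)
    also have "\<dots> = K * (\<Sum>k<n. \<bar>c k\<bar>)"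
      by (simp add: sum_distrib_left mult.commute)
    also have "\<dots> \<le> M"
      unfolding M_def using K(1) sum by (intro mult_left_mono sum_le_suminf) auto
    finally show ?thesis .
  qed
  have "sqrt (w t) * \<bar>G t\<bar> \<le> M" if "t > 0" for t
  proof (rule tendsto_upperbound)
    show "(\<lambda>n. sqrt (w t) * \<bar>S n t\<bar>) \<longlonglongrightarrow> sqrt (w t) * \<bar>G t\<bar>"
      by (intro tendsto_intros S_lim that)
  qed (use S_bound[OF that] in auto)
  then show "\<exists>M. \<forall>t>0. sqrt (laguerre_weight \<alpha> t) * \<bar>laguerre_series \<alpha> c 0 t\<bar> \<le> M"
    unfolding w_def G_def by blast
  have intl: "(\<lambda>t. w t * (laguerre_on \<alpha> k t * laguerre_on \<alpha> m t)) absolutely_integrable_on {0<..}" for k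
    using laguerre_weight_integrable[of \<alpha> "laguerre_on_poly \<alpha> k * laguerre_on_poly \<alpha> m"] assms(1)
    by (simp add: w_def)
  have S_eq: "w t * S n t * laguerre_on \<alpha> m t
      = (\<Sum>k<n. c k * (w t * (laguerre_on \<alpha> k t * laguerre_on \<alpha> m t)))" for n t
    by (simp add: S_def sum_distrib_left sum_distrib_right mult_ac)
  have intS: "(\<lambda>t. w t * S n t * laguerre_on \<alpha> m t) absolutely_integrable_on {0<..}" for n
    unfolding S_eq by (intro absolutely_integrable_sum set_integrable_mult_right intl) auto
  have "(LINT t:{0<..}|lebesgue. w t * S n t * laguerre_on \<alpha> m t)
      = (\<Sum>k<n. c k * (if k = m then 1 else 0))" for n
    unfolding S_eq
    by (subst set_lebesgue_integral_sum)
       (auto intro!: set_integrable_mult_right intl sum.cong simp: laguerre_on_orthonormal[OF assms(1), folded w_def])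
  then have "(LINT t:{0<..}|lebesgue. w t * S n t * laguerre_on \<alpha> m t) = (if m < n then c m else 0)" for n
    by (simp add: sum.delta if_distrib cong: if_cong)
  moreover have "(\<lambda>n. if m < n then c m else 0) \<longlonglongrightarrow> c m"
    by (rule tendsto_eventually, rule eventually_mono[OF eventually_gt_at_top[of m]]) simp
  moreover have "(\<lambda>n. LINT t:{0<..}|lebesgue. w t * S n t * laguerre_on \<alpha> m t) \<longlonglongrightarrow>
      (LINT t:{0<..}|lebesgue. w t * G t * laguerre_on \<alpha> m t)"
    unfolding set_lebesgue_integral_def
  \<comment> \<open>One factor sqrt(w) is spent on the partial sums; the other, decaying like
    exp(-t/2), keeps the majorant integrable.\<close>
  proof (rule integral_dominated_convergence[where
        w = "\<lambda>t. indicator {0<..} t *\<^sub>R (M * \<bar>t powr (\<alpha> / 2) * exp (- (1 / 2) * t) * laguerre_on \<alpha> m t\<bar>)"])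
    show "(\<lambda>t. indicator {0<..} t *\<^sub>R (w t * G t * laguerre_on \<alpha> m t)) \<in> borel_measurable lebesgue"
    proof (fold set_borel_measurable_def, rule continuous_on_set_borel_measurable_lebesgue)
      have "continuous_on {0<..} (poly (laguerre_on_poly \<alpha> m))"
        by (intro continuous_intros)
      then show "continuous_on {0<..} (\<lambda>t. w t * G t * laguerre_on \<alpha> m t)"
        unfolding w_def laguerre_weight_def G_def
        by (intro continuous_intros laguerre_series_cont[OF assms(1) sum']) auto
    qed
    show "(\<lambda>t. indicator {0<..} t *\<^sub>R (w t * S n t * laguerre_on \<alpha> m t)) \<in> borel_measurable lebesgue" for n
      using intS[of n] unfolding set_integrable_def by (rule borel_measurable_integrable)
    have "(\<lambda>t. M * \<bar>t powr (\<alpha> / 2) * exp (- (1 / 2) * t) * laguerre_on \<alpha> m t\<bar>) absolutely_integrable_on {0<..}"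
      using powr_exp_poly_integrable[of "\<alpha> / 2" "1 / 2" "laguerre_on_poly \<alpha> m"] assms(1)
      by (intro set_integrable_mult_right set_integrable_abs) simp
    then show "integrable lebesgue
        (\<lambda>t. indicator {0<..} t *\<^sub>R (M * \<bar>t powr (\<alpha> / 2) * exp (- (1 / 2) * t) * laguerre_on \<alpha> m t\<bar>))"
      by (simp only: set_integrable_def)
    show "AE t in lebesgue. (\<lambda>n. indicator {0<..} t *\<^sub>R (w t * S n t * laguerre_on \<alpha> m t))
        \<longlonglongrightarrow> indicator {0<..} t *\<^sub>R (w t * G t * laguerre_on \<alpha> m t)"
    proof (intro AE_I2)
      fix t :: real
      show "(\<lambda>n. indicator {0<..} t *\<^sub>R (w t * S n t * laguerre_on \<alpha> m t))
        \<longlonglongrightarrow> indicator {0<..} t *\<^sub>R (w t * G t * laguerre_on \<alpha> m t)"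
        by (cases "t > 0") (auto intro!: tendsto_intros S_lim)
    qed
    show "AE t in lebesgue. norm (indicator {0<..} t *\<^sub>R (w t * S n t * laguerre_on \<alpha> m t))
        \<le> indicator {0<..} t *\<^sub>R (M * \<bar>t powr (\<alpha> / 2) * exp (- (1 / 2) * t) * laguerre_on \<alpha> m t\<bar>)" for n
    proof (intro AE_I2)
      fix t :: real
      show "norm (indicator {0<..} t *\<^sub>R (w t * S n t * laguerre_on \<alpha> m t))
        \<le> indicator {0<..} t *\<^sub>R (M * \<bar>t powr (\<alpha> / 2) * exp (- (1 / 2) * t) * laguerre_on \<alpha> m t\<bar>)"
      proof (cases "t > 0")
        case True
        have "\<bar>w t * S n t * laguerre_on \<alpha> m t\<bar>
            = (sqrt (w t) * \<bar>S n t\<bar>) * (sqrt (w t) * \<bar>laguerre_on \<alpha> m t\<bar>)"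
          by (subst laguerre_weight_eq_sqrt_mult[of \<alpha> t, folded w_def])
             (simp add: abs_mult w_def laguerre_weight_nonneg mult_ac)
        also have "\<dots> \<le> M * (sqrt (w t) * \<bar>laguerre_on \<alpha> m t\<bar>)"
          using S_bound[OF True] by (intro mult_right_mono) (auto simp: w_def laguerre_weight_nonneg)
        finally show ?thesis
          using True by (simp add: w_def sqrt_laguerre_weight abs_mult)
      qed simp
    qed
  qed
  ultimately show "(LINT t:{0<..}|lebesgue.
      laguerre_weight \<alpha> t * laguerre_series \<alpha> c 0 t * laguerre_on \<alpha> m t) = c m"
    unfolding w_def G_def using LIMSEQ_unique by simp
qed

text \<open>The weight is split evenly: one sqrt(w) bounds g, the other makes q integrable.\<close>

lemma sqrt_weight_bounded_mult_integrable:
  assumes bound: "\<And>t. t > 0 \<Longrightarrow> sqrt (laguerre_weight \<alpha> t) * \<bar>g t\<bar> \<le> M"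
    and cont: "continuous_on {0<..} g" "continuous_on {0<..} q"
    and int: "(\<lambda>t. sqrt (laguerre_weight \<alpha> t) * q t) absolutely_integrable_on {0<..}"
  shows "(\<lambda>t. laguerre_weight \<alpha> t * g t * q t) absolutely_integrable_on {0<..}"
proof (rule set_integrable_bound[OF set_integrable_mult_right[OF int, of M]])
  show "set_borel_measurable lebesgue {0<..} (\<lambda>t. laguerre_weight \<alpha> t * g t * q t)"
    unfolding laguerre_weight_def
    by (intro continuous_on_set_borel_measurable_lebesgue continuous_intros cont) auto
  show "AE t in lebesgue. t \<in> {0<..} \<longrightarrow> norm (laguerre_weight \<alpha> t * g t * q t)
      \<le> norm (M * (sqrt (laguerre_weight \<alpha> t) * q t))"
  proof (intro AE_I2 impI)
    fix t :: real assume "t \<in> {0<..}"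
    then have "t > 0" by simp
    have "\<bar>laguerre_weight \<alpha> t * g t * q t\<bar> = (sqrt (laguerre_weight \<alpha> t) * \<bar>g t\<bar>) *
        (sqrt (laguerre_weight \<alpha> t) * \<bar>q t\<bar>)"
      by (subst laguerre_weight_eq_sqrt_mult) (simp add: abs_mult laguerre_weight_nonneg mult_ac)
    also have "\<dots> \<le> \<bar>M\<bar> * (sqrt (laguerre_weight \<alpha> t) * \<bar>q t\<bar>)"
      using bound[OF \<open>t > 0\<close>] by (intro mult_right_mono) (auto simp: laguerre_weight_nonneg)
    finally show "norm (laguerre_weight \<alpha> t * g t * q t) \<le> norm (M * (sqrt (laguerre_weight \<alpha> t) * q t))"
      by (simp add: abs_mult laguerre_weight_nonneg)
  qed
qed

text \<open>Completeness of the Laguerre system: \<open>f\<close> minus its series is orthogonal to all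
  polynomials, and the exponential decay of the weight makes the moment problem determinate.\<close>

lemma laguerre_series_representative:
  assumes "\<alpha> \<ge> 0" and f: "f \<in> weighted_L2 \<alpha>"
    and sum: "summable (\<lambda>k. real k ^ r * \<bar>laguerre_coeff \<alpha> f k\<bar>)"
  shows "is_C_representative r f (laguerre_series \<alpha> (laguerre_coeff \<alpha> f) 0)"
proof -
  define c where "c = laguerre_coeff \<alpha> f"
  define w where "w = laguerre_weight \<alpha>"
  define g where "g = laguerre_series \<alpha> c 0"
  note sum = sum[folded c_def]
  have sum0: "summable (\<lambda>k. \<bar>c k\<bar>)"
  proof (rule summable_comparison_test'[OF sum])
    fix k :: nat assume "k \<ge> 1"
    then have "1 * \<bar>c k\<bar> \<le> real k ^ r * \<bar>c k\<bar>"
      by (intro mult_right_mono one_le_power) auto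
    then show "norm \<bar>c k\<bar> \<le> real k ^ r * \<bar>c k\<bar>" by simp
  qed
  obtain M where M: "\<And>t. t > 0 \<Longrightarrow> sqrt (w t) * \<bar>g t\<bar> \<le> M"
    using laguerre_series_bounded[OF assms(1) sum0] unfolding w_def g_def by blast
  have g_cont: "continuous_on {0<..} g"
    unfolding g_def using laguerre_series_cont[OF assms(1) sum] by blast
  \<comment> \<open>Growth of q below exp(t/2) is what both pairings tolerate: w q^2 and sqrt(w) q
    must be integrable. Needed with b = 0 for the moments and b = 1/4 for their determinacy.\<close>
  have int_diff: "(\<lambda>t. w t * (f t - g t) * q t) absolutely_integrable_on {0<..}"
    if q: "q = (\<lambda>t. exp (b * t) * poly p t)" "b < 1 / 2" for q b p
  proof -
    have cq: "continuous_on {0<..} q"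
      unfolding q(1) by (intro continuous_intros)
    have "(\<lambda>t. t powr \<alpha> * exp (- (1 - 2 * b) * t) * poly (p\<^sup>2) t) absolutely_integrable_on {0<..}"
      using assms(1) q(2) by (intro powr_exp_poly_integrable) auto
    moreover have "exp (- (1 - 2 * b) * t) = exp (- t) * (exp (b * t))\<^sup>2" for t
      by (simp add: power2_eq_square algebra_simps flip: exp_add)
    ultimately have "(\<lambda>t. w t * (q t)\<^sup>2) absolutely_integrable_on {0<..}"
      unfolding q(1) w_def laguerre_weight_def
      by (simp add: power_mult_distrib mult_ac)
    then have "(\<lambda>t. w t * f t * q t) absolutely_integrable_on {0<..}"
      unfolding w_def by (intro weighted_L2_mult_integrable f cq)
    moreover have "(\<lambda>t. w t * g t * q t) absolutely_integrable_on {0<..}"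
      unfolding w_def
    proof (rule sqrt_weight_bounded_mult_integrable[OF M[unfolded w_def] g_cont cq])
      have "(\<lambda>t. t powr (\<alpha> / 2) * exp (- (1 / 2 - b) * t) * poly p t) absolutely_integrable_on {0<..}"
        using assms(1) q(2) by (intro powr_exp_poly_integrable) auto
      then show "(\<lambda>t. sqrt (laguerre_weight \<alpha> t) * q t) absolutely_integrable_on {0<..}"
        by (rule set_integrable_cong[THEN iffD1, rotated 3])
           (auto simp: q(1) sqrt_laguerre_weight algebra_simps simp flip: exp_add)
    qed
    ultimately have "(\<lambda>t. w t * f t * q t - w t * g t * q t) absolutely_integrable_on {0<..}"
      by (rule set_integral_diff)
    then show ?thesis
      by (simp add: algebra_simps)
  qed
  have int_poly: "(\<lambda>t. w t * (f t - g t) * poly p t) absolutely_integrable_on {0<..}" for p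
    using int_diff[of "poly p" 0 p] by simp
  have orth: "(LINT t:{0<..}|lebesgue. w t * (f t - g t) * laguerre \<alpha> k t) = 0" for k
  proof -
    define d where "d = sqrt (fact k / Gamma (real k + \<alpha> + 1))"
    have d: "d \<noteq> 0"
      using laguerre_norm_pos[OF assms(1), of k] by (auto simp: d_def)
    have "continuous_on {0<..} (poly (laguerre_on_poly \<alpha> k))"
      by (intro continuous_intros)
    then have cl: "continuous_on {0<..} (laguerre_on \<alpha> k)" by simp
    have "(\<lambda>t. w t * f t * laguerre_on \<alpha> k t) absolutely_integrable_on {0<..}"
      using laguerre_weight_integrable[of \<alpha> "(laguerre_on_poly \<alpha> k)\<^sup>2"] assms(1) unfolding w_def
      by (intro weighted_L2_mult_integrable f cl) simp
    moreover have "(\<lambda>t. w t * g t * laguerre_on \<alpha> k t) absolutely_integrable_on {0<..}"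
      unfolding w_def
    proof (rule sqrt_weight_bounded_mult_integrable[OF M[unfolded w_def] g_cont cl])
      have "(\<lambda>t. t powr (\<alpha> / 2) * exp (- (1 / 2) * t) * poly (laguerre_on_poly \<alpha> k) t)
          absolutely_integrable_on {0<..}"
        using assms(1) by (intro powr_exp_poly_integrable) auto
      then show "(\<lambda>t. sqrt (laguerre_weight \<alpha> t) * laguerre_on \<alpha> k t) absolutely_integrable_on {0<..}"
        by (rule set_integrable_cong[THEN iffD1, rotated 3]) (auto simp: sqrt_laguerre_weight)
    qed
    ultimately have "(LINT t:{0<..}|lebesgue. w t * f t * laguerre_on \<alpha> k t - w t * g t * laguerre_on \<alpha> k t)
        = c k - c k"
      using laguerre_series_coeff[OF assms(1) sum0, of k]
      by (simp add: set_integral_diff(2) w_def g_def)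
         (simp add: c_def laguerre_coeff_def weighted_inner_def)
    then have "d * (LINT t:{0<..}|lebesgue. w t * (f t - g t) * laguerre \<alpha> k t) = 0"
      by (simp add: laguerre_on_def d_def algebra_simps flip: set_integral_mult_right)
    with d show ?thesis by simp
  qed
  \<comment> \<open>Triangularity: L_k has degree exactly k, so orthogonality to it and vanishing
    lower moments force the k-th moment to vanish.\<close>
  have moments: "(LINT t:{0<..}|lebesgue. w t * (f t - g t) * t ^ k) = 0" for k
  proof (induction k rule: less_induct)
    case (less k)
    have int_pow: "(\<lambda>t. w t * (f t - g t) * t ^ i) absolutely_integrable_on {0<..}" for i
      using int_poly[of "monom 1 i"] by (simp add: poly_monom)
    define a where "a = (\<lambda>i. coeff (laguerre_poly \<alpha> k) i)"
    have a_k: "a k \<noteq> 0"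
      by (simp add: a_def coeff_laguerre_poly)
    have "w t * (f t - g t) * laguerre \<alpha> k t = (\<Sum>i\<le>k. a i * (w t * (f t - g t) * t ^ i))" for t
      by (simp add: laguerre_def a_def coeff_laguerre_poly sum_distrib_left mult_ac)
    then have "0 = (\<Sum>i\<le>k. LINT t:{0<..}|lebesgue. a i * (w t * (f t - g t) * t ^ i))"
      using orth[of k] int_pow by (simp add: set_lebesgue_integral_sum set_integrable_mult_right)
    also have "\<dots> = (\<Sum>i\<le>k. a i * (LINT t:{0<..}|lebesgue. w t * (f t - g t) * t ^ i))"
      by (simp only: set_integral_mult_right)
    also have "\<dots> = a k * (LINT t:{0<..}|lebesgue. w t * (f t - g t) * t ^ k)"
      using less by (simp add: lessThan_Suc_atMost[symmetric])
    finally show ?case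
      using a_k by simp
  qed
  define v where "v = (\<lambda>t. indicator {0<..} t * (w t * (f t - g t)))"
  have "AE t in lebesgue. v t = 0"
  proof (rule AE_zero_if_moments_zero)
    show "integrable lebesgue (\<lambda>t. v t * t ^ k * exp (1 / 4 * t))" for k
      using int_diff[OF refl, of "1 / 4" "monom 1 k"]
      by (simp add: set_integrable_def v_def poly_monom mult_ac)
    show "(LINT t|lebesgue. v t * t ^ k) = 0" for k
      using moments[of k] by (simp add: set_lebesgue_integral_def v_def mult_ac)
  qed (auto simp: v_def)
  then have "AE t in lebesgue. 0 < t \<longrightarrow> g t = f t"
  proof (rule eventually_mono)
    fix t assume "v t = 0"
    then show "0 < t \<longrightarrow> g t = f t"
      using laguerre_weight_pos[of t \<alpha>] by (auto simp: v_def w_def)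
  qed
  moreover have "g \<in> C_class_pos r"
    unfolding g_def
    by (rule C_class_posI[where G = "laguerre_series \<alpha> c"])
       (auto intro: laguerre_series_deriv[OF assms(1) sum] laguerre_series_cont[OF assms(1) sum])
  ultimately show ?thesis
    by (simp add: is_C_representative_def g_def c_def)
qed

section \<open>Error of the summation method\<close>

lemma deriv_summation_error:
  assumes "\<alpha> \<ge> 0" "r \<ge> 1" "f \<in> weighted_L2 \<alpha>"
    and sum: "summable (\<lambda>k. real k ^ r * \<bar>laguerre_coeff \<alpha> f k\<bar>)"
    and g: "is_C_representative r f g" and "t > 0"
  shows "(deriv ^^ r) (\<lambda>x. g x - summation_method \<alpha> \<nu> N y x) t =
    laguerre_series \<alpha> (laguerre_coeff \<alpha> f) r t - (\<Sum>k\<le>N. \<nu> N k * y k * laguerre_on_deriv \<alpha> r k t)"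
proof (rule higher_deriv_eqI[where G = "\<lambda>j t. laguerre_series \<alpha> (laguerre_coeff \<alpha> f) j t
    - (\<Sum>k\<le>N. \<nu> N k * y k * laguerre_on_deriv \<alpha> j k t)"])
  fix t :: real assume "t > 0"
  then have "g t = laguerre_series \<alpha> (laguerre_coeff \<alpha> f) 0 t"
    using C_representative_unique[OF g] laguerre_series_representative[OF assms(1,3) sum] assms(2)
    by blast
  then show "g t - summation_method \<alpha> \<nu> N y t = laguerre_series \<alpha> (laguerre_coeff \<alpha> f) 0 t
      - (\<Sum>k\<le>N. \<nu> N k * y k * laguerre_on_deriv \<alpha> 0 k t)"
    by (simp add: summation_method_def)
next
  fix j t assume "j < r" "(t::real) > 0"
  then show "((\<lambda>t. laguerre_series \<alpha> (laguerre_coeff \<alpha> f) j t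
      - (\<Sum>k\<le>N. \<nu> N k * y k * laguerre_on_deriv \<alpha> j k t)) has_real_derivative
      laguerre_series \<alpha> (laguerre_coeff \<alpha> f) (Suc j) t
      - (\<Sum>k\<le>N. \<nu> N k * y k * laguerre_on_deriv \<alpha> (Suc j) k t)) (at t)"
    by (intro DERIV_diff DERIV_sum DERIV_cmult laguerre_series_deriv[OF assms(1) sum] laguerre_on_deriv_Suc)
qed (use assms in auto)

text \<open>The error splits into multiplier defect, tail and noise. The series is truncated at M to
  keep all sums finite; M goes to infinity in the main proof.\<close>

lemma summation_partial_error_le:
  fixes c d \<nu> \<xi> :: "nat \<Rightarrow> real"
  assumes d: "\<And>k. v * \<bar>d k\<bar> \<le> K * real k ^ r" and "v \<ge> 0" "r \<ge> 1" "N \<le> M"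
  shows "v * \<bar>(\<Sum>k\<le>M. c k * d k) - (\<Sum>k\<le>N. \<nu> k * (c k + \<xi> k) * d k)\<bar>
    \<le> K * ((\<Sum>k=1..N. real k ^ r * (\<bar>1 - \<nu> k\<bar> * \<bar>c k\<bar>)) + (\<Sum>k\<in>{N<..M}. real k ^ r * \<bar>c k\<bar>)
        + (\<Sum>k=1..N. real k ^ r * (\<bar>\<nu> k\<bar> * \<bar>\<xi> k\<bar>)))"
proof -
  have le: "v * \<bar>\<Sum>k\<in>A. b k * d k\<bar> \<le> K * (\<Sum>k\<in>A. real k ^ r * \<bar>b k\<bar>)" for A and b :: "nat \<Rightarrow> real"
  proof -
    have "v * \<bar>\<Sum>k\<in>A. b k * d k\<bar> \<le> v * (\<Sum>k\<in>A. \<bar>b k * d k\<bar>)"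
      using \<open>v \<ge> 0\<close> by (intro mult_left_mono sum_abs)
    also have "\<dots> = (\<Sum>k\<in>A. \<bar>b k\<bar> * (v * \<bar>d k\<bar>))"
      by (simp add: sum_distrib_left abs_mult mult_ac)
    also have "\<dots> \<le> (\<Sum>k\<in>A. \<bar>b k\<bar> * (K * real k ^ r))"
      by (intro sum_mono mult_left_mono d) auto
    finally show ?thesis
      by (simp add: sum_distrib_left mult_ac)
  qed
  \<comment> \<open>The term k = 0 carries the factor 0^r = 0; the r-th derivative kills the
    constant function.\<close>
  have drop_zero: "(\<Sum>k\<le>N. real k ^ r * b k) = (\<Sum>k=1..N. real k ^ r * b k)" for b
    using \<open>r \<ge> 1\<close> by (intro sum.mono_neutral_right) auto
  have split: "{..M} = {..N} \<union> {N<..M}"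
    using \<open>N \<le> M\<close> by auto
  have "(\<Sum>k\<le>M. c k * d k) = (\<Sum>k\<le>N. c k * d k) + (\<Sum>k\<in>{N<..M}. c k * d k)"
    unfolding split by (intro sum.union_disjoint) auto
  then have eq: "(\<Sum>k\<le>M. c k * d k) - (\<Sum>k\<le>N. \<nu> k * (c k + \<xi> k) * d k)
      = (\<Sum>k\<le>N. (1 - \<nu> k) * c k * d k) + (\<Sum>k\<in>{N<..M}. c k * d k) - (\<Sum>k\<le>N. \<nu> k * \<xi> k * d k)"
    by (simp add: algebra_simps sum.distrib sum_subtractf)
  have "v * \<bar>(\<Sum>k\<le>M. c k * d k) - (\<Sum>k\<le>N. \<nu> k * (c k + \<xi> k) * d k)\<bar> \<le> v * (\<bar>\<Sum>k\<le>N. (1 - \<nu> k) * c k * d k\<bar> + \<bar>\<Sum>k\<in>{N<..M}. c k * d k\<bar>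
      + \<bar>\<Sum>k\<le>N. \<nu> k * \<xi> k * d k\<bar>)"
    unfolding eq using \<open>v \<ge> 0\<close> by (intro mult_left_mono) auto
  also have "\<dots> = v * \<bar>\<Sum>k\<le>N. (1 - \<nu> k) * c k * d k\<bar> + v * \<bar>\<Sum>k\<in>{N<..M}. c k * d k\<bar>
      + v * \<bar>\<Sum>k\<le>N. \<nu> k * \<xi> k * d k\<bar>"
    by (simp only: distrib_left)
  also have "\<dots> \<le> K * (\<Sum>k\<le>N. real k ^ r * \<bar>(1 - \<nu> k) * c k\<bar>) + K * (\<Sum>k\<in>{N<..M}. real k ^ r * \<bar>c k\<bar>)
      + K * (\<Sum>k\<le>N. real k ^ r * \<bar>\<nu> k * \<xi> k\<bar>)"
    using le[of "\<lambda>k. (1 - \<nu> k) * c k" "{..N}"] le[of c "{N<..M}"] le[of "\<lambda>k. \<nu> k * \<xi> k" "{..N}"]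
    by linarith
  also have "\<dots> = K * ((\<Sum>k\<le>N. real k ^ r * \<bar>(1 - \<nu> k) * c k\<bar>) + (\<Sum>k\<in>{N<..M}. real k ^ r * \<bar>c k\<bar>)
      + (\<Sum>k\<le>N. real k ^ r * \<bar>\<nu> k * \<xi> k\<bar>))"
    by (simp only: distrib_left)
  finally show ?thesis
    unfolding drop_zero abs_mult .
qed

lemma powr_eq_mult_powr_weighted_coeff:
  assumes "k \<ge> 1"
  shows "real k powr a * \<bar>c\<bar> = real k powr (a - \<mu>) * \<bar>real (max 1 k) powr \<mu> * c\<bar>"
  using assms by (simp add: abs_mult max_absorb2 mult.assoc[symmetric] flip: powr_add)

theorem theorem2p5:
  fixes \<alpha> \<mu> \<theta> C a\<^sub>1 a\<^sub>2 :: real and r :: nat and s p :: ereal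
  assumes "\<alpha> \<ge> 0" and "r \<ge> 1" and "1 \<le> s" and "1 \<le> p"
    and "\<mu> > real r + 1 - recip s"
    and "\<theta> > 0" and "\<theta> > \<mu> + recip s - 1 - real r"
    and "C > 0" and "0 < a\<^sub>1" and "a\<^sub>1 \<le> a\<^sub>2"
  shows "\<exists>c>0. \<forall>\<nu> \<in> summation_class \<theta> C.
    \<forall>\<delta>::real. \<forall>f \<in> weighted_L2 \<alpha>. \<forall>\<xi> :: nat \<Rightarrow> real. \<forall>N::nat.
      0 < \<delta> \<longrightarrow> \<delta> < 1 \<longrightarrow> smoothness_norm \<alpha> s \<mu> f \<le> 1 \<longrightarrow> ell_norm p \<xi> \<le> ereal \<delta> \<longrightarrow>
      N \<ge> r \<longrightarrow>
      a\<^sub>1 * \<delta> powr (- 1 / (\<mu> + recip s - recip p)) \<le> real N \<longrightarrow>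
      real N \<le> a\<^sub>2 * \<delta> powr (- 1 / (\<mu> + recip s - recip p)) \<longrightarrow>
      (\<exists>g. is_C_representative r f g) \<and>
      (\<forall>g. is_C_representative r f g \<longrightarrow>
        C_norm (\<lambda>t. (deriv ^^ r)
                      (\<lambda>x. g x - summation_method \<alpha> \<nu> N (\<lambda>k. laguerre_coeff \<alpha> f k + \<xi> k) x) t
                    * sqrt (laguerre_weight \<alpha> t))
        \<le> ereal (c * \<delta> powr ((\<mu> + recip s - 1 - real r) / (\<mu> + recip s - recip p))))"
proof -
  \<comment> \<open>e is the decay exponent of the deterministic error, b the growth exponent of the
    noise; their sum D fixes the choice of N.\<close>
  define e where "e = \<mu> + recip s - 1 - real r"
  define b where "b = real r + 1 - recip p"
  define D where "D = \<mu> + recip s - recip p"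
  have "e > 0" "b > 0" "D = e + b"
    using assms recip_bounds[OF \<open>1 \<le> p\<close>] by (auto simp: e_def b_def D_def)
  then have "D > 0" by simp
  obtain K where K: "K > 0" "\<And>j k t. t > 0 \<Longrightarrow>
    sqrt (laguerre_weight \<alpha> t) * \<bar>laguerre_on_deriv \<alpha> j k t\<bar> \<le> K * real k ^ j"
    using laguerre_on_deriv_bound[OF assms(1)] by metis
  have exp_B1: "\<theta> + real r - \<mu> + 1 - recip s = \<theta> - e"
    by (simp add: e_def)
  \<comment> \<open>This is \<theta> > e: the order of the method exceeds the rate, so the weighted
    sum is governed by its upper end.\<close>
  have "0 < \<theta> + real r - \<mu> + 1 - recip s"
    using assms by simp
  note sum_s = ell_norm_sum_le[OF \<open>1 \<le> s\<close> this, unfolded exp_B1]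
  obtain B1 where B1: "B1 > 0" "\<And>\<delta> x N. \<delta> > 0 \<Longrightarrow> ell_norm s x \<le> ereal \<delta> \<Longrightarrow> N > 0 \<Longrightarrow>
      (\<Sum>k=1..N. real k powr (\<theta> + real r - \<mu>) * \<bar>x k\<bar>) \<le> B1 * \<delta> * real N powr (\<theta> - e)"
    by (rule sum_s) (erule that, simp)
  have exp_B2: "real r - \<mu> + 1 - recip s = - e"
    by (simp add: e_def)
  \<comment> \<open>This is e > 0, the smoothness hypothesis on \<mu>.\<close>
  have "real r - \<mu> + 1 - recip s < 0"
    using assms by simp
  note tail_s = ell_norm_tail_sum_le[OF \<open>1 \<le> s\<close> this, unfolded exp_B2]
  obtain B2 where B2: "B2 > 0" "\<And>\<delta> x N M. \<delta> > 0 \<Longrightarrow> ell_norm s x \<le> ereal \<delta> \<Longrightarrow> N > 0 \<Longrightarrow>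
      (\<Sum>k\<in>{N<..M}. real k powr (real r - \<mu>) * \<bar>x k\<bar>) \<le> B2 * \<delta> * real N powr (- e)"
    by (rule tail_s) (erule that, simp)
  obtain B3 where B3: "B3 > 0" "\<And>\<delta> x N. \<delta> > 0 \<Longrightarrow> ell_norm p x \<le> ereal \<delta> \<Longrightarrow> N > 0 \<Longrightarrow>
      (\<Sum>k=1..N. real k powr real r * \<bar>x k\<bar>) \<le> B3 * \<delta> * real N powr b"
    by (rule ell_norm_sum_le[OF \<open>1 \<le> p\<close> \<open>b > 0\<close>[unfolded b_def], folded b_def])
      (erule that, simp)
  \<comment> \<open>\<open>C * B1\<close> belongs to the multipliers, \<open>B2\<close> to the tail,
    \<open>(1 + C) * B3\<close> to the noise. The constant is fixed before \<nu>, \<delta>, f, \<xi>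
    and N.\<close>
  define c\<^sub>0 where "c\<^sub>0 = K * ((C * B1 + B2) * a\<^sub>1 powr (- e) + (1 + C) * B3 * a\<^sub>2 powr b)"
  have "c\<^sub>0 > 0"
    unfolding c\<^sub>0_def using K(1) B1(1) B2(1) B3(1) assms
    by (intro mult_pos_pos add_pos_pos) auto
  have main: "(\<exists>g. is_C_representative r f g) \<and>
      (\<forall>g. is_C_representative r f g \<longrightarrow>
        C_norm (\<lambda>t. (deriv ^^ r)
                      (\<lambda>x. g x - summation_method \<alpha> \<nu> N (\<lambda>k. laguerre_coeff \<alpha> f k + \<xi> k) x) t
                    * sqrt (laguerre_weight \<alpha> t))
        \<le> ereal (c\<^sub>0 * \<delta> powr (e / D)))"
    if \<nu>: "\<nu> \<in> summation_class \<theta> C" and f: "f \<in> weighted_L2 \<alpha>" and \<delta>: "0 < \<delta>"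
      and fs: "smoothness_norm \<alpha> s \<mu> f \<le> 1" and \<xi>: "ell_norm p \<xi> \<le> ereal \<delta>" and "N \<ge> r"
      and N1: "a\<^sub>1 * \<delta> powr (- 1 / D) \<le> real N" and N2: "real N \<le> a\<^sub>2 * \<delta> powr (- 1 / D)"
    for \<nu> \<delta> f \<xi> N
  proof -
    define c where "c = laguerre_coeff \<alpha> f"
    have "N > 0" using \<open>N \<ge> r\<close> \<open>r \<ge> 1\<close> by simp
    have x: "ell_norm s (\<lambda>k. real (max 1 k) powr \<mu> * c k) \<le> ereal 1"
      using fs smoothness_norm_eq_ell_norm[OF \<open>1 \<le> s\<close>] by (simp add: c_def one_ereal_def)
    have tail: "(\<Sum>k\<in>{N<..M}. real k ^ r * \<bar>c k\<bar>) \<le> B2 * real N powr (- e)" if "N > 0" for N M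
    proof -
      have "(\<Sum>k\<in>{N<..M}. real k ^ r * \<bar>c k\<bar>)
          = (\<Sum>k\<in>{N<..M}. real k powr (real r - \<mu>) * \<bar>real (max 1 k) powr \<mu> * c k\<bar>)"
        by (intro sum.cong refl) (subst powr_eq_mult_powr_weighted_coeff[symmetric], auto simp: powr_realpow)
      also have "\<dots> \<le> B2 * real N powr (- e)"
        using B2(2)[OF zero_less_one x that] by simp
      finally show ?thesis .
    qed
    have sum: "summable (\<lambda>k. real k ^ r * \<bar>c k\<bar>)"
    proof (rule summableI_nonneg_bounded)
      fix n
      \<comment> \<open>The tail estimate with N = 1, plus the terms k = 0 and k = 1, bounds all
        partial sums.\<close>
      have "(\<Sum>k<n. real k ^ r * \<bar>c k\<bar>) \<le> (\<Sum>k\<in>{0, 1} \<union> {1<..n}. real k ^ r * \<bar>c k\<bar>)"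
        by (intro sum_mono2) auto
      also have "\<dots> = (\<Sum>k\<in>{0, 1}. real k ^ r * \<bar>c k\<bar>) + (\<Sum>k\<in>{1<..n}. real k ^ r * \<bar>c k\<bar>)"
        by (intro sum.union_disjoint) auto
      also have "\<dots> \<le> (\<Sum>k\<in>{0, 1}. real k ^ r * \<bar>c k\<bar>) + B2 * real 1 powr (- e)"
        by (intro add_left_mono tail) simp
      finally show "(\<Sum>k<n. real k ^ r * \<bar>c k\<bar>)
          \<le> (\<Sum>k\<in>{0, 1}. real k ^ r * \<bar>c k\<bar>) + B2 * real 1 powr (- e)" .
    qed simp
    have \<nu>_bound: "\<bar>1 - \<nu> N k\<bar> \<le> C * (real k / real N) powr \<theta>" if "k \<le> N" for k
      using \<nu> that \<open>N > 0\<close> by (auto simp: summation_class_def)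
    have \<nu>_abs: "\<bar>\<nu> N k\<bar> \<le> 1 + C" if "k \<le> N" for k
    proof -
      have "(real k / real N) powr \<theta> \<le> 1"
        using that \<open>N > 0\<close> \<open>\<theta> > 0\<close> by (intro powr_le1) (auto simp: divide_le_eq)
      then have "C * (real k / real N) powr \<theta> \<le> C * 1"
        using \<open>C > 0\<close> by (intro mult_left_mono) auto
      with \<nu>_bound[OF that] show ?thesis by simp
    qed
    define E where "E = C * B1 * real N powr (- e) + B2 * real N powr (- e) + (1 + C) * B3 * \<delta> * real N powr b"
    have first: "(\<Sum>k=1..N. real k ^ r * (\<bar>1 - \<nu> N k\<bar> * \<bar>c k\<bar>)) \<le> C * B1 * real N powr (- e)"
    proof -
      \<comment> \<open>Of (k/N)^\<theta>, the factor N^(-\<theta>) stays outside and k^\<theta>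
        joins the weight; \<open>B1\<close> returns N^(\<theta>-e), so N^(-e) remains.\<close>
      have "(\<Sum>k=1..N. real k ^ r * (\<bar>1 - \<nu> N k\<bar> * \<bar>c k\<bar>))
          \<le> (\<Sum>k=1..N. C * real N powr (- \<theta>) *
              (real k powr (\<theta> + real r - \<mu>) * \<bar>real (max 1 k) powr \<mu> * c k\<bar>))"
      proof (intro sum_mono)
        fix k assume k: "k \<in> {1..N}"
        have "real k ^ r * (\<bar>1 - \<nu> N k\<bar> * \<bar>c k\<bar>)
            \<le> real k ^ r * (C * (real k / real N) powr \<theta> * \<bar>c k\<bar>)"
          using k \<nu>_bound by (intro mult_left_mono mult_right_mono) auto
        also have "\<dots> = C * real N powr (- \<theta>) * (real k powr (\<theta> + real r) * \<bar>c k\<bar>)"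
          using k by (simp add: powr_divide powr_minus_divide powr_add powr_realpow)
        also have "real k powr (\<theta> + real r) * \<bar>c k\<bar>
            = real k powr (\<theta> + real r - \<mu>) * \<bar>real (max 1 k) powr \<mu> * c k\<bar>"
          using k by (intro powr_eq_mult_powr_weighted_coeff) auto
        finally show "real k ^ r * (\<bar>1 - \<nu> N k\<bar> * \<bar>c k\<bar>) \<le> C * real N powr (- \<theta>) *
              (real k powr (\<theta> + real r - \<mu>) * \<bar>real (max 1 k) powr \<mu> * c k\<bar>)" .
      qed
      also have "\<dots> \<le> C * real N powr (- \<theta>) * (B1 * real N powr (\<theta> - e))"
        unfolding sum_distrib_left[symmetric]
        using B1(2)[OF zero_less_one x \<open>N > 0\<close>] \<open>C > 0\<close> by (intro mult_left_mono) auto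
      also have "\<dots> = C * B1 * real N powr (- e)"
        by (simp add: mult_ac flip: powr_add)
      finally show ?thesis .
    qed
    have third: "(\<Sum>k=1..N. real k ^ r * (\<bar>\<nu> N k\<bar> * \<bar>\<xi> k\<bar>)) \<le> (1 + C) * B3 * \<delta> * real N powr b"
    proof -
      have "(\<Sum>k=1..N. real k ^ r * (\<bar>\<nu> N k\<bar> * \<bar>\<xi> k\<bar>))
          \<le> (\<Sum>k=1..N. (1 + C) * (real k powr real r * \<bar>\<xi> k\<bar>))"
      proof (intro sum_mono)
        fix k assume k: "k \<in> {1..N}"
        have "real k ^ r * (\<bar>\<nu> N k\<bar> * \<bar>\<xi> k\<bar>) \<le> real k ^ r * ((1 + C) * \<bar>\<xi> k\<bar>)"
          using k \<nu>_abs by (intro mult_left_mono mult_right_mono) auto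
        then show "real k ^ r * (\<bar>\<nu> N k\<bar> * \<bar>\<xi> k\<bar>) \<le> (1 + C) * (real k powr real r * \<bar>\<xi> k\<bar>)"
          using k by (simp add: powr_realpow mult_ac)
      qed
      also have "\<dots> \<le> (1 + C) * (B3 * \<delta> * real N powr b)"
        unfolding sum_distrib_left[symmetric]
        using B3(2)[OF \<delta> \<xi> \<open>N > 0\<close>] \<open>C > 0\<close> by (intro mult_left_mono) auto
      finally show ?thesis by (simp add: mult_ac)
    qed
    \<comment> \<open>The lower bound on N controls N^(-e), the upper bound controls \<delta> N^b;
      since 1 - b/D = e/D, both give the same power of \<delta>.\<close>
    have E: "K * E \<le> c\<^sub>0 * \<delta> powr (e / D)"
    proof -
      have "real N powr (- e) \<le> (a\<^sub>1 * \<delta> powr (- 1 / D)) powr (- e)"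
        using N1 \<delta> \<open>0 < a\<^sub>1\<close> \<open>e > 0\<close> by (intro powr_mono2') auto
      also have "\<dots> = a\<^sub>1 powr (- e) * \<delta> powr (e / D)"
        using \<open>0 < a\<^sub>1\<close> by (simp add: powr_mult powr_powr)
      finally have N_neg: "real N powr (- e) \<le> a\<^sub>1 powr (- e) * \<delta> powr (e / D)" .
      have "real N powr b \<le> (a\<^sub>2 * \<delta> powr (- 1 / D)) powr b"
        using N2 \<open>b > 0\<close> by (intro powr_mono2) auto
      also have "\<dots> = a\<^sub>2 powr b * \<delta> powr (- b / D)"
        using assms by (simp add: powr_mult powr_powr)
      finally have "\<delta> * real N powr b \<le> a\<^sub>2 powr b * (\<delta> powr 1 * \<delta> powr (- b / D))"
        using \<delta> by simp
      also have "\<delta> powr 1 * \<delta> powr (- b / D) = \<delta> powr (e / D)"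
      proof -
        have "1 + - b / D = e / D"
          using \<open>D > 0\<close> \<open>D = e + b\<close> by (simp add: field_simps)
        then show ?thesis
          unfolding powr_add[symmetric] by simp
      qed
      finally have N_pos: "\<delta> * real N powr b \<le> a\<^sub>2 powr b * \<delta> powr (e / D)" .
      have "E = (C * B1 + B2) * real N powr (- e) + (1 + C) * B3 * (\<delta> * real N powr b)"
        by (simp add: E_def algebra_simps)
      also have "\<dots> \<le> (C * B1 + B2) * (a\<^sub>1 powr (- e) * \<delta> powr (e / D))
          + (1 + C) * B3 * (a\<^sub>2 powr b * \<delta> powr (e / D))"
        using N_neg N_pos \<open>C > 0\<close> B1(1) B2(1) B3(1) by (intro add_mono mult_left_mono) auto
      also have "\<dots> = ((C * B1 + B2) * a\<^sub>1 powr (- e) + (1 + C) * B3 * a\<^sub>2 powr b) * \<delta> powr (e / D)"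
        by (simp add: algebra_simps)
      finally have "K * E \<le> K * (((C * B1 + B2) * a\<^sub>1 powr (- e) + (1 + C) * B3 * a\<^sub>2 powr b) * \<delta> powr (e / D))"
        using K(1) by (intro mult_left_mono) auto
      then show ?thesis
        by (simp add: c\<^sub>0_def mult.assoc)
    qed
    have bound: "\<bar>(deriv ^^ r) (\<lambda>x. g x - summation_method \<alpha> \<nu> N (\<lambda>k. laguerre_coeff \<alpha> f k + \<xi> k) x) t
          * sqrt (laguerre_weight \<alpha> t)\<bar> \<le> c\<^sub>0 * \<delta> powr (e / D)"
      if g: "is_C_representative r f g" and t: "t > 0" for g t
    proof -
      define v where "v = sqrt (laguerre_weight \<alpha> t)"
      have "v \<ge> 0" by (simp add: v_def laguerre_weight_nonneg)
      define T where "T = (\<Sum>k\<le>N. \<nu> N k * (c k + \<xi> k) * laguerre_on_deriv \<alpha> r k t)"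
      have "v * \<bar>laguerre_series \<alpha> c r t - T\<bar> \<le> K * E"
      \<comment> \<open>Bound the truncated error uniformly in M \<ge> N and let M tend to
        infinity.\<close>
      proof (rule tendsto_upperbound)
        have "(\<lambda>M. \<Sum>k\<le>M. c k * laguerre_on_deriv \<alpha> r k t) \<longlonglongrightarrow> laguerre_series \<alpha> c r t"
          using laguerre_series_sums[OF assms(1) sum _ t, of r] by (simp add: sums_def_le)
        then show "(\<lambda>M. v * \<bar>(\<Sum>k\<le>M. c k * laguerre_on_deriv \<alpha> r k t) - T\<bar>)
            \<longlonglongrightarrow> v * \<bar>laguerre_series \<alpha> c r t - T\<bar>"
          by (intro tendsto_intros)
        have "v * \<bar>(\<Sum>k\<le>M. c k * laguerre_on_deriv \<alpha> r k t) - T\<bar> \<le> K * E" if "M \<ge> N" for M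
        proof -
          have "v * \<bar>(\<Sum>k\<le>M. c k * laguerre_on_deriv \<alpha> r k t) - T\<bar>
              \<le> K * ((\<Sum>k=1..N. real k ^ r * (\<bar>1 - \<nu> N k\<bar> * \<bar>c k\<bar>))
                + (\<Sum>k\<in>{N<..M}. real k ^ r * \<bar>c k\<bar>)
                + (\<Sum>k=1..N. real k ^ r * (\<bar>\<nu> N k\<bar> * \<bar>\<xi> k\<bar>)))"
            unfolding T_def using K(2)[OF t] \<open>v \<ge> 0\<close> \<open>r \<ge> 1\<close> that
            by (intro summation_partial_error_le) (auto simp: v_def)
          also have "\<dots> \<le> K * E"
            unfolding E_def using K(1) first tail[OF \<open>N > 0\<close>] third
            by (intro mult_left_mono add_mono) auto
          finally show ?thesis .
        qed
        then show "\<forall>\<^sub>F M in sequentially. v * \<bar>(\<Sum>k\<le>M. c k * laguerre_on_deriv \<alpha> r k t) - T\<bar> \<le> K * E"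
          using eventually_sequentially by blast
      qed simp
      moreover have "(deriv ^^ r) (\<lambda>x. g x - summation_method \<alpha> \<nu> N (\<lambda>k. laguerre_coeff \<alpha> f k + \<xi> k) x) t
          = laguerre_series \<alpha> c r t - T"
        using deriv_summation_error[OF assms(1,2) f sum[unfolded c_def] g t] by (simp add: T_def c_def)
      ultimately have "\<bar>(deriv ^^ r) (\<lambda>x. g x - summation_method \<alpha> \<nu> N (\<lambda>k. laguerre_coeff \<alpha> f k + \<xi> k) x) t
          * sqrt (laguerre_weight \<alpha> t)\<bar> \<le> K * E"
        using \<open>v \<ge> 0\<close> by (simp add: abs_mult v_def mult.commute)
      then show ?thesis using E by (rule order_trans)
    qed
    have "is_C_representative r f (laguerre_series \<alpha> c 0)"
      using laguerre_series_representative[OF assms(1) f] sum unfolding c_def by blast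
    then show ?thesis
      using bound unfolding C_norm_def by (auto intro!: SUP_least)
  qed
  show ?thesis
  proof (intro exI[of _ c\<^sub>0] conjI ballI allI impI)
    show "c\<^sub>0 > 0" by fact
  next
    fix \<nu> \<delta> f \<xi> N
    assume *: "\<nu> \<in> summation_class \<theta> C" "f \<in> weighted_L2 \<alpha>" "0 < \<delta>" "smoothness_norm \<alpha> s \<mu> f \<le> 1"
      "ell_norm p \<xi> \<le> ereal \<delta>" "r \<le> N"
      "a\<^sub>1 * \<delta> powr (- 1 / (\<mu> + recip s - recip p)) \<le> real N"
      "real N \<le> a\<^sub>2 * \<delta> powr (- 1 / (\<mu> + recip s - recip p))"
    note m = main[unfolded D_def e_def, OF *]
    show "\<exists>g. is_C_representative r f g"
      using m by blast
    show "C_norm (\<lambda>t. (deriv ^^ r)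
                      (\<lambda>x. g x - summation_method \<alpha> \<nu> N (\<lambda>k. laguerre_coeff \<alpha> f k + \<xi> k) x) t
                    * sqrt (laguerre_weight \<alpha> t))
        \<le> ereal (c\<^sub>0 * \<delta> powr ((\<mu> + recip s - 1 - real r) / (\<mu> + recip s - recip p)))"
      if "is_C_representative r f g" for g
      using m that by blast
  qed
qed

end
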